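(* Let $G(\mathcal{Y})=(G_\sigma,\psi_a,g_{a,b})$ be a complex of groups over a scwol $\mathcal{Y}$, and let $\gamma\in V(\mathcal{Y})$. Let $L(\mathcal{Y}(\gamma))$ be the local complex of groups over $\gamma$ (a complex of groups over the scwol $\mathcal{Y}(\gamma)$), let $T$ be a maximal tree in the 1-skeleton $|\mathcal{Y}(\gamma)|^{(1)}$, and let $\iota_T:L(\mathcal{Y}(\gamma))\to\pi_1(L(\mathcal{Y}(\gamma)),T)$ be the natural morphism. Then: (1) $L(\mathcal{Y}(\gamma))$ is developable; (2) the fundamental group $\pi_1(L(\mathcal{Y}(\gamma)),T)$ is (isomorphic to) the local group $G_\gamma$; and (3) the development $D(\mathcal{Y}(\gamma),\iota_T)$ is (isomorphic as a scwol to) the local development $\mathcal{Y}(\tilde\gamma)$.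
   Context: **Scwols.** A small category without loops (scwol) $\mathcal{Y}$ is a small category in which the only morphism from any object to itself is the identity. $V(\mathcal{Y})$ is its set of objects, $E(\mathcal{Y})$ its set of non-identity morphisms; $a\in E(\mathcal{Y})$ is a morphism from $i(a)$ to $t(a)$. $E^{(k)}(\mathcal{Y})$ is the set of $k$-tuples $(a_1,\dots,a_k)$ in $E(\mathcal{Y})$ with $i(a_j)=t(a_{j+1})$ for $1\le j<k$; for $(a,b)\in E^{(2)}(\mathcal{Y})$ the composite is $ab$, with $i(ab)=i(b)$, $t(ab)=t(a)$. The geometric realization $|\mathcal{Y}|$ is the complex with vertex set $V(\mathcal{Y})$ and one $k$-simplex for each element of $E^{(k)}(\mathcal{Y})$, glued in the obvious way (1-simplices $|a|$ correspond to $a\in E(\mathcal{Y})$). $\mathcal{Y}$ is simply connected if $|\mathcal{Y}|$ is. **Complexes of groups.** A complex of groups $G(\mathcal{Y})=(G_\sigma,\psi_a,g_{a,b})$ over $\mathcal{Y}$ consists of a local group $G_\sigma$ for each $\sigma\in V(\mathcal{Y})$, an injective homomorphism $\psi_a:G_{i(a)}\to G_{t(a)}$ for each $a\in E(\mathcal{Y})$, and a twisting element $g_{a,b}\in G_{t(a)}$ for each $(a,b)\in E^{(2)}(\mathcal{Y})$, such that $\mathrm{Ad}(g_{a,b})\psi_{ab}=\psi_a\psi_b$ (where $\mathrm{Ad}(g)(h)=ghg^{-1}$) and $\psi_a(g_{b,c})g_{a,bc}=g_{a,b}g_{ab,c}$ for all $(a,b,c)\in E^{(3)}(\mathcal{Y})$.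 **Morphisms.** A morphism $\phi:H(\mathcal{Y})\to G(\mathcal{X})$ over a functor $f:\mathcal{Y}\to\mathcal{X}$ sending $E(\mathcal{Y})$ to $E(\mathcal{X})$ consists of homomorphisms $\phi_\sigma:H_\sigma\to G_{f(\sigma)}$ and elements $\phi(a)\in G_{t(f(a))}$ with $\mathrm{Ad}(\phi(a))\psi_{f(a)}\phi_{i(a)}=\phi_{t(a)}\psi_a$ and $\phi_{t(a)}(h_{a,b})\phi(ab)=\phi(a)\psi_{f(a)}(\phi(b))g_{f(a),f(b)}$. It is an isomorphism if $f$ is an isomorphism and all $\phi_\sigma$ are isomorphisms. A morphism $\phi:G(\mathcal{Y})\to G$ to a group $G$ consists of homomorphisms $\phi_\sigma:G_\sigma\to G$ and elements $\phi(a)\in G$ with $\mathrm{Ad}(\phi(a))\phi_{i(a)}=\phi_{t(a)}\psi_a$ and $\phi_{t(a)}(g_{a,b})\phi(ab)=\phi(a)\phi(b)$. **Developability.** An action of a group $G$ on a scwol $\mathcal{X}$ is a homomorphism $G\to\mathrm{Aut}(\mathcal{X})$ such that for all $a\in E(\mathcal{X})$, $g\in G$: $g.i(a)\ne t(a)$, and $g.i(a)=i(a)$ implies $g.a=a$. Let $\mathcal{Y}=G\backslash\mathcal{X}$ be the quotient scwol. Choose a lift $\bar\sigma\in V(\mathcal{X})$ of each $\sigma\in V(\mathcal{Y})$; for $a\in E(\mathcal{Y})$ let $\bar a$ be the unique lift of $a$ with $i(\bar a)=\overline{i(a)}$ and choose $h_a\in G$ with $h_a.t(\bar a)=\overline{t(a)}$.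 The complex of groups associated to the action has local groups $\mathrm{Stab}_G(\bar\sigma)$, homomorphisms $\psi_a=\mathrm{Ad}(h_a)$ and twisting elements $g_{a,b}=h_ah_bh_{ab}^{-1}$. A complex of groups is developable if it arises in this way (up to isomorphism) from an action of a group on a simply connected scwol. **Fundamental group.** For $T$ a maximal tree in $|\mathcal{Y}|^{(1)}$, $\pi_1(G(\mathcal{Y}),T)$ is the group generated by $\bigsqcup_\sigma G_\sigma\sqcup\{a^+,a^-:a\in E(\mathcal{Y})\}$ subject to: the relations of each $G_\sigma$; $(a^{\pm})^{-1}=a^{\mp}$; $a^+b^+=g_{a,b}(ab)^+$ for $(a,b)\in E^{(2)}(\mathcal{Y})$; $\psi_a(g)=a^+ga^-$ for $g\in G_{i(a)}$; and $a^{\pm}=1$ if $|a|\in T$. The natural morphism $\iota_T:G(\mathcal{Y})\to\pi_1(G(\mathcal{Y}),T)$ maps each $G_\sigma$ naturally and sends $a$ to $a^+$. **Development.** For a morphism $\phi:G(\mathcal{Y})\to G$ to a group, the development $D(\mathcal{Y},\phi)$ is the scwol with objects $(g\phi_\sigma(G_\sigma),\sigma)$ for $\sigma\in V(\mathcal{Y})$, $g\in G$, and non-identity morphisms $(g\phi_{i(a)}(G_{i(a)}),a)$ for $a\in E(\mathcal{Y})$, $g\in G$, with source $(g\phi_{i(a)}(G_{i(a)}),i(a))$ and target $(g\phi(a)^{-1}\phi_{t(a)}(G_{t(a)}),t(a))$; the composite of composable $(g\phi_{i(a)}(G_{i(a)}),a)$ and $(h\phi_{i(b)}(G_{i(b)}),b)$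 is $(h\phi_{i(b)}(G_{i(b)}),ab)$. **The scwol $\mathcal{Y}(\gamma)$.** The upper link $\mathrm{Lk}_\gamma$ has objects $\{c\in E(\mathcal{Y}):t(c)=\gamma\}$ and morphisms $\{(c,d)\in E^{(2)}(\mathcal{Y}):t(c)=\gamma\}$, with $(c,d)$ going from $cd$ to $c$ and composition $(c,d)(cd,d')=(c,dd')$. The lower link $\mathrm{Lk}^\gamma$ has objects $\{b\in E(\mathcal{Y}):i(b)=\gamma\}$ and morphisms $\{(a,b)\in E^{(2)}(\mathcal{Y}):i(b)=\gamma\}$, with $(a,b)$ going from $b$ to $ab$ and composition $(a',ab)(a,b)=(a'a,b)$. $\mathcal{Y}(\gamma)$ has objects $V(\mathrm{Lk}_\gamma)\sqcup\{\gamma\}\sqcup V(\mathrm{Lk}^\gamma)$ and non-identity morphisms: those of $\mathrm{Lk}_\gamma$ and $\mathrm{Lk}^\gamma$; $\gamma*c$ from $c$ to $\gamma$; $b*c$ from $c$ to $b$; $b*\gamma$ from $\gamma$ to $b$ (for $c\in V(\mathrm{Lk}_\gamma)$, $b\in V(\mathrm{Lk}^\gamma)$). The remaining compositions are $(\gamma*c)(c,d)=\gamma*cd$, $(b*c)(c,d)=b*cd$, $(a,b)(b*c)=ab*c$, $(b*\gamma)(\gamma*c)=b*c$, $(a,b)(b*\gamma)=ab*\gamma$. **Local complex of groups $L(\mathcal{Y}(\gamma))$.** It is the complex of groups $(L_\mu,\lambda_u,l_{u,v})$ over $\mathcal{Y}(\gamma)$ with: $L_c=G_{i(c)}$ for $c\in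 V(\mathrm{Lk}_\gamma)$, $L_\gamma=G_\gamma$, $L_b=G_\gamma$ for $b\in V(\mathrm{Lk}^\gamma)$; $\lambda_{(c,d)}=\psi_d$, $\lambda_{\gamma*c}=\psi_c$, $\lambda_{b*c}=\psi_c$, $\lambda_{b*\gamma}=\mathrm{id}_{G_\gamma}$, $\lambda_{(a,b)}=\mathrm{id}_{G_\gamma}$ for $(a,b)\in E(\mathrm{Lk}^\gamma)$; $l_{(c_1,d_1),(c_2,d_2)}=g_{d_1,d_2}$ for $((c_1,d_1),(c_2,d_2))\in E^{(2)}(\mathrm{Lk}_\gamma)$, $l_{\gamma*c,(c,d)}=g_{c,d}$, $l_{b*c,(c,d)}=g_{c,d}$, and all other twisting elements (for the pairs $((a,b),b*c)$, $(b*\gamma,\gamma*c)$, $((a,b),b*\gamma)$ and pairs in $E^{(2)}(\mathrm{Lk}^\gamma)$) trivial. **Local development $\mathcal{Y}(\tilde\gamma)$.** Let $\mathrm{Lk}_{\tilde\gamma}$ be the scwol with objects $(g\psi_c(G_{i(c)}),c)$, $t(c)=\gamma$, $g\in G_\gamma$, and morphisms $(g\psi_{cd}(G_{i(d)}),c,d)$, $(c,d)\in E^{(2)}(\mathcal{Y})$, $t(c)=\gamma$, $g\in G_\gamma$, with source $(g\psi_{cd}(G_{i(d)}),cd)$, target $(gg_{c,d}^{-1}\psi_c(G_{i(c)}),c)$, and the composite of composable $(g\psi_{cd}(G_{i(d)}),c,d)$ and $(h\psi_{cdd'}(G_{i(d')}),cd,d')$ equal to $(h\psi_{cdd'}(G_{i(d')}),c,dd')$.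 $\mathcal{Y}(\tilde\gamma)$ has objects $V(\mathrm{Lk}_{\tilde\gamma})\sqcup\{\gamma\}\sqcup V(\mathrm{Lk}^\gamma)$ and non-identity morphisms: those of $\mathrm{Lk}_{\tilde\gamma}$ and $\mathrm{Lk}^\gamma$; $\gamma*x$ from $x$ to $\gamma$, $b*x$ from $x$ to $b$, $b*\gamma$ from $\gamma$ to $b$, for $x\in V(\mathrm{Lk}_{\tilde\gamma})$, $b\in V(\mathrm{Lk}^\gamma)$. Composition: as in the links, together with $(\gamma*x)e=\gamma*y$ and $(b*x)e=b*y$ for $e$ a morphism of $\mathrm{Lk}_{\tilde\gamma}$ from $y$ to $x$, $(a,b)(b*x)=ab*x$, $(b*\gamma)(\gamma*x)=b*x$, $(a,b)(b*\gamma)=ab*\gamma$. *)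

theory Defs
  imports "HOL-Homology.Simplices" "HOL-Algebra.Group_Action"
begin

section \<open>Small categories without loops\<close>

text \<open>
  A scwol is given by its objects, its non-identity morphisms and the composition of the latter;
  the identities stay implicit.  The composite \<open>ab\<close> of a pair in \<open>E\<^sup>(\<^sup>2\<^sup>)\<close> is required to be again in
  \<open>E\<close>: this is what gives a meaning to \<open>\<psi>\<^bsub>ab\<^esub>\<close>.  Outside their domains
  \<open>ini\<close>, \<open>ter\<close> and \<open>cmp\<close> are irrelevant.
\<close>

record ('v, 'e) scwol_data =
  verts :: "'v set"
  edges :: "'e set"
  ini :: "'e \<Rightarrow> 'v"
  ter :: "'e \<Rightarrow> 'v"
  cmp :: "'e \<Rightarrow> 'e \<Rightarrow> 'e"

definition scwol :: "('v, 'e) scwol_data \<Rightarrow> bool" where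
  "scwol Y \<longleftrightarrow>
     (\<forall>a\<in>edges Y. ini Y a \<in> verts Y \<and> ter Y a \<in> verts Y \<and> ini Y a \<noteq> ter Y a) \<and>
     (\<forall>a\<in>edges Y. \<forall>b\<in>edges Y. ini Y a = ter Y b \<longrightarrow>
        cmp Y a b \<in> edges Y \<and> ini Y (cmp Y a b) = ini Y b \<and> ter Y (cmp Y a b) = ter Y a) \<and>
     (\<forall>a\<in>edges Y. \<forall>b\<in>edges Y. \<forall>c\<in>edges Y. ini Y a = ter Y b \<longrightarrow> ini Y b = ter Y c \<longrightarrow>
        cmp Y (cmp Y a b) c = cmp Y a (cmp Y b c))"

definition composable2 :: "('v, 'e) scwol_data \<Rightarrow> ('e \<times> 'e) set" where
  "composable2 Y = {(a, b). a \<in> edges Y \<and> b \<in> edges Y \<and> ini Y a = ter Y b}"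

definition composable3 :: "('v, 'e) scwol_data \<Rightarrow> ('e \<times> 'e \<times> 'e) set" where
  "composable3 Y = {(a, b, c). (a, b) \<in> composable2 Y \<and> (b, c) \<in> composable2 Y}"

definition nondeg_functor ::
    "('v, 'e) scwol_data \<Rightarrow> ('w, 'f) scwol_data \<Rightarrow> ('v \<Rightarrow> 'w) \<Rightarrow> ('e \<Rightarrow> 'f) \<Rightarrow> bool" where
  "nondeg_functor Y X fv fe \<longleftrightarrow>
     fv \<in> verts Y \<rightarrow> verts X \<and> fe \<in> edges Y \<rightarrow> edges X \<and>
     (\<forall>a\<in>edges Y. ini X (fe a) = fv (ini Y a) \<and> ter X (fe a) = fv (ter Y a)) \<and>
     (\<forall>(a, b)\<in>composable2 Y. fe (cmp Y a b) = cmp X (fe a) (fe b))"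

definition scwol_iso ::
    "('v, 'e) scwol_data \<Rightarrow> ('w, 'f) scwol_data \<Rightarrow> ('v \<Rightarrow> 'w) \<Rightarrow> ('e \<Rightarrow> 'f) \<Rightarrow> bool" where
  "scwol_iso Y X fv fe \<longleftrightarrow> scwol Y \<and> scwol X \<and> nondeg_functor Y X fv fe \<and>
     bij_betw fv (verts Y) (verts X) \<and> bij_betw fe (edges Y) (edges X)"

definition scwol_isomorphic :: "('v, 'e) scwol_data \<Rightarrow> ('w, 'f) scwol_data \<Rightarrow> bool" where
  "scwol_isomorphic Y X \<longleftrightarrow> (\<exists>fv fe. scwol_iso Y X fv fe)"


section \<open>The geometric realization\<close>

text \<open>
  The simplices: \<open>Inl \<sigma>\<close> is the vertex \<open>\<sigma>\<close>, and \<open>Inr [a\<^sub>1, \<dots>, a\<^sub>k]\<close> is the \<open>k\<close>-simplex of an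
  element of \<open>E\<^sup>(\<^sup>k\<^sup>)\<close>, whose vertices, in order, are \<open>t(a\<^sub>1), i(a\<^sub>1), \<dots>, i(a\<^sub>k)\<close>.
\<close>

definition simplices :: "('v, 'e) scwol_data \<Rightarrow> ('v + 'e list) set" where
  "simplices Y = Inl ` verts Y \<union>
     Inr ` {as. as \<noteq> [] \<and> set as \<subseteq> edges Y \<and> successively (\<lambda>a b. ini Y a = ter Y b) as}"

fun simplex_dim :: "'v + 'e list \<Rightarrow> nat" where
  "simplex_dim (Inl \<sigma>) = 0"
| "simplex_dim (Inr as) = length as"

text \<open>
  The face obtained by omitting the \<open>j\<close>-th vertex; for \<open>0 < j < k\<close> this replaces
  \<open>a\<^sub>j, a\<^bsub>j+1\<^esub>\<close> (which are \<open>as ! (j - 1)\<close> and \<open>as ! j\<close>) by their composite.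
\<close>

fun simplex_face :: "('v, 'e) scwol_data \<Rightarrow> nat \<Rightarrow> 'v + 'e list \<Rightarrow> 'v + 'e list" where
  "simplex_face Y j (Inl \<sigma>) = Inl \<sigma>"
| "simplex_face Y j (Inr as) =
     (if length as \<le> 1 then Inl (if j = 0 then ini Y (hd as) else ter Y (hd as))
      else if j = 0 then Inr (tl as)
      else if j = length as then Inr (butlast as)
      else Inr (take (j - 1) as @ [cmp Y (as ! (j - 1)) (as ! j)] @ drop (j + 1) as))"

inductive glued ::
    "('v, 'e) scwol_data \<Rightarrow> ('v + 'e list) \<times> (nat \<Rightarrow> real) \<Rightarrow> ('v + 'e list) \<times> (nat \<Rightarrow> real) \<Rightarrow> bool"
  for Y where
  "\<lbrakk>s \<in> simplices Y; simplex_dim s = Suc k; j \<le> Suc k; x \<in> standard_simplex k\<rbrakk>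
     \<Longrightarrow> glued Y (simplex_face Y j s, x) (s, simplical_face j x)"

definition quotient_topology :: "'a topology \<Rightarrow> ('a \<Rightarrow> 'b) \<Rightarrow> 'b topology" where
  "quotient_topology X q =
     topology (\<lambda>U. U \<subseteq> q ` topspace X \<and> openin X {x \<in> topspace X. q x \<in> U})"

lemma istopology_quotient:
  "istopology (\<lambda>U. U \<subseteq> q ` topspace X \<and> openin X {x \<in> topspace X. q x \<in> U})"
proof -
  have 1: "{x \<in> topspace X. q x \<in> S \<inter> T} =
      {x \<in> topspace X. q x \<in> S} \<inter> {x \<in> topspace X. q x \<in> T}" for S T
    by auto
  have 2: "{x \<in> topspace X. q x \<in> \<Union>K} = \<Union>((\<lambda>S. {x \<in> topspace X. q x \<in> S}) ` K)" for K
    by auto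
  have 3: "openin X {x \<in> topspace X. q x \<in> S \<inter> T}"
    if "openin X {x \<in> topspace X. q x \<in> S}" "openin X {x \<in> topspace X. q x \<in> T}" for S T
    using that by (subst 1) (rule openin_Int)
  have 4: "openin X {x \<in> topspace X. q x \<in> \<Union>K}"
    if "\<forall>S\<in>K. openin X {x \<in> topspace X. q x \<in> S}" for K
    by (subst 2, rule openin_Union) (use that in auto)
  show ?thesis
    unfolding istopology_def
  proof (intro conjI allI impI)
    fix S T
    assume "S \<subseteq> q ` topspace X \<and> openin X {x \<in> topspace X. q x \<in> S}"
      and "T \<subseteq> q ` topspace X \<and> openin X {x \<in> topspace X. q x \<in> T}"
    then show "S \<inter> T \<subseteq> q ` topspace X" "openin X {x \<in> topspace X. q x \<in> S \<inter> T}"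
      using 3 by auto
  next
    fix K
    assume K: "\<forall>S\<in>K. S \<subseteq> q ` topspace X \<and> openin X {x \<in> topspace X. q x \<in> S}"
    then show "\<Union>K \<subseteq> q ` topspace X"
      by (meson Sup_least)
    show "openin X {x \<in> topspace X. q x \<in> \<Union>K}"
      using K by (intro 4) blast
  qed
qed

lemma openin_quotient_topology:
  "openin (quotient_topology X q) U \<longleftrightarrow>
     U \<subseteq> q ` topspace X \<and> openin X {x \<in> topspace X. q x \<in> U}"
  by (simp add: quotient_topology_def istopology_quotient)

lemma topspace_quotient_topology: "topspace (quotient_topology X q) = q ` topspace X"
proof
  show "topspace (quotient_topology X q) \<subseteq> q ` topspace X"
    using iffD1[OF openin_quotient_topology openin_topspace] by (rule conjunct1)
  have "{x \<in> topspace X. q x \<in> q ` topspace X} = topspace X"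
    by auto
  then have "openin (quotient_topology X q) (q ` topspace X)"
    by (simp add: openin_quotient_topology)
  then show "q ` topspace X \<subseteq> topspace (quotient_topology X q)"
    by (rule openin_subset)
qed

lemma quotient_map_quotient_topology: "quotient_map X (quotient_topology X q) q"
  by (simp add: quotient_map_def topspace_quotient_topology openin_quotient_topology)

definition simplex_sum :: "('v, 'e) scwol_data \<Rightarrow> (('v + 'e list) \<times> (nat \<Rightarrow> real)) topology" where
  "simplex_sum Y =
     sum_topology (\<lambda>s. subtopology (powertop_real UNIV) (standard_simplex (simplex_dim s)))
       (simplices Y)"

definition realization ::
    "('v, 'e) scwol_data \<Rightarrow> (('v + 'e list) \<times> (nat \<Rightarrow> real)) set topology" where
  "realization Y = quotient_topology (simplex_sum Y) (\<lambda>p. {q. equivclp (glued Y) p q})"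

definition simply_connected_space :: "'a topology \<Rightarrow> bool" where
  "simply_connected_space X \<longleftrightarrow> path_connected_space X \<and>
     (\<forall>p. pathin X p \<and> p 1 = p 0 \<longrightarrow>
        homotopic_with (\<lambda>r. r 0 = p 0 \<and> r 1 = p 0) (top_of_set {0..1}) X p (\<lambda>_. p 0))"

definition simply_connected_scwol :: "('v, 'e) scwol_data \<Rightarrow> bool" where
  "simply_connected_scwol Y \<longleftrightarrow> scwol Y \<and> simply_connected_space (realization Y)"


section \<open>Maximal trees in the 1-skeleton\<close>

text \<open>
  The 1-skeleton of \<open>|Y|\<close> is an undirected multigraph with vertices \<open>verts Y\<close> and edges \<open>edges Y\<close>.
  A step \<open>(a, True)\<close> of an edge path runs along \<open>|a|\<close> from \<open>i(a)\<close> to \<open>t(a)\<close>, and \<open>(a, False)\<close> runs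
  backwards.  A subgraph is a pair \<open>(W, T)\<close> of a set of vertices and a set of edges.
\<close>

fun edge_path ::
    "('v, 'e) scwol_data \<Rightarrow> 'e set \<Rightarrow> 'v \<Rightarrow> ('e \<times> bool) list \<Rightarrow> 'v \<Rightarrow> bool" where
  "edge_path Y T v [] w \<longleftrightarrow> v = w"
| "edge_path Y T v ((a, s) # p) w \<longleftrightarrow>
     a \<in> T \<and> v = (if s then ini Y a else ter Y a) \<and>
     edge_path Y T (if s then ter Y a else ini Y a) p w"

definition reduced_path :: "('e \<times> bool) list \<Rightarrow> bool" where
  "reduced_path p \<longleftrightarrow> successively (\<lambda>x y. \<not> (fst x = fst y \<and> snd x \<noteq> snd y)) p"

definition tree_in :: "('v, 'e) scwol_data \<Rightarrow> 'v set \<Rightarrow> 'e set \<Rightarrow> bool" where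
  "tree_in Y W T \<longleftrightarrow> W \<subseteq> verts Y \<and> W \<noteq> {} \<and>
     T \<subseteq> {a \<in> edges Y. ini Y a \<in> W \<and> ter Y a \<in> W} \<and>
     (\<forall>v\<in>W. \<forall>w\<in>W. \<exists>!p. edge_path Y T v p w \<and> reduced_path p)"

definition maximal_tree :: "('v, 'e) scwol_data \<Rightarrow> 'v set \<Rightarrow> 'e set \<Rightarrow> bool" where
  "maximal_tree Y W T \<longleftrightarrow> tree_in Y W T \<and>
     (\<forall>W' T'. tree_in Y W' T' \<and> W \<subseteq> W' \<and> T \<subseteq> T' \<longrightarrow> W' = W \<and> T' = T)"


section \<open>Complexes of groups and their morphisms\<close>

record ('v, 'e, 'g) cog_data =
  lgrp :: "'v \<Rightarrow> 'g monoid"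
  lhom :: "'e \<Rightarrow> 'g \<Rightarrow> 'g"
  twist :: "'e \<Rightarrow> 'e \<Rightarrow> 'g"

definition Ad :: "('g, 'm) monoid_scheme \<Rightarrow> 'g \<Rightarrow> 'g \<Rightarrow> 'g" where
  "Ad H g h = g \<otimes>\<^bsub>H\<^esub> h \<otimes>\<^bsub>H\<^esub> inv\<^bsub>H\<^esub> g"

definition complex_of_groups :: "('v, 'e) scwol_data \<Rightarrow> ('v, 'e, 'g) cog_data \<Rightarrow> bool" where
  "complex_of_groups Y G \<longleftrightarrow> scwol Y \<and>
     (\<forall>\<sigma>\<in>verts Y. group (lgrp G \<sigma>)) \<and>
     (\<forall>a\<in>edges Y. lhom G a \<in> hom (lgrp G (ini Y a)) (lgrp G (ter Y a)) \<and>
        inj_on (lhom G a) (carrier (lgrp G (ini Y a)))) \<and>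
     (\<forall>(a, b)\<in>composable2 Y. twist G a b \<in> carrier (lgrp G (ter Y a)) \<and>
        (\<forall>g\<in>carrier (lgrp G (ini Y b)).
           Ad (lgrp G (ter Y a)) (twist G a b) (lhom G (cmp Y a b) g) = lhom G a (lhom G b g))) \<and>
     (\<forall>(a, b, c)\<in>composable3 Y.
        lhom G a (twist G b c) \<otimes>\<^bsub>lgrp G (ter Y a)\<^esub> twist G a (cmp Y b c) =
        twist G a b \<otimes>\<^bsub>lgrp G (ter Y a)\<^esub> twist G (cmp Y a b) c)"

text \<open>A morphism consists of a functor \<open>(fv, fe)\<close>, homomorphisms \<open>\<phi> \<sigma>\<close> and elements \<open>\<phi>e a\<close>.\<close>

definition cog_morphism ::
    "('v, 'e) scwol_data \<Rightarrow> ('v, 'e, 'g) cog_data \<Rightarrow> ('w, 'f) scwol_data \<Rightarrow> ('w, 'f, 'h) cog_data \<Rightarrow>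
     ('v \<Rightarrow> 'w) \<Rightarrow> ('e \<Rightarrow> 'f) \<Rightarrow> ('v \<Rightarrow> 'g \<Rightarrow> 'h) \<Rightarrow> ('e \<Rightarrow> 'h) \<Rightarrow> bool" where
  "cog_morphism Y H X G fv fe \<phi> \<phi>e \<longleftrightarrow> nondeg_functor Y X fv fe \<and>
     (\<forall>\<sigma>\<in>verts Y. \<phi> \<sigma> \<in> hom (lgrp H \<sigma>) (lgrp G (fv \<sigma>))) \<and>
     (\<forall>a\<in>edges Y. \<phi>e a \<in> carrier (lgrp G (ter X (fe a))) \<and>
        (\<forall>g\<in>carrier (lgrp H (ini Y a)).
           Ad (lgrp G (ter X (fe a))) (\<phi>e a) (lhom G (fe a) (\<phi> (ini Y a) g)) =
           \<phi> (ter Y a) (lhom H a g))) \<and>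
     (\<forall>(a, b)\<in>composable2 Y.
        \<phi> (ter Y a) (twist H a b) \<otimes>\<^bsub>lgrp G (ter X (fe a))\<^esub> \<phi>e (cmp Y a b) =
        \<phi>e a \<otimes>\<^bsub>lgrp G (ter X (fe a))\<^esub> lhom G (fe a) (\<phi>e b)
          \<otimes>\<^bsub>lgrp G (ter X (fe a))\<^esub> twist G (fe a) (fe b))"

definition cog_isomorphic ::
    "('v, 'e) scwol_data \<Rightarrow> ('v, 'e, 'g) cog_data \<Rightarrow> ('w, 'f) scwol_data \<Rightarrow> ('w, 'f, 'h) cog_data \<Rightarrow> bool"
  where
  "cog_isomorphic Y H X G \<longleftrightarrow>
     (\<exists>fv fe \<phi> \<phi>e. cog_morphism Y H X G fv fe \<phi> \<phi>e \<and> scwol_iso Y X fv fe \<and>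
        (\<forall>\<sigma>\<in>verts Y. \<phi> \<sigma> \<in> iso (lgrp H \<sigma>) (lgrp G (fv \<sigma>))))"


section \<open>The fundamental group\<close>

text \<open>
  The group \<open>\<langle>S | R\<rangle>\<close>: words in letters \<open>(x, True)\<close> (for \<open>x\<close>) and \<open>(x, False)\<close> (for \<open>x\<^sup>-\<^sup>1\<close>), modulo
  the congruence generated by free cancellation and the relations \<open>l = r\<close> for \<open>(l, r) \<in> R\<close>.
\<close>

type_synonym 'x pword = "('x \<times> bool) list"

inductive pres_eq :: "'x set \<Rightarrow> ('x pword \<times> 'x pword) set \<Rightarrow> 'x pword \<Rightarrow> 'x pword \<Rightarrow> bool"
  for S R where
  refl: "w \<in> lists (S \<times> UNIV) \<Longrightarrow> pres_eq S R w w"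
| sym: "pres_eq S R u v \<Longrightarrow> pres_eq S R v u"
| trans: "pres_eq S R u v \<Longrightarrow> pres_eq S R v w \<Longrightarrow> pres_eq S R u w"
| cancel: "\<lbrakk>u \<in> lists (S \<times> UNIV); v \<in> lists (S \<times> UNIV); x \<in> S\<rbrakk>
    \<Longrightarrow> pres_eq S R (u @ [(x, s), (x, \<not> s)] @ v) (u @ v)"
| relation: "\<lbrakk>u \<in> lists (S \<times> UNIV); v \<in> lists (S \<times> UNIV); (l, r) \<in> R\<rbrakk>
    \<Longrightarrow> pres_eq S R (u @ l @ v) (u @ r @ v)"

definition pres_class :: "'x set \<Rightarrow> ('x pword \<times> 'x pword) set \<Rightarrow> 'x pword \<Rightarrow> 'x pword set" where
  "pres_class S R w = {w'. pres_eq S R w w'}"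

definition presented_group :: "'x set \<Rightarrow> ('x pword \<times> 'x pword) set \<Rightarrow> 'x pword set monoid" where
  "presented_group S R =
     \<lparr>carrier = pres_class S R ` lists (S \<times> UNIV),
      mult = (\<lambda>A B. \<Union>u\<in>A. \<Union>v\<in>B. pres_class S R (u @ v)),
      one = pres_class S R []\<rparr>"

datatype ('v, 'e, 'g) pi1_gen = Loc 'v 'g | Plus 'e | Minus 'e

type_synonym ('v, 'e, 'g) pi1_elem = "('v, 'e, 'g) pi1_gen pword set"

definition pi1_gens :: "('v, 'e) scwol_data \<Rightarrow> ('v, 'e, 'g) cog_data \<Rightarrow> ('v, 'e, 'g) pi1_gen set" where
  "pi1_gens Y G = {Loc \<sigma> g |\<sigma> g. \<sigma> \<in> verts Y \<and> g \<in> carrier (lgrp G \<sigma>)} \<union>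
     Plus ` edges Y \<union> Minus ` edges Y"

abbreviation (input) pos :: "'x \<Rightarrow> 'x \<times> bool" where "pos x \<equiv> (x, True)"
abbreviation (input) neg :: "'x \<Rightarrow> 'x \<times> bool" where "neg x \<equiv> (x, False)"

definition pi1_rels :: "('v, 'e) scwol_data \<Rightarrow> ('v, 'e, 'g) cog_data \<Rightarrow> 'e set \<Rightarrow>
    (('v, 'e, 'g) pi1_gen pword \<times> ('v, 'e, 'g) pi1_gen pword) set" where
  "pi1_rels Y G T =
     {([pos (Loc \<sigma> g), pos (Loc \<sigma> h)], [pos (Loc \<sigma> (g \<otimes>\<^bsub>lgrp G \<sigma>\<^esub> h))]) |\<sigma> g h.
        \<sigma> \<in> verts Y \<and> g \<in> carrier (lgrp G \<sigma>) \<and> h \<in> carrier (lgrp G \<sigma>)} \<union>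
     {([neg (Plus a)], [pos (Minus a)]) |a. a \<in> edges Y} \<union>
     {([neg (Minus a)], [pos (Plus a)]) |a. a \<in> edges Y} \<union>
     {([pos (Plus a), pos (Plus b)],
       [pos (Loc (ter Y a) (twist G a b)), pos (Plus (cmp Y a b))]) |a b. (a, b) \<in> composable2 Y} \<union>
     {([pos (Loc (ter Y a) (lhom G a g))],
       [pos (Plus a), pos (Loc (ini Y a) g), pos (Minus a)]) |a g.
        a \<in> edges Y \<and> g \<in> carrier (lgrp G (ini Y a))} \<union>
     {([pos (Plus a)], []) |a. a \<in> T} \<union>
     {([pos (Minus a)], []) |a. a \<in> T}"

definition pi1 :: "('v, 'e) scwol_data \<Rightarrow> ('v, 'e, 'g) cog_data \<Rightarrow> 'e set \<Rightarrow>
    ('v, 'e, 'g) pi1_elem monoid" where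
  "pi1 Y G T = presented_group (pi1_gens Y G) (pi1_rels Y G T)"

text \<open>The natural morphism \<open>\<iota>\<^sub>T\<close>, on the local groups and on \<open>E(Y)\<close>.\<close>

definition iota_grp :: "('v, 'e) scwol_data \<Rightarrow> ('v, 'e, 'g) cog_data \<Rightarrow> 'e set \<Rightarrow>
    'v \<Rightarrow> 'g \<Rightarrow> ('v, 'e, 'g) pi1_elem" where
  "iota_grp Y G T \<sigma> g = pres_class (pi1_gens Y G) (pi1_rels Y G T) [pos (Loc \<sigma> g)]"

definition iota_edge :: "('v, 'e) scwol_data \<Rightarrow> ('v, 'e, 'g) cog_data \<Rightarrow> 'e set \<Rightarrow>
    'e \<Rightarrow> ('v, 'e, 'g) pi1_elem" where
  "iota_edge Y G T a = pres_class (pi1_gens Y G) (pi1_rels Y G T) [pos (Plus a)]"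


section \<open>Actions on scwols and developability\<close>

definition scwol_action ::
    "('h, 'm) monoid_scheme \<Rightarrow> ('v, 'e) scwol_data \<Rightarrow> ('h \<Rightarrow> 'v \<Rightarrow> 'v) \<Rightarrow> ('h \<Rightarrow> 'e \<Rightarrow> 'e) \<Rightarrow> bool" where
  "scwol_action \<Gamma> X \<alpha> \<beta> \<longleftrightarrow>
     scwol X \<and> group_action \<Gamma> (verts X) \<alpha> \<and> group_action \<Gamma> (edges X) \<beta> \<and>
     (\<forall>g\<in>carrier \<Gamma>. nondeg_functor X X (\<alpha> g) (\<beta> g)) \<and>
     (\<forall>g\<in>carrier \<Gamma>. \<forall>a\<in>edges X.
        \<alpha> g (ini X a) \<noteq> ter X a \<and> (\<alpha> g (ini X a) = ini X a \<longrightarrow> \<beta> g a = a))"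

text \<open>
  On orbits, \<open>i\<close> and \<open>t\<close> are the image maps, and the composite of \<open>A\<close> and \<open>B\<close> consists of the
  composites of all composable representatives, which by the second condition on actions form a
  single orbit.
\<close>

definition quotient_scwol ::
    "('h, 'm) monoid_scheme \<Rightarrow> ('v, 'e) scwol_data \<Rightarrow> ('h \<Rightarrow> 'v \<Rightarrow> 'v) \<Rightarrow> ('h \<Rightarrow> 'e \<Rightarrow> 'e) \<Rightarrow>
     ('v set, 'e set) scwol_data" where
  "quotient_scwol \<Gamma> X \<alpha> \<beta> =
     \<lparr>verts = orbits \<Gamma> (verts X) \<alpha>,
      edges = orbits \<Gamma> (edges X) \<beta>,
      ini = (\<lambda>A. ini X ` A),
      ter = (\<lambda>A. ter X ` A),
      cmp = (\<lambda>A B. {cmp X a b |a b. a \<in> A \<and> b \<in> B \<and> ini X a = ter X b})\<rparr>"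

definition edge_lift :: "('v, 'e) scwol_data \<Rightarrow> ('v set \<Rightarrow> 'v) \<Rightarrow> 'e set \<Rightarrow> 'e" where
  "edge_lift X lift A = (THE a. a \<in> A \<and> ini X a = lift (ini X ` A))"

definition action_choices ::
    "('h, 'm) monoid_scheme \<Rightarrow> ('v, 'e) scwol_data \<Rightarrow> ('h \<Rightarrow> 'v \<Rightarrow> 'v) \<Rightarrow> ('h \<Rightarrow> 'e \<Rightarrow> 'e) \<Rightarrow>
     ('v set \<Rightarrow> 'v) \<Rightarrow> ('e set \<Rightarrow> 'h) \<Rightarrow> bool" where
  "action_choices \<Gamma> X \<alpha> \<beta> lift h \<longleftrightarrow>
     (\<forall>\<sigma>\<in>verts (quotient_scwol \<Gamma> X \<alpha> \<beta>). lift \<sigma> \<in> \<sigma>) \<and>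
     (\<forall>a\<in>edges (quotient_scwol \<Gamma> X \<alpha> \<beta>). h a \<in> carrier \<Gamma> \<and>
        \<alpha> (h a) (ter X (edge_lift X lift a)) = lift (ter (quotient_scwol \<Gamma> X \<alpha> \<beta>) a))"

definition action_cog ::
    "'h monoid \<Rightarrow> ('v, 'e) scwol_data \<Rightarrow> ('h \<Rightarrow> 'v \<Rightarrow> 'v) \<Rightarrow> ('h \<Rightarrow> 'e \<Rightarrow> 'e) \<Rightarrow>
     ('v set \<Rightarrow> 'v) \<Rightarrow> ('e set \<Rightarrow> 'h) \<Rightarrow> ('v set, 'e set, 'h) cog_data" where
  "action_cog \<Gamma> X \<alpha> \<beta> lift h =
     \<lparr>lgrp = (\<lambda>\<sigma>. \<Gamma>\<lparr>carrier := stabilizer \<Gamma> \<alpha> (lift \<sigma>)\<rparr>),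
      lhom = (\<lambda>a. Ad \<Gamma> (h a)),
      twist = (\<lambda>a b. h a \<otimes>\<^bsub>\<Gamma>\<^esub> h b \<otimes>\<^bsub>\<Gamma>\<^esub> inv\<^bsub>\<Gamma>\<^esub> h (cmp (quotient_scwol \<Gamma> X \<alpha> \<beta>) a b))\<rparr>"

text \<open>
  Since HOL has no quantification over types, the acting group and the simply connected scwol range
  over the types in which the fundamental group of \<open>G(Y)\<close> and the development of \<open>\<iota>\<^sub>T\<close> live.  This
  loses nothing: a complex of groups arising from any action on a simply connected scwol also arises
  from the action of its fundamental group on that development (Bridson--Haefliger, Chapter III.C).
\<close>

definition developable :: "('v, 'e) scwol_data \<Rightarrow> ('v, 'e, 'g) cog_data \<Rightarrow> bool" where
  "developable Y G \<longleftrightarrow> complex_of_groups Y G \<and>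
     (\<exists>(\<Gamma> :: ('v, 'e, 'g) pi1_elem monoid)
       (X :: (('v, 'e, 'g) pi1_elem set \<times> 'v, ('v, 'e, 'g) pi1_elem set \<times> 'e) scwol_data) \<alpha> \<beta> lift h.
        group \<Gamma> \<and> scwol_action \<Gamma> X \<alpha> \<beta> \<and> simply_connected_scwol X \<and>
        action_choices \<Gamma> X \<alpha> \<beta> lift h \<and>
        cog_isomorphic Y G (quotient_scwol \<Gamma> X \<alpha> \<beta>) (action_cog \<Gamma> X \<alpha> \<beta> lift h))"


section \<open>The development of a morphism to a group\<close>

text \<open>
  If \<open>A = g\<phi>(G\<^bsub>i(a)\<^esub>)\<close>, then the set product \<open>A \<phi>(a)\<^sup>-\<^sup>1 \<phi>(G\<^bsub>t(a)\<^esub>)\<close> is the coset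
  \<open>g\<phi>(a)\<^sup>-\<^sup>1\<phi>(G\<^bsub>t(a)\<^esub>)\<close>, by \<open>Ad(\<phi>(a))\<phi>\<^bsub>i(a)\<^esub> = \<phi>\<^bsub>t(a)\<^esub>\<psi>\<^sub>a\<close>.
\<close>

definition development ::
    "('v, 'e) scwol_data \<Rightarrow> ('v, 'e, 'g) cog_data \<Rightarrow> ('h, 'm) monoid_scheme \<Rightarrow>
     ('v \<Rightarrow> 'g \<Rightarrow> 'h) \<Rightarrow> ('e \<Rightarrow> 'h) \<Rightarrow> ('h set \<times> 'v, 'h set \<times> 'e) scwol_data" where
  "development Y G \<Gamma> \<phi> \<phi>e =
     \<lparr>verts = {(g <#\<^bsub>\<Gamma>\<^esub> (\<phi> \<sigma> ` carrier (lgrp G \<sigma>)), \<sigma>) |g \<sigma>. g \<in> carrier \<Gamma> \<and> \<sigma> \<in> verts Y},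
      edges = {(g <#\<^bsub>\<Gamma>\<^esub> (\<phi> (ini Y a) ` carrier (lgrp G (ini Y a))), a) |g a.
                 g \<in> carrier \<Gamma> \<and> a \<in> edges Y},
      ini = (\<lambda>(A, a). (A, ini Y a)),
      ter = (\<lambda>(A, a).
        (A <#>\<^bsub>\<Gamma>\<^esub> (inv\<^bsub>\<Gamma>\<^esub> (\<phi>e a) <#\<^bsub>\<Gamma>\<^esub> (\<phi> (ter Y a) ` carrier (lgrp G (ter Y a)))), ter Y a)),
      cmp = (\<lambda>(A, a) (B, b). (B, cmp Y a b))\<rparr>"


section \<open>The local complex of groups and the local development\<close>

definition upper_link :: "('v, 'e) scwol_data \<Rightarrow> 'v \<Rightarrow> ('e, 'e \<times> 'e) scwol_data" where
  "upper_link Y \<gamma> =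
     \<lparr>verts = {c \<in> edges Y. ter Y c = \<gamma>},
      edges = {(c, d) \<in> composable2 Y. ter Y c = \<gamma>},
      ini = (\<lambda>(c, d). cmp Y c d),
      ter = (\<lambda>(c, d). c),
      cmp = (\<lambda>(c, d) (_, d'). (c, cmp Y d d'))\<rparr>"

definition lower_link :: "('v, 'e) scwol_data \<Rightarrow> 'v \<Rightarrow> ('e, 'e \<times> 'e) scwol_data" where
  "lower_link Y \<gamma> =
     \<lparr>verts = {b \<in> edges Y. ini Y b = \<gamma>},
      edges = {(a, b) \<in> composable2 Y. ini Y b = \<gamma>},
      ini = (\<lambda>(a, b). b),
      ter = (\<lambda>(a, b). cmp Y a b),
      cmp = (\<lambda>(a', _) (a, b). (cmp Y a' a, b))\<rparr>"

text \<open>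
  The scwols \<open>Y(\<gamma>)\<close> and \<open>Y(\<gamma>~)\<close> are built in the same way, from the upper link of \<open>\<gamma>\<close>
  and of \<open>\<gamma>~\<close> respectively, and the lower link of \<open>\<gamma>\<close>.  Here \<open>Apex\<close> is \<open>\<gamma>\<close>, and
  \<open>ApexUp x\<close>, \<open>LowUp b x\<close>, \<open>LowApex b\<close> are the morphisms \<open>\<gamma>*x\<close>, \<open>b*x\<close>, \<open>b*\<gamma>\<close>.
\<close>

datatype ('u, 'b) jvert = Up 'u | Apex | Low 'b

datatype ('u, 'm, 'b, 'k) jedge = UpE 'm | LowE 'k | ApexUp 'u | LowUp 'b 'u | LowApex 'b

fun join_ini :: "('u, 'm) scwol_data \<Rightarrow> ('b, 'k) scwol_data \<Rightarrow>
    ('u, 'm, 'b, 'k) jedge \<Rightarrow> ('u, 'b) jvert" where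
  "join_ini U L (UpE e) = Up (ini U e)"
| "join_ini U L (LowE f) = Low (ini L f)"
| "join_ini U L (ApexUp x) = Up x"
| "join_ini U L (LowUp b x) = Up x"
| "join_ini U L (LowApex b) = Apex"

fun join_ter :: "('u, 'm) scwol_data \<Rightarrow> ('b, 'k) scwol_data \<Rightarrow>
    ('u, 'm, 'b, 'k) jedge \<Rightarrow> ('u, 'b) jvert" where
  "join_ter U L (UpE e) = Up (ter U e)"
| "join_ter U L (LowE f) = Low (ter L f)"
| "join_ter U L (ApexUp x) = Apex"
| "join_ter U L (LowUp b x) = Low b"
| "join_ter U L (LowApex b) = Low b"

fun join_cmp :: "('u, 'm) scwol_data \<Rightarrow> ('b, 'k) scwol_data \<Rightarrow>
    ('u, 'm, 'b, 'k) jedge \<Rightarrow> ('u, 'm, 'b, 'k) jedge \<Rightarrow> ('u, 'm, 'b, 'k) jedge" where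
  "join_cmp U L (UpE e) (UpE e') = UpE (cmp U e e')"
| "join_cmp U L (LowE f) (LowE f') = LowE (cmp L f f')"
| "join_cmp U L (ApexUp x) (UpE e) = ApexUp (ini U e)"
| "join_cmp U L (LowUp b x) (UpE e) = LowUp b (ini U e)"
| "join_cmp U L (LowE f) (LowUp b x) = LowUp (ter L f) x"
| "join_cmp U L (LowApex b) (ApexUp x) = LowUp b x"
| "join_cmp U L (LowE f) (LowApex b) = LowApex (ter L f)"
| "join_cmp U L _ _ = undefined"

definition link_join :: "('u, 'm) scwol_data \<Rightarrow> ('b, 'k) scwol_data \<Rightarrow>
    (('u, 'b) jvert, ('u, 'm, 'b, 'k) jedge) scwol_data" where
  "link_join U L =
     \<lparr>verts = Up ` verts U \<union> {Apex} \<union> Low ` verts L,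
      edges = UpE ` edges U \<union> LowE ` edges L \<union> ApexUp ` verts U \<union>
        {LowUp b x |b x. b \<in> verts L \<and> x \<in> verts U} \<union> LowApex ` verts L,
      ini = join_ini U L,
      ter = join_ter U L,
      cmp = join_cmp U L\<rparr>"

definition local_scwol :: "('v, 'e) scwol_data \<Rightarrow> 'v \<Rightarrow>
    (('e, 'e) jvert, ('e, 'e \<times> 'e, 'e, 'e \<times> 'e) jedge) scwol_data" where
  "local_scwol Y \<gamma> = link_join (upper_link Y \<gamma>) (lower_link Y \<gamma>)"

fun local_grp :: "('v, 'e) scwol_data \<Rightarrow> ('v, 'e, 'g) cog_data \<Rightarrow> 'v \<Rightarrow>
    ('e, 'e) jvert \<Rightarrow> 'g monoid" where
  "local_grp Y G \<gamma> (Up c) = lgrp G (ini Y c)"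
| "local_grp Y G \<gamma> Apex = lgrp G \<gamma>"
| "local_grp Y G \<gamma> (Low b) = lgrp G \<gamma>"

fun local_hom :: "('v, 'e, 'g) cog_data \<Rightarrow>
    ('e, 'e \<times> 'e, 'e, 'e \<times> 'e) jedge \<Rightarrow> 'g \<Rightarrow> 'g" where
  "local_hom G (UpE (c, d)) = lhom G d"
| "local_hom G (ApexUp c) = lhom G c"
| "local_hom G (LowUp b c) = lhom G c"
| "local_hom G (LowApex b) = id"
| "local_hom G (LowE (a, b)) = id"

fun local_twist :: "('v, 'e, 'g) cog_data \<Rightarrow> 'v \<Rightarrow>
    ('e, 'e \<times> 'e, 'e, 'e \<times> 'e) jedge \<Rightarrow> ('e, 'e \<times> 'e, 'e, 'e \<times> 'e) jedge \<Rightarrow> 'g" where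
  "local_twist G \<gamma> (UpE (c1, d1)) (UpE (c2, d2)) = twist G d1 d2"
| "local_twist G \<gamma> (ApexUp c') (UpE (c, d)) = twist G c d"
| "local_twist G \<gamma> (LowUp b c') (UpE (c, d)) = twist G c d"
| "local_twist G \<gamma> _ _ = \<one>\<^bsub>lgrp G \<gamma>\<^esub>"

definition local_cog :: "('v, 'e) scwol_data \<Rightarrow> ('v, 'e, 'g) cog_data \<Rightarrow> 'v \<Rightarrow>
    (('e, 'e) jvert, ('e, 'e \<times> 'e, 'e, 'e \<times> 'e) jedge, 'g) cog_data" where
  "local_cog Y G \<gamma> =
     \<lparr>lgrp = local_grp Y G \<gamma>, lhom = local_hom G, twist = local_twist G \<gamma>\<rparr>"

text \<open>As for the development, the target is written as a set product of \<open>g\<psi>\<^bsub>cd\<^esub>(G\<^bsub>i(d)\<^esub>)\<close> with a coset.\<close>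

definition upper_link_dev :: "('v, 'e) scwol_data \<Rightarrow> ('v, 'e, 'g) cog_data \<Rightarrow> 'v \<Rightarrow>
    ('g set \<times> 'e, 'g set \<times> 'e \<times> 'e) scwol_data" where
  "upper_link_dev Y G \<gamma> =
     \<lparr>verts = {(g <#\<^bsub>lgrp G \<gamma>\<^esub> (lhom G c ` carrier (lgrp G (ini Y c))), c) |g c.
                 g \<in> carrier (lgrp G \<gamma>) \<and> c \<in> edges Y \<and> ter Y c = \<gamma>},
      edges = {(g <#\<^bsub>lgrp G \<gamma>\<^esub> (lhom G (cmp Y c d) ` carrier (lgrp G (ini Y d))), c, d) |g c d.
                 g \<in> carrier (lgrp G \<gamma>) \<and> (c, d) \<in> composable2 Y \<and> ter Y c = \<gamma>},
      ini = (\<lambda>(A, c, d). (A, cmp Y c d)),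
      ter = (\<lambda>(A, c, d).
        (A <#>\<^bsub>lgrp G \<gamma>\<^esub> (inv\<^bsub>lgrp G \<gamma>\<^esub> (twist G c d) <#\<^bsub>lgrp G \<gamma>\<^esub>
           (lhom G c ` carrier (lgrp G (ini Y c)))), c)),
      cmp = (\<lambda>(A, c, d) (B, _, d'). (B, c, cmp Y d d'))\<rparr>"

definition local_development :: "('v, 'e) scwol_data \<Rightarrow> ('v, 'e, 'g) cog_data \<Rightarrow> 'v \<Rightarrow>
    (('g set \<times> 'e, 'e) jvert, ('g set \<times> 'e, 'g set \<times> 'e \<times> 'e, 'e, 'e \<times> 'e) jedge) scwol_data" where
  "local_development Y G \<gamma> = link_join (upper_link_dev Y G \<gamma>) (lower_link Y \<gamma>)"

end

theory Submission
  imports Defs "HOL-Analysis.Abstract_Topological_Spaces"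
begin

text \<open>
  Write \<open>L\<close> for the local complex of groups.  The homomorphisms \<open>\<psi>\<^sub>c\<close> on the upper link and the
  identity of \<open>G\<^sub>\<gamma>\<close> elsewhere, together with the elements \<open>g\<^bsub>c,d\<^esub>\<close> on the morphisms \<open>(c, d)\<close> of the
  upper link and \<open>1\<close> on all others, form a morphism \<open>\<phi>\<close> from \<open>L\<close> to \<open>G\<^sub>\<gamma>\<close> which is injective on the
  local groups.  Elements \<open>k\<^sub>v\<close> of \<open>G\<^sub>\<gamma>\<close> with \<open>k\<^sub>t \<phi>(a) k\<^sub>i\<^sup>-\<^sup>1 = 1\<close> on the tree conjugate \<open>\<phi>\<close> to a morphism
  that factors through \<open>\<pi>\<^sub>1(L, T)\<close>.  The resulting homomorphism to \<open>G\<^sub>\<gamma>\<close> is inverse to the inclusion of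
  the local group at the vertex \<open>\<gamma>\<close>, because every vertex of \<open>Y(\<gamma>)\<close> is joined to \<open>\<gamma>\<close> by an edge.
  Under this isomorphism the development of \<open>\<iota>\<^sub>T\<close> becomes that of \<open>\<phi>\<close>, which is the local development
  up to relabelling.  The latter is a cone with apex \<open>\<gamma>\<close>: its realization contracts along straight lines
  to the apex, so it is simply connected, and \<open>L\<close> arises from the action of \<open>\<pi>\<^sub>1(L, T)\<close> on the
  development of \<open>\<iota>\<^sub>T\<close>.
\<close>

section \<open>Coning off a scwol\<close>

text \<open>For the star of \<gamma>, formed by the edges \<open>ApexUp c\<close> and
  \<open>LowApex b\<close>, \<phi> is already trivial on the tree. An arbitrary maximal tree may
  contain edges \<open>(c, d)\<close> of the upper link, where \<phi> takes the value
  \<open>twist G c d\<close>, which may differ from 1; this is what the conjugating elements repair.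
  Inside the fundamental group the edges of the star move every local group to the one at \<gamma>,
  whatever the tree is, and comparing them with the conjugating elements shows that the inclusion of
  the local group at \<gamma> is onto. Injectivity of \<phi> serves twice: it pulls the axioms of a
  complex of groups for \<open>L\<close> back from identities in a group, and it identifies the
  stabilizers in the development with the local groups. The contraction of a cone has to respect the
  gluing of simplices. The apex lies in the middle of the order, with lower vertices on one side and
  upper ones on the other, so coning a simplex may split one of its edges, and the simplex may
  already contain the apex. Hence the bookkeeping with chains and positions.\<close>

text \<open>
  A loop \<open>p\<close> is the bottom edge of the square \<open>(s, t) \<mapsto> H (t, p s)\<close>.  Push it across the square to the
  other three edges: the top edge is constant, so the result runs up and down the track of \<open>p 0\<close>.
\<close>

lemma simply_connected_space_contraction:
  assumes H: "continuous_map (prod_topology (top_of_set {0..1::real}) X) X H"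
    and H0: "\<And>x. x \<in> topspace X \<Longrightarrow> H (0, x) = x"
    and H1: "\<And>x. x \<in> topspace X \<Longrightarrow> H (1, x) = z"
  shows "simply_connected_space X"
  unfolding simply_connected_space_def
proof (intro conjI allI impI)
  have path: "path_component_of X x z" if x: "x \<in> topspace X" for x
  proof -
    have "pathin X (\<lambda>t. H (t, x))"
      unfolding pathin_def
      by (rule continuous_map_compose[OF _ H, unfolded o_def])
        (use x in \<open>auto intro: continuous_map_pairedI\<close>)
    then show ?thesis
      unfolding path_component_of_def using H0[OF x] H1[OF x] by fastforce
  qed
  then show "path_connected_space X"
    by (metis path_connected_space_iff_path_component path_component_of_sym path_component_of_trans)
next
  fix p assume p: "pathin X p \<and> p 1 = p 0"
  let ?I = "top_of_set {0..1::real}"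
  let ?P = "\<lambda>r. r 0 = p 0 \<and> r 1 = p 0"
  let ?F = "\<lambda>w::real \<times> real. H (snd w, p (fst w))"
  \<comment> \<open>The point \<open>(?c s, ?m s)\<close> runs through the left, top and right edges
    of the square, each in one third of the time. It starts at \<open>(0, 0)\<close> and ends at
    \<open>(1, 0)\<close>, as the bottom edge does.\<close>
  let ?m = "\<lambda>s::real. min 1 (min (3 * s) (3 - 3 * s))"
  let ?c = "\<lambda>s::real. max 0 (min 1 (3 * s - 1))"
  have cp: "continuous_map ?I X p"
    using p by (simp add: pathin_def)
  have pX: "p s \<in> topspace X" if "s \<in> {0..1}" for s
    using cp that by (auto simp: continuous_map_def)
  have FX: "continuous_map (top_of_set ({0..1} \<times> {0..1})) X ?F"
  proof -
    have "continuous_map (prod_topology ?I ?I) X (H \<circ> (\<lambda>w. (snd w, p (fst w))))"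
      by (rule continuous_map_compose[OF _ H])
        (intro continuous_map_pairedI continuous_map_snd
           continuous_map_compose[OF continuous_map_fst cp, unfolded o_def])
    then show ?thesis
      by (simp add: o_def prod_topology_subtopology_eu)
  qed
  have pull: "continuous_map (prod_topology ?I ?I) X (\<lambda>w. ?F (k w))"
    if "continuous_on ({0..1} \<times> {0..1}) k" "k ` ({0..1} \<times> {0..1}) \<subseteq> {0..1} \<times> {0..1}" for k
  proof -
    have "continuous_map (top_of_set ({0..1} \<times> {0..1})) (top_of_set ({0..1} \<times> {0..1})) k"
      using that by (auto simp: continuous_map_in_subtopology)
    from continuous_map_compose[OF this FX] show ?thesis
      by (simp add: o_def prod_topology_subtopology_eu)
  qed
  have convex: "(1 - u) * a + u * b \<in> {0..1}" if "u \<in> {0..1}" "a \<in> {0..1}" "b \<in> {0..1}" for u a b :: real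
    using that convex_bound_le[of a 1 b "1 - u" u] by auto
  have mc: "?m s \<in> {0..1}" "?c s \<in> {0..1}" if "s \<in> {0..1}" for s
    using that by auto
  \<comment> \<open>The square is convex, so straight segments join the two paths and keep both ends
    fixed. Applying \<open>H\<close> to the loop directly would not do, as \<open>H\<close> may move
    the base point.\<close>
  have 1: "homotopic_with ?P ?I X p (\<lambda>s. H (?m s, p 0))"
  proof (subst homotopic_with, force, intro exI[of _ "\<lambda>w. ?F ((1 - fst w) * snd w + fst w * ?c (snd w), fst w * ?m (snd w))"] conjI ballI)
    show "continuous_map (prod_topology ?I ?I) X
      (\<lambda>w. ?F ((1 - fst w) * snd w + fst w * ?c (snd w), fst w * ?m (snd w)))"
    proof (rule pull)
      show "continuous_on ({0..1} \<times> {0..1})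
         (\<lambda>w. ((1 - fst w) * snd w + fst w * ?c (snd w), fst w * ?m (snd w)))"
        by (intro continuous_intros)
      show "(\<lambda>w. ((1 - fst w) * snd w + fst w * ?c (snd w), fst w * ?m (snd w))) ` ({0..1} \<times> {0..1})
        \<subseteq> {0..1} \<times> {0..1}"
      proof (rule image_subsetI)
        fix w :: "real \<times> real" assume "w \<in> {0..1} \<times> {0..1}"
        then obtain u s where w: "w = (u, s)" and "u \<in> {0..1}" "s \<in> {0..1}" by blast
        with convex[of u s "?c s"] convex[of u 0 "?m s"] mc[of s]
        show "((1 - fst w) * snd w + fst w * ?c (snd w), fst w * ?m (snd w)) \<in> {0..1} \<times> {0..1}"
          by (simp add: w)
      qed
    qed
  next
    fix s assume "s \<in> topspace ?I"
    then have s: "s \<in> {0..1}" by simp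
    show "?F ((1 - fst (0, s)) * snd (0, s) + fst (0, s) * ?c (snd (0, s)), fst (0, s) * ?m (snd (0, s))) = p s"
      using H0[OF pX[OF s]] by simp
    \<comment> \<open>On the outer thirds \<open>p (?c s)\<close> is \<open>p 0\<close> or
      \<open>p 1\<close>, which are equal; on the middle third the height is 1 and \<open>H\<close>
      is constantly \<open>z\<close>.\<close>
    consider "s \<le> 1/3" | "1/3 \<le> s" "s \<le> 2/3" | "2/3 \<le> s" by linarith
    then show "?F ((1 - fst (1, s)) * snd (1, s) + fst (1, s) * ?c (snd (1, s)), fst (1, s) * ?m (snd (1, s)))
       = H (?m s, p 0)"
    proof cases
      case 1
      then show ?thesis by simp
    next
      case 2
      then have "?m s = 1" by simp
      then show ?thesis using H1[OF pX[OF mc(2)[OF s]]] H1[OF pX[of 0]] by simp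
    next
      case 3
      then have "?c s = 1" by simp
      then show ?thesis using p by simp
    qed
  next
    fix u :: real
    show "?F ((1 - fst (u, 0)) * snd (u, 0) + fst (u, 0) * ?c (snd (u, 0)), fst (u, 0) * ?m (snd (u, 0))) = p 0"
      using H0[OF pX[of 0]] by simp
    show "?F ((1 - fst (u, 1)) * snd (u, 1) + fst (u, 1) * ?c (snd (u, 1)), fst (u, 1) * ?m (snd (u, 1))) = p 0"
      using H0[OF pX[of 1]] p by simp
  qed
  \<comment> \<open>Scaling the height by \<open>1 - u\<close> shrinks the out-and-back path to its
    start.\<close>
  have 2: "homotopic_with ?P ?I X (\<lambda>s. H (?m s, p 0)) (\<lambda>_. p 0)"
  proof (subst homotopic_with, force, intro exI[of _ "\<lambda>w. ?F (0, (1 - fst w) * ?m (snd w))"] conjI ballI)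
    show "continuous_map (prod_topology ?I ?I) X (\<lambda>w. ?F (0, (1 - fst w) * ?m (snd w)))"
    proof (rule pull)
      show "continuous_on ({0..1} \<times> {0..1}) (\<lambda>w. (0, (1 - fst w) * ?m (snd w)))"
        by (intro continuous_intros)
      show "(\<lambda>w. (0, (1 - fst w) * ?m (snd w))) ` ({0..1} \<times> {0..1}) \<subseteq> {0..1::real} \<times> {0..1}"
      proof (rule image_subsetI)
        fix w :: "real \<times> real" assume "w \<in> {0..1} \<times> {0..1}"
        then obtain u s where w: "w = (u, s)" and "u \<in> {0..1}" "s \<in> {0..1}" by blast
        with convex[of u "?m s" 0] mc[of s]
        show "(0, (1 - fst w) * ?m (snd w)) \<in> {0..1::real} \<times> {0..1}"
          by (simp add: w)
      qed
    qed
  qed (use H0[OF pX[of 0]] in auto)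
  show "homotopic_with ?P ?I X p (\<lambda>_. p 0)"
    by (rule homotopic_with_trans[OF 1 2])
qed

section \<open>Chains, their simplices and their faces\<close>

lemma scwolD:
  assumes "scwol X"
  shows "\<And>a. a \<in> edges X \<Longrightarrow> ini X a \<in> verts X \<and> ter X a \<in> verts X \<and> ini X a \<noteq> ter X a"
    and "\<And>a b. \<lbrakk>a \<in> edges X; b \<in> edges X; ini X a = ter X b\<rbrakk> \<Longrightarrow>
       cmp X a b \<in> edges X \<and> ini X (cmp X a b) = ini X b \<and> ter X (cmp X a b) = ter X a"
    and "\<And>a b c. \<lbrakk>a \<in> edges X; b \<in> edges X; c \<in> edges X; ini X a = ter X b; ini X b = ter X c\<rbrakk> \<Longrightarrow>
       cmp X (cmp X a b) c = cmp X a (cmp X b c)"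
  using assms by (auto simp: scwol_def)

text \<open>
  A simplex is coded by its first vertex \<open>v = t(a\<^sub>1)\<close> and the list \<open>a\<^sub>1, \<dots>, a\<^sub>k\<close>, which treats vertices
  and simplices of positive dimension alike.
\<close>

fun chain :: "('v, 'e) scwol_data \<Rightarrow> 'v \<Rightarrow> 'e list \<Rightarrow> bool" where
  "chain X v [] \<longleftrightarrow> v \<in> verts X"
| "chain X v (a # as) \<longleftrightarrow> a \<in> edges X \<and> ter X a = v \<and> chain X (ini X a) as"

definition simplex_of :: "'v \<Rightarrow> 'e list \<Rightarrow> 'v + 'e list" where
  "simplex_of v as = (if as = [] then Inl v else Inr as)"

fun face_top :: "('v, 'e) scwol_data \<Rightarrow> nat \<Rightarrow> 'v \<Rightarrow> 'e list \<Rightarrow> 'v" where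
  "face_top X j v [] = v"
| "face_top X j v (a # as) = (if j = 0 then ini X a else v)"

text \<open>\<open>simplex_face\<close> cuts lists with \<open>take\<close> and \<open>drop\<close>;
  this recursive form can be followed along inductions over chains. The index counts vertices, of
  which there is one more than edges.\<close>

fun face_edges :: "('v, 'e) scwol_data \<Rightarrow> nat \<Rightarrow> 'e list \<Rightarrow> 'e list" where
  "face_edges X j [] = []"
| "face_edges X 0 (a # as) = as"
| "face_edges X (Suc j) [a] = []"
| "face_edges X (Suc 0) (a # b # as) = cmp X a b # as"
| "face_edges X (Suc (Suc j)) (a # b # as) = a # face_edges X (Suc j) (b # as)"

lemma chain_start: "scwol X \<Longrightarrow> chain X v as \<Longrightarrow> v \<in> verts X"
  by (cases as) (auto dest: scwolD)

lemma chain_iff: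
  assumes "scwol X" "as \<noteq> []"
  shows "chain X v as \<longleftrightarrow> set as \<subseteq> edges X \<and> successively (\<lambda>a b. ini X a = ter X b) as \<and> v = ter X (hd as)"
  using assms(2)
proof (induction as arbitrary: v)
  case (Cons a as)
  then show ?case
    using scwolD(1)[OF assms(1)] by (cases as) auto
qed simp

lemma simplices_eq:
  assumes "scwol X"
  shows "simplices X = {simplex_of v as |v as. chain X v as}"
proof (intro equalityI subsetI)
  fix s assume "s \<in> simplices X"
  then consider v where "v \<in> verts X" "s = Inl v"
    | as where "as \<noteq> []" "set as \<subseteq> edges X" "successively (\<lambda>a b. ini X a = ter X b) as" "s = Inr as"
    by (auto simp: simplices_def)
  then show "s \<in> {simplex_of v as |v as. chain X v as}"
  proof cases
    case (1 v)
    then show ?thesis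
      by (auto simp: simplex_of_def intro!: exI[of _ v] exI[of _ "[]"])
  next
    case (2 as)
    then have "chain X (ter X (hd as)) as"
      by (subst chain_iff[OF assms]) auto
    with 2 show ?thesis
      by (auto simp: simplex_of_def intro!: exI[of _ "ter X (hd as)"] exI[of _ as])
  qed
next
  fix s assume "s \<in> {simplex_of v as |v as. chain X v as}"
  then obtain v as where "s = simplex_of v as" "chain X v as" by blast
  then show "s \<in> simplices X"
    using chain_iff[OF assms, of as v] by (cases "as = []") (auto simp: simplices_def simplex_of_def)
qed

lemma simplex_dim_simplex_of [simp]: "simplex_dim (simplex_of v as) = length as"
  by (simp add: simplex_of_def)

lemma face_edges_last: "face_edges X (length as) as = butlast as"
  by (induction X "length as" as rule: face_edges.induct) auto

lemma face_edges_inner: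
  "0 < j \<Longrightarrow> j < length as \<Longrightarrow>
    face_edges X j as = take (j - 1) as @ [cmp X (as ! (j - 1)) (as ! j)] @ drop (j + 1) as"
  by (induction X j as rule: face_edges.induct) auto

lemma length_face_edges: "j \<le> length as \<Longrightarrow> length (face_edges X j as) = length as - 1"
  by (induction X j as rule: face_edges.induct) auto

lemma simplex_face_simplex_of:
  assumes "chain X v as" "as \<noteq> []" "j \<le> length as"
  shows "simplex_face X j (simplex_of v as) = simplex_of (face_top X j v as) (face_edges X j as)"
proof (cases "length as = 1")
  case True
  then obtain a where "as = [a]" by (auto simp: length_Suc_conv)
  then show ?thesis
    using assms by (cases j) (auto simp: simplex_of_def)
next
  case False
  then have len: "length as > 1" using assms by (cases as) auto
  then have ne: "face_edges X j as \<noteq> []"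
    using length_face_edges[OF assms(3), of X] by auto
  consider "j = 0" | "j = length as" "0 < j" | "0 < j" "j < length as" using assms by linarith
  then show ?thesis
  proof cases
    case 1
    with len ne show ?thesis by (cases as) (auto simp: simplex_of_def)
  next
    case 2
    with len ne show ?thesis by (auto simp: simplex_of_def face_edges_last)
  next
    case 3
    with len ne show ?thesis by (auto simp: simplex_of_def face_edges_inner)
  qed
qed

text \<open>
  \<open>X\<close> is a cone over its other vertices: each of them is joined to \<open>z\<close> by exactly one edge, in one
  direction or the other, and morphisms from a vertex above \<open>z\<close> to one below factor through \<open>z\<close>.
\<close>

locale cone =
  fixes X :: "('v, 'e) scwol_data" and z :: 'v
  assumes scwol: "scwol X" and apex: "z \<in> verts X"
    and spoke_ex1: "\<And>v. v \<in> verts X \<Longrightarrow> v \<noteq> z \<Longrightarrow>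
      \<exists>!a. a \<in> edges X \<and> (ini X a = v \<and> ter X a = z \<or> ini X a = z \<and> ter X a = v)"
    and through_apex: "\<And>a b c. \<lbrakk>a \<in> edges X; b \<in> edges X; c \<in> edges X; ini X b = z; ter X b = ter X a;
      ter X c = z; ini X c = ini X a\<rbrakk> \<Longrightarrow> a = cmp X b c"
begin

text \<open>Edges point from later to earlier vertices of a chain, so these are the vertices that
  can precede \<open>z\<close>. In a link join they are the vertices \<open>Low b\<close>.\<close>

definition low :: "'v \<Rightarrow> bool" where
  "low v \<longleftrightarrow> (\<exists>a\<in>edges X. ini X a = z \<and> ter X a = v)"

definition spoke :: "'v \<Rightarrow> 'e" where
  "spoke v = (THE a. a \<in> edges X \<and> (ini X a = v \<and> ter X a = z \<or> ini X a = z \<and> ter X a = v))"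

lemma spoke:
  assumes "v \<in> verts X" "v \<noteq> z"
  shows "spoke v \<in> edges X \<and> (ini X (spoke v) = v \<and> ter X (spoke v) = z \<or> ini X (spoke v) = z \<and> ter X (spoke v) = v)"
  unfolding spoke_def by (rule theI'[OF spoke_ex1[OF assms]])

lemma spoke_ini: "a \<in> edges X \<Longrightarrow> ter X a = z \<Longrightarrow> spoke (ini X a) = a"
  using spoke_ex1[of "ini X a"] spoke[of "ini X a"] scwolD(1)[OF scwol, of a] by auto

lemma spoke_ter: "a \<in> edges X \<Longrightarrow> ini X a = z \<Longrightarrow> spoke (ter X a) = a"
  using spoke_ex1[of "ter X a"] spoke[of "ter X a"] scwolD(1)[OF scwol, of a] by auto

lemma not_low_apex [simp]: "\<not> low z"
  using scwolD(1)[OF scwol] unfolding low_def by metis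

text \<open>Otherwise composing with an edge out of \<open>z\<close> would give an edge from
  \<open>z\<close> to itself.\<close>

lemma not_low_ini: "a \<in> edges X \<Longrightarrow> ter X a = z \<Longrightarrow> \<not> low (ini X a)"
  using scwolD[OF scwol] unfolding low_def by (metis)

lemma low_ter: "a \<in> edges X \<Longrightarrow> ini X a = z \<Longrightarrow> low (ter X a)"
  by (auto simp: low_def)

lemma low_mono: "a \<in> edges X \<Longrightarrow> low (ini X a) \<Longrightarrow> low (ter X a)"
  using scwolD(2)[OF scwol] unfolding low_def by metis

lemma spoke_low: "v \<in> verts X \<Longrightarrow> low v \<Longrightarrow> spoke v \<in> edges X \<and> ini X (spoke v) = z \<and> ter X (spoke v) = v"
  unfolding low_def using spoke_ter by metis

lemma spoke_up:
  "v \<in> verts X \<Longrightarrow> v \<noteq> z \<Longrightarrow> \<not> low v \<Longrightarrow> spoke v \<in> edges X \<and> ini X (spoke v) = v \<and> ter X (spoke v) = z"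
  using spoke unfolding low_def by metis

text \<open>An edge away from \<open>z\<close> forms a commuting triangle with the spokes of its two
  ends: both ends are low, or neither is, or only the target is. Uniqueness of spokes settles the
  first two cases, \<open>through_apex\<close> the third.\<close>

lemma cmp_spoke_low: "a \<in> edges X \<Longrightarrow> low (ini X a) \<Longrightarrow> cmp X a (spoke (ini X a)) = spoke (ter X a)"
  using spoke_low scwolD[OF scwol] spoke_ter by metis

lemma cmp_spoke_up:
  assumes "a \<in> edges X" "ter X a \<noteq> z" "\<not> low (ter X a)" 
  shows "cmp X (spoke (ter X a)) a = spoke (ini X a)"
  using spoke_up[of "ter X a"] assms scwolD[OF scwol] spoke_ini by metis

lemma cmp_spokes:
  assumes "a \<in> edges X" "ini X a \<noteq> z" "\<not> low (ini X a)" "low (ter X a)"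
  shows "cmp X (spoke (ter X a)) (spoke (ini X a)) = a"
  using through_apex[OF assms(1), of "spoke (ter X a)" "spoke (ini X a)"] spoke_low[of "ter X a"] spoke_up[of "ini X a"]
    assms scwolD[OF scwol] by metis

text \<open>
  In a chain the low vertices come first.  The apex, unless already present, is inserted right
  after them, at the vertex position \<open>apex_pos\<close>.
\<close>

fun apex_in :: "'v \<Rightarrow> 'e list \<Rightarrow> bool" where
  "apex_in v [] \<longleftrightarrow> v = z"
| "apex_in v (a # as) \<longleftrightarrow> v = z \<or> apex_in (ini X a) as"

text \<open>The edge from the first non-low vertex to the last low one is split into two spokes
  through \<open>z\<close>; if all vertices are low, or none is, a spoke is added at an end.\<close>

fun insert_apex :: "'v \<Rightarrow> 'e list \<Rightarrow> 'e list" where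
  "insert_apex v [] = (if v = z then [] else [spoke v])"
| "insert_apex v (a # as) =
     (if v = z then a # as
      else if low v then (if low (ini X a) then a else spoke v) # insert_apex (ini X a) as
      else spoke v # a # as)"

definition cone_top :: "'v \<Rightarrow> 'v" where
  "cone_top v = (if low v then v else z)"

text \<open>As the low vertices come first, this is their number, and it is also the index of
  \<open>z\<close> in a chain that contains \<open>z\<close>.\<close>

fun apex_pos :: "'v \<Rightarrow> 'e list \<Rightarrow> nat" where
  "apex_pos v [] = (if low v then 1 else 0)"
| "apex_pos v (a # as) = (if low v then Suc (apex_pos (ini X a) as) else 0)"

section \<open>Coning of chains and its effect on faces\<close>

lemma apex_pos_not_low: "\<not> low v \<Longrightarrow> apex_pos v as = 0"
  by (cases as) auto

lemma insert_apex_not_low: "\<not> low v \<Longrightarrow> v \<noteq> z \<Longrightarrow> insert_apex v as = spoke v # as"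
  by (cases as) auto

lemma apex_in_apex [simp]: "apex_in z as"
  by (cases as) auto

lemma apex_in_low: "chain X v as \<Longrightarrow> apex_in v as \<Longrightarrow> v \<noteq> z \<Longrightarrow> low v"
proof (induction as arbitrary: v)
  case (Cons a as)
  then show ?case
    by (cases "ini X a = z") (auto dest: low_ter low_mono)
qed simp

lemma apex_pos_le: "chain X v as \<Longrightarrow> apex_in v as \<Longrightarrow> apex_pos v as \<le> length as"
proof (induction as arbitrary: v)
  case (Cons a as)
  then show ?case
    by (cases "v = z") auto
qed auto

lemma apex_pos_le_Suc: "apex_pos v as \<le> Suc (length as)"
  by (induction as arbitrary: v) auto

text \<open>In a chain through \<open>z\<close> the edge from \<open>z\<close> to the preceding
  vertex is already the spoke of that vertex.\<close>

lemma insert_apex_in: "chain X v as \<Longrightarrow> apex_in v as \<Longrightarrow> insert_apex v as = as \<and> cone_top v = v"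
proof (induction as arbitrary: v)
  case (Cons a as)
  show ?case
  proof (cases "v = z")
    case False
    then have "low v" using apex_in_low Cons.prems by blast
    moreover have "low (ini X a) \<or> spoke v = a"
      using Cons.prems apex_in_low[of "ini X a" as] spoke_ter[of a] False by (cases "ini X a = z") auto
    ultimately show ?thesis using False Cons by (auto simp: cone_top_def)
  qed (simp add: cone_top_def)
qed (simp add: cone_top_def)

text \<open>The chain is the face of its cone opposite \<open>z\<close>: deleting an interior
  \<open>z\<close> composes the two spokes around it, and \<open>cmp_spokes\<close> returns the
  original edge.\<close>

lemma insert_apex_notin:
  assumes "chain X v as" "\<not> apex_in v as"
  shows "chain X (cone_top v) (insert_apex v as) \<and> length (insert_apex v as) = Suc (length as)
    \<and> face_top X (apex_pos v as) (cone_top v) (insert_apex v as) = v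
    \<and> face_edges X (apex_pos v as) (insert_apex v as) = as"
  using assms
proof (induction as arbitrary: v)
  case Nil
  then show ?case using spoke_low[of v] spoke_up[of v]
    apex by (auto simp: cone_top_def)
next
  case (Cons a as)
  let ?w = "ini X a"
  have "?w \<noteq> z" using Cons.prems apex_in_apex[of as] by (metis apex_in.simps(2))
  then have v: "v \<in> verts X" "v \<noteq> z" "a \<in> edges X" "ter X a = v" and w: "?w \<noteq> z" "?w \<in> verts X"
    using Cons.prems scwolD(1)[OF scwol] by auto
  note IH = Cons.IH[of ?w]
  show ?case
  proof (cases "low v")
    case True
    show ?thesis
    proof (cases "low ?w")
      case low: True
      obtain n where n: "apex_pos ?w as = Suc n" using low by (cases as) auto
      obtain b bs where b: "insert_apex ?w as = b # bs" using w low by (cases as) auto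
      show ?thesis
        using IH Cons.prems v w True low n b by (auto simp: cone_top_def)
    next
      case False
      then show ?thesis
        using Cons.prems v w True spoke_low[of v] spoke_up[of ?w] cmp_spokes[of a]
        by (auto simp: cone_top_def insert_apex_not_low apex_pos_not_low)
    qed
  next
    case False
    then show ?thesis
      using Cons.prems v spoke_up[of v] by (auto simp: cone_top_def)
  qed
qed

text \<open>Coning commutes with faces up to a shift of indices. Vertex \<open>j\<close> keeps its
  number in the cone if it is low, that is if \<open>j < apex_pos v as\<close>, and moves up by one
  otherwise; deleting a low vertex moves the apex down by one. Next to the apex this rests on the
  triangles \<open>cmp_spoke_low\<close> and \<open>cmp_spoke_up\<close>.\<close>

lemma face_notin:
  assumes "chain X v as" "\<not> apex_in v as" "as \<noteq> []" "j \<le> length as"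
  shows "\<not> apex_in (face_top X j v as) (face_edges X j as)
    \<and> apex_pos (face_top X j v as) (face_edges X j as) = (if j < apex_pos v as then apex_pos v as - 1 else apex_pos v as)
    \<and> cone_top (face_top X j v as) = face_top X (if j < apex_pos v as then j else Suc j) (cone_top v) (insert_apex v as)
    \<and> insert_apex (face_top X j v as) (face_edges X j as)
      = face_edges X (if j < apex_pos v as then j else Suc j) (insert_apex v as)"
  using assms
proof (induction as arbitrary: v j)
  case (Cons a as)
  let ?w = "ini X a"
  have "?w \<noteq> z" using Cons.prems apex_in_apex[of as] by (metis apex_in.simps(2))
  then have v: "v \<in> verts X" "v \<noteq> z" "a \<in> edges X" "ter X a = v"
    and w: "?w \<noteq> z" "?w \<in> verts X" "\<not> apex_in ?w as" "chain X ?w as"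
    using Cons.prems scwolD(1)[OF scwol] by auto
  note mono = low_mono[OF v(3)]
  \<comment> \<open>The cases follow the clauses of \<open>face_edges\<close>; only the last one
    calls for the induction hypothesis.\<close>
  consider (0) "j = 0" | (1) "j = 1" "as = []" | (2) b bs where "j = 1" "as = b # bs"
    | (3) i b bs where "j = Suc (Suc i)" "as = b # bs"
  proof (cases j)
    case (Suc n)
    with Cons.prems show ?thesis by (cases n; cases as) (auto intro: that)
  qed (use that in blast)
  then show ?case
  proof cases
    case 0
    show ?thesis
    proof (cases "low ?w")
      case True
      moreover obtain n where "apex_pos ?w as = Suc n" using True by (cases as) auto
      ultimately show ?thesis
        using 0 v w mono by (auto simp: cone_top_def)
    next
      case False
      then show ?thesis
        using 0 v w spoke_low[of v]
        by (auto simp: cone_top_def insert_apex_not_low apex_pos_not_low cmp_spoke_up)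
    qed
  next
    case 1
    then show ?thesis
      using v w mono by (auto simp: cone_top_def cmp_spoke_low)
  next
    case 2
    let ?u = "ini X b"
    have "?u \<noteq> z" using w(3) apex_in_apex[of bs] 2(2) by (metis apex_in.simps(2))
    then have b: "b \<in> edges X" "ter X b = ?w" "?u \<noteq> z" "?u \<in> verts X"
      using w 2 scwolD(1)[OF scwol, of b] by auto
    note mono' = low_mono[OF b(1)]
    have ini: "ini X (cmp X a b) = ?u" using v b scwolD(2)[OF scwol] by auto
    obtain n where n: "low ?u \<Longrightarrow> apex_pos ?u bs = Suc n" by (cases bs) auto
    have sp: "cmp X (spoke ?w) b = spoke ?u" if "\<not> low ?w"
      using cmp_spoke_up[of b] b w that by auto
    have sp': "cmp X a (spoke ?w) = spoke v" if "low ?w"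
      using cmp_spoke_low[of a] v w that by auto
    show ?thesis
      using 2 v w b mono mono' ini sp sp' n
      by (auto simp: cone_top_def insert_apex_not_low apex_pos_not_low)
  next
    case 3
    have j: "Suc i \<le> length as" using Cons.prems 3 by simp
    note IH = Cons.IH[OF w(4,3) _ j]
    obtain c cs where c: "low ?w \<Longrightarrow> insert_apex ?w as = c # cs"
      using w by (cases as) (auto simp: 3)
    show ?thesis
      using 3 v w IH c by (auto simp: cone_top_def insert_apex_not_low apex_pos_not_low)
  qed
qed simp

lemma face_in_other:
  assumes "chain X v as" "apex_in v as" "j \<le> length as" "j \<noteq> apex_pos v as"
  shows "apex_in (face_top X j v as) (face_edges X j as)
    \<and> apex_pos (face_top X j v as) (face_edges X j as) = (if j < apex_pos v as then apex_pos v as - 1 else apex_pos v as)"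
  using assms
proof (induction as arbitrary: v j)
  case (Cons a as)
  show ?case
  proof (cases "v = z")
    case True
    then show ?thesis using Cons.prems by (cases j) (auto simp: apex_pos_not_low)
  next
    case False
    let ?w = "ini X a"
    have low: "low v" using Cons.prems False apex_in_low by blast
    have w: "apex_in ?w as" "chain X ?w as" using Cons.prems False by auto
    have wlow: "?w \<noteq> z \<Longrightarrow> low ?w" using w apex_in_low by blast
    consider (0) "j = 0" | (1) "j = 1" "as = []" | (2) b bs where "j = 1" "as = b # bs"
      | (3) i b bs where "j = Suc (Suc i)" "as = b # bs"
    proof (cases j)
      case (Suc n)
      with Cons.prems show ?thesis by (cases n; cases as) (auto intro: that)
    qed (use that in blast)
    then show ?thesis
    proof cases
      case 0
      then show ?thesis using Cons.prems low w by (auto simp: apex_pos_not_low)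
    next
      case 1
      then show ?thesis using Cons.prems low w by auto
    next
      case 2
      have "ini X (cmp X a b) = ini X b" using Cons.prems 2 scwolD(2)[OF scwol] by auto
      moreover have "?w \<noteq> z"
        using Cons.prems(4) 2(1) low apex_pos_not_low[OF not_low_apex, of as] by (metis One_nat_def apex_pos.simps(2))
      ultimately show ?thesis using Cons.prems 2 low w wlow by auto
    next
      case 3
      then show ?thesis using Cons.prems Cons.IH[of ?w "Suc i"] low w wlow by auto
    qed
  qed
qed simp

text \<open>Converse of \<open>insert_apex_notin\<close>: once \<open>z\<close> is deleted, coning
  puts it back in the same place. An interior \<open>z\<close> disappears into a composite edge,
  which \<open>insert_apex\<close> splits into the same two spokes.\<close>

lemma face_in_apex:
  assumes "chain X v as" "apex_in v as" "as \<noteq> []"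
  defines "v' \<equiv> face_top X (apex_pos v as) v as" and "bs \<equiv> face_edges X (apex_pos v as) as"
  shows "\<not> apex_in v' bs \<and> apex_pos v' bs = apex_pos v as \<and> cone_top v' = v \<and> insert_apex v' bs = as"
  using assms(1-3) unfolding v'_def bs_def
proof (induction as arbitrary: v)
  case (Cons a as)
  let ?w = "ini X a"
  have a: "a \<in> edges X" "ter X a = v" "?w \<in> verts X" "v \<in> verts X" "chain X ?w as"
    using Cons.prems scwolD(1)[OF scwol] by auto
  show ?case
  proof (cases "v = z")
    case True
    then have "\<not> low ?w" "?w \<noteq> z" "spoke ?w = a"
      using not_low_ini a spoke_ini scwolD(1)[OF scwol, of a] by auto
    moreover have "\<not> apex_in ?w as" using apex_in_low[OF a(5)] calculation by auto
    ultimately show ?thesis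
      using True by (auto simp: apex_pos_not_low cone_top_def insert_apex_not_low)
  next
    case False
    have low: "low v" using Cons.prems False apex_in_low by blast
    have w: "apex_in ?w as" using Cons.prems False by auto
    show ?thesis
    proof (cases as)
      case Nil
      then show ?thesis using False low w a spoke_ter[of a] by (auto simp: cone_top_def)
    next
      case (Cons b bs)
      let ?u = "ini X b"
      have b: "b \<in> edges X" "ter X b = ?w" "?u \<in> verts X" "chain X ?u bs"
        using a Cons scwolD(1)[OF scwol] by auto
      show ?thesis
      proof (cases "?w = z")
        case True
        then have u: "\<not> low ?u" "?u \<noteq> z" "spoke ?u = b" "spoke v = a"
          using not_low_ini b a spoke_ini spoke_ter[of a] scwolD(1)[OF scwol, of b] by auto
        then have "\<not> apex_in ?u bs" using apex_in_low[OF b(4)] by auto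
        moreover have "ini X (cmp X a b) = ?u" using scwolD(2)[OF scwol] a b by auto
        ultimately show ?thesis
          using True Cons u False low by (auto simp: apex_pos_not_low cone_top_def insert_apex_not_low)
      next
        case wz: False
        then have wlow: "low ?w" using apex_in_low[OF a(5) w] by blast
        obtain n where n: "apex_pos ?w as = Suc n" using wlow Cons by auto
        show ?thesis
          using Cons.IH[OF a(5) w] wlow low n False Cons wz by (auto simp: cone_top_def)
      qed
    qed
  qed
qed simp

end

section \<open>Maps out of sums, face inclusions and points of the realization\<close>

text \<open>The components of a sum are open in it, so an open box in \<open>Z\<close> times one
  component is still an open box in \<open>Z\<close> times the sum.\<close>

lemma continuous_map_prod_sum_topology:
  assumes "\<And>i. i \<in> I \<Longrightarrow> continuous_map (prod_topology Z (T i)) R (\<lambda>w. h (fst w, i, snd w))"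
  shows "continuous_map (prod_topology Z (sum_topology T I)) R h"
  unfolding continuous_map_def
proof (intro conjI allI impI)
  have sub: "h w \<in> topspace R" if w: "w \<in> topspace (prod_topology Z (sum_topology T I))" for w
  proof -
    obtain y i x where "w = (y, i, x)" "i \<in> I" "y \<in> topspace Z" "x \<in> topspace (T i)"
      using w by auto
    with funcset_mem[OF continuous_map_funspace[OF assms[of i]], of "(y, x)"] show ?thesis by auto
  qed
  then show "h \<in> topspace (prod_topology Z (sum_topology T I)) \<rightarrow> topspace R" by blast
  fix U assume U: "openin R U"
  show "openin (prod_topology Z (sum_topology T I)) {w \<in> topspace (prod_topology Z (sum_topology T I)). h w \<in> U}"
    unfolding openin_prod_topology_alt
  proof (intro allI impI)
    fix y p assume yp: "(y, p) \<in> {w \<in> topspace (prod_topology Z (sum_topology T I)). h w \<in> U}"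
    then obtain i x where p: "p = (i, x)" "i \<in> I" "y \<in> topspace Z" "x \<in> topspace (T i)" by auto
    have op: "openin (prod_topology Z (T i)) {w \<in> topspace (prod_topology Z (T i)). h (fst w, i, snd w) \<in> U}"
      by (rule openin_continuous_map_preimage[OF assms[OF p(2)] U])
    have mem: "(y, x) \<in> {w \<in> topspace (prod_topology Z (T i)). h (fst w, i, snd w) \<in> U}"
      using p yp by auto
    obtain A B where AB: "openin Z A" "openin (T i) B" "y \<in> A" "x \<in> B"
      "A \<times> B \<subseteq> {w \<in> topspace (prod_topology Z (T i)). h (fst w, i, snd w) \<in> U}"
      using op[unfolded openin_prod_topology_alt, rule_format, OF mem] by blast
    have "openin (sum_topology T I) (Pair i ` B)"
      using open_map_component_injection[OF p(2), of T] AB(2) by (simp add: open_map_def)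
    moreover have "A \<times> Pair i ` B \<subseteq> {w \<in> topspace (prod_topology Z (sum_topology T I)). h w \<in> U}"
      using AB(5) p by (auto simp: subset_iff)
    ultimately show "\<exists>A B. openin Z A \<and> openin (sum_topology T I) B \<and> y \<in> A \<and> p \<in> B \<and>
        A \<times> B \<subseteq> {w \<in> topspace (prod_topology Z (sum_topology T I)). h w \<in> U}"
      using AB p by blast
  qed
qed

lemma chain_face:
  "\<lbrakk>scwol X; chain X v as; as \<noteq> []; j \<le> length as\<rbrakk> \<Longrightarrow> chain X (face_top X j v as) (face_edges X j as)"
proof (induction X j as arbitrary: v rule: face_edges.induct)
  case (4 X a b as)
  then show ?case using scwolD(2)[OF 4(1), of a b] by simp
qed (simp_all add: scwolD(1) chain_start)

text \<open>\<open>simplical_face j\<close> inserts a zero at index \<open>j\<close>. Its linearity,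
  its effect on vertices and the cosimplicial identity push straight lines through face
  inclusions.\<close>

lemma simplical_face_sum:
  "simplical_face j (\<lambda>i. (c :: real) * f i + d * g i) = (\<lambda>i. c * simplical_face j f i + d * simplical_face j g i)"
  by (auto simp: simplical_face_def)

lemma simplical_face_basis:
  "simplical_face j (\<lambda>i. if i = p then 1 else 0 :: real) = (\<lambda>i. if i = (if j \<le> p then Suc p else p) then 1 else 0)"
  by (auto simp: simplical_face_def fun_eq_iff)

lemma simplical_face_swap:
  "j \<le> p \<Longrightarrow> simplical_face j (simplical_face p x) = simplical_face (Suc p) (simplical_face j x)"
  by (auto simp: simplical_face_def fun_eq_iff)

context
  fixes X :: "('v, 'e) scwol_data"
begin

definition point :: "'v \<Rightarrow> 'e list \<Rightarrow> (nat \<Rightarrow> real) \<Rightarrow> (('v + 'e list) \<times> (nat \<Rightarrow> real)) set" where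
  "point v as x = {r. equivclp (glued X) (simplex_of v as, x) r}"

lemma point_face:
  assumes "scwol X" "chain X v as" "as \<noteq> []" "j \<le> length as" "x \<in> standard_simplex (length as - 1)"
  shows "point (face_top X j v as) (face_edges X j as) x = point v as (simplical_face j x)"
proof -
  have "simplex_of v as \<in> simplices X" using assms by (auto simp: simplices_eq)
  then have "glued X (simplex_face X j (simplex_of v as), x) (simplex_of v as, simplical_face j x)"
    using assms glued.intros[of "simplex_of v as" X "length as - 1" j x] by simp
  then have "equivclp (glued X) (simplex_face X j (simplex_of v as), x) (simplex_of v as, simplical_face j x)"
    by (rule r_into_equivclp)
  then show ?thesis
    unfolding point_def simplex_face_simplex_of[OF assms(2-4)]
    by (auto intro: equivclp_trans equivclp_sym)
qed

text \<open>A vertex survives every face that deletes a different one: delete the last vertex if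
  \<open>i = 0\<close> and the first one otherwise, until a single vertex is left. Vertex
  \<open>i > 0\<close> is the source of the edge with list index \<open>i - 1\<close>.\<close>

lemma point_vertex:
  assumes "scwol X"
  shows "chain X v as \<Longrightarrow> i \<le> length as \<Longrightarrow> 
    point v as (\<lambda>n. if n = i then 1 else 0) = 
    point (if i = 0 then v else ini X (as ! (i - 1))) [] (\<lambda>n. if n = 0 then 1 else 0)"
proof (induction "length as" arbitrary: v as i)
  case (Suc k)
  then obtain a bs where as: "as = a # bs" by (cases as) auto
  show ?case
  proof (cases i)
    case 0
    have *: "point (face_top X (length as) v as) (face_edges X (length as) as) (\<lambda>n. if n = i then 1 else 0)
      = point v as (simplical_face (length as) (\<lambda>n. if n = i then 1 else 0))"
      by (rule point_face[OF assms Suc.prems(1)]) (use as 0 in auto)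
    have "chain X (face_top X (length as) v as) (face_edges X (length as) as)"
      by (rule chain_face[OF assms Suc.prems(1)]) (use as in auto)
    from Suc.hyps(1)[OF _ this, of 0] * show ?thesis
      using Suc.hyps(2) 0 as length_face_edges[of "length as" as X] by (simp add: simplical_face_basis)
  next
    case (Suc n)
    have *: "point (face_top X 0 v as) (face_edges X 0 as) (\<lambda>m. if m = n then 1 else 0)
      = point v as (simplical_face 0 (\<lambda>m. if m = n then 1 else 0))"
      by (rule point_face[OF assms Suc.prems(1)]) (use as Suc.prems Suc in auto)
    have "chain X (ini X a) bs" using Suc.prems as by auto
    from Suc.hyps(1)[OF _ this, of n] * show ?thesis
      using Suc.hyps(2) Suc as Suc.prems by (cases n) (simp_all add: simplical_face_basis)
  qed
qed simp

end

section \<open>The straight-line contraction onto the apex\<close>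

context cone begin

lemma insert_apex_vertex:
  assumes "chain X v as"
  shows "(if apex_pos v as = 0 then cone_top v else ini X (insert_apex v as ! (apex_pos v as - 1))) = z"
  using assms
proof (induction as arbitrary: v)
  case Nil
  then show ?case using spoke_low[of v] by (auto simp: cone_top_def)
next
  case (Cons a as)
  let ?w = "ini X a"
  have a: "a \<in> edges X" "chain X ?w as" "ter X a = v" "v \<in> verts X" "?w \<in> verts X"
    using Cons.prems scwolD(1)[OF scwol] by auto
  show ?case
  proof (cases "low v")
    case True
    then have vz: "v \<noteq> z" by auto
    show ?thesis
    proof (cases "low ?w")
      case low: True
      then obtain n where "apex_pos ?w as = Suc n" by (cases as) auto
      then show ?thesis using Cons.IH[OF a(2)] True vz low by auto
    next
      case False
      then show ?thesis using True vz spoke_low[of v] a by (auto simp: apex_pos_not_low)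
    qed
  next
    case False
    then show ?thesis by (auto simp: cone_top_def)
  qed
qed

text \<open>Barycentric coordinates in the coned simplex: a zero is inserted at the apex unless the
  apex is a vertex already.\<close>

definition cone_coord :: "'v \<Rightarrow> 'e list \<Rightarrow> (nat \<Rightarrow> real) \<Rightarrow> nat \<Rightarrow> real" where
  "cone_coord v as x = (if apex_in v as then x else simplical_face (apex_pos v as) x)"

definition cone_line :: "'v \<Rightarrow> 'e list \<Rightarrow> real \<Rightarrow> (nat \<Rightarrow> real) \<Rightarrow> nat \<Rightarrow> real" where
  "cone_line v as t x = (\<lambda>i. (1 - t) * cone_coord v as x i + t * (if i = apex_pos v as then 1 else 0))"

definition cone_point :: "'v \<Rightarrow> 'e list \<Rightarrow> real \<Rightarrow> (nat \<Rightarrow> real) \<Rightarrow> (('v + 'e list) \<times> (nat \<Rightarrow> real)) set" where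
  "cone_point v as t x = point X (cone_top v) (insert_apex v as) (cone_line v as t x)"

lemma chain_insert_apex: "chain X v as \<Longrightarrow> chain X (cone_top v) (insert_apex v as)"
  using insert_apex_in insert_apex_notin by (cases "apex_in v as") auto

lemma length_insert_apex:
  "chain X v as \<Longrightarrow> length (insert_apex v as) = (if apex_in v as then length as else Suc (length as))"
  using insert_apex_in insert_apex_notin by auto

lemma cone_coord_in:
  assumes "chain X v as" "x \<in> standard_simplex (length as)"
  shows "cone_coord v as x \<in> standard_simplex (length (insert_apex v as))"
  using assms simplical_face_in_standard_simplex[of "Suc (length as)" "apex_pos v as" x] apex_pos_le_Suc[of v as]
  by (simp add: cone_coord_def length_insert_apex)

lemma cone_line_in:
  assumes "chain X v as" "x \<in> standard_simplex (length as)" "0 \<le> t" "t \<le> 1"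
  shows "cone_line v as t x \<in> standard_simplex (length (insert_apex v as))"
proof -
  have "apex_pos v as \<le> length (insert_apex v as)"
    using apex_pos_le_Suc[of v as] apex_pos_le[OF assms(1)] by (auto simp: length_insert_apex[OF assms(1)])
  then show ?thesis
    unfolding cone_line_def using convex_standard_simplex[OF cone_coord_in[OF assms(1,2)] _ assms(3,4)] by simp
qed

lemma cone_point_0:
  assumes "chain X v as" "x \<in> standard_simplex (length as)"
  shows "cone_point v as 0 x = point X v as x"
proof (cases "apex_in v as")
  case True
  then show ?thesis using insert_apex_in[OF assms(1)] by (simp add: cone_point_def cone_line_def cone_coord_def)
next
  case False
  note * = insert_apex_notin[OF assms(1) False]
  have "point X (face_top X (apex_pos v as) (cone_top v) (insert_apex v as))
      (face_edges X (apex_pos v as) (insert_apex v as)) x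
    = point X (cone_top v) (insert_apex v as) (simplical_face (apex_pos v as) x)"
    by (rule point_face[OF scwol]) (use * assms apex_pos_le_Suc[of v as] in auto)
  then show ?thesis using * False by (simp add: cone_point_def cone_line_def cone_coord_def)
qed

lemma cone_point_1:
  assumes "chain X v as"
  shows "cone_point v as 1 x = point X z [] (\<lambda>n. if n = 0 then 1 else 0)"
proof -
  have "apex_pos v as \<le> length (insert_apex v as)"
    using apex_pos_le_Suc[of v as] apex_pos_le[OF assms(1)] by (auto simp: length_insert_apex[OF assms(1)])
  from point_vertex[OF scwol chain_insert_apex[OF assms] this] insert_apex_vertex[OF assms]
  show ?thesis by (simp add: cone_point_def cone_line_def)
qed

text \<open>Glued points have the same track. If \<open>z\<close> is not a vertex, the cone of the
  face is a face of the cone; if \<open>z\<close> is a vertex and another one is deleted, simplex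
  and face are their own cones; if \<open>z\<close> itself is deleted, simplex and face have the
  same cone and the two lines coincide.\<close>

lemma cone_point_face:
  assumes "chain X v as" "as \<noteq> []" "j \<le> length as" "x \<in> standard_simplex (length as - 1)" "0 \<le> t" "t \<le> 1"
  shows "cone_point (face_top X j v as) (face_edges X j as) t x = cone_point v as t (simplical_face j x)"
proof -
  let ?v' = "face_top X j v as" and ?bs = "face_edges X j as" and ?p = "apex_pos v as"
  have ch: "chain X ?v' ?bs" by (rule chain_face[OF scwol assms(1-3)])
  have len: "length ?bs = length as - 1" using length_face_edges[OF assms(3)] .
  have line: "cone_line ?v' ?bs t x \<in> standard_simplex (length (insert_apex ?v' ?bs))"
    by (rule cone_line_in[OF ch]) (use len assms in auto)
  show ?thesis
  proof (cases "apex_in v as")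
    case False
    note * = face_notin[OF assms(1) False assms(2,3)]
    \<comment> \<open>The number that the deleted vertex has in the cone.\<close>
    define j' where "j' = (if j < ?p then j else Suc j)"
    note C = insert_apex_notin[OF assms(1) False]
    have lx: "cone_line ?v' ?bs t x \<in> standard_simplex (length (insert_apex v as) - 1)"
      using line * len C assms(2) length_insert_apex[OF ch] by simp
    have "point X (face_top X j' (cone_top v) (insert_apex v as)) (face_edges X j' (insert_apex v as)) (cone_line ?v' ?bs t x)
      = point X (cone_top v) (insert_apex v as) (simplical_face j' (cone_line ?v' ?bs t x))"
      by (rule point_face[OF scwol chain_insert_apex[OF assms(1)] _ _ lx]) (use C assms in \<open>auto simp: j'_def\<close>)
    then have "cone_point ?v' ?bs t x = point X (cone_top v) (insert_apex v as) (simplical_face j' (cone_line ?v' ?bs t x))"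
      using * unfolding j'_def cone_point_def by metis
    moreover have "simplical_face j' (cone_line ?v' ?bs t x) = cone_line v as t (simplical_face j x)"
    proof (cases "j < ?p")
      case True
      \<comment> \<open>The deleted vertex precedes the apex, so the apex of the face sits at
        \<open>?p - 1\<close>; this is the index in the cosimplicial identity.\<close>
      then have "j \<le> ?p - 1" by simp
      with True show ?thesis
        using * False simplical_face_swap[of j "?p - 1" x]
        unfolding cone_line_def simplical_face_sum simplical_face_basis by (simp add: cone_coord_def j'_def)
    next
      case jp: False
      then show ?thesis
        using * False simplical_face_swap[of ?p j x]
        unfolding cone_line_def simplical_face_sum simplical_face_basis by (simp add: cone_coord_def j'_def)
    qed
    ultimately show ?thesis by (simp add: cone_point_def)
  next
    case True
    show ?thesis
    proof (cases "j = ?p")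
      case False
      note * = face_in_other[OF assms(1) True assms(3) False]
      have b: "insert_apex ?v' ?bs = ?bs" "cone_top ?v' = ?v'"
        using * insert_apex_in[OF ch] by auto
      have "point X ?v' ?bs (cone_line ?v' ?bs t x) = point X v as (simplical_face j (cone_line ?v' ?bs t x))"
        by (rule point_face[OF scwol assms(1-3)]) (use line b len in simp)
      then have "cone_point ?v' ?bs t x = point X v as (simplical_face j (cone_line ?v' ?bs t x))"
        unfolding cone_point_def b .
      moreover have "simplical_face j (cone_line ?v' ?bs t x) = cone_line v as t (simplical_face j x)"
      proof (cases "j < ?p")
        case True
        then have "j \<le> ?p - 1" by simp
        with True show ?thesis
          using * \<open>apex_in v as\<close>
          unfolding cone_line_def simplical_face_sum simplical_face_basis by (simp add: cone_coord_def)
      next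
        case jp: False
        with False have "\<not> j \<le> ?p" by simp
        with jp show ?thesis
          using * \<open>apex_in v as\<close>
          unfolding cone_line_def simplical_face_sum simplical_face_basis by (simp add: cone_coord_def)
      qed
      ultimately show ?thesis using insert_apex_in[OF assms(1) True] by (simp add: cone_point_def)
    next
      case j: True
      note * = face_in_apex[OF assms(1) True assms(2)]
      then have b: "apex_in ?v' ?bs = False" "apex_pos ?v' ?bs = ?p" "cone_top ?v' = v" "insert_apex ?v' ?bs = as"
        unfolding j by simp_all
      have c: "insert_apex v as = as" "cone_top v = v" "apex_in v as = True"
        using insert_apex_in[OF assms(1) True] True by simp_all
      show ?thesis
        unfolding cone_point_def cone_line_def cone_coord_def b c if_True if_False by (simp only: j)
    qed
  qed
qed

end

section \<open>Descent of the contraction to the realization\<close>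

context cone begin

text \<open>Recovers the first vertex, which \<open>simplex_of\<close> forgets as soon as there are
  edges.\<close>

definition chain_of :: "'v + 'e list \<Rightarrow> 'v \<times> 'e list" where
  "chain_of s = (case s of Inl v \<Rightarrow> (v, []) | Inr as \<Rightarrow> (ter X (hd as), as))"

lemma chain_of_simplex_of: "chain X v as \<Longrightarrow> chain_of (simplex_of v as) = (v, as)"
  by (cases as) (auto simp: chain_of_def simplex_of_def)

definition contraction :: "real \<times> ('v + 'e list) \<times> (nat \<Rightarrow> real) \<Rightarrow> (('v + 'e list) \<times> (nat \<Rightarrow> real)) set" where
  "contraction = (\<lambda>(t, s, x). cone_point (fst (chain_of s)) (snd (chain_of s)) t x)"

lemma contraction_eq: "chain X v as \<Longrightarrow> contraction (t, simplex_of v as, x) = cone_point v as t x"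
  by (simp add: contraction_def chain_of_simplex_of)

lemma topspace_simplex_sum: "topspace (simplex_sum X) = {(s, x). s \<in> simplices X \<and> x \<in> standard_simplex (simplex_dim s)}"
  by (auto simp: simplex_sum_def)

lemma continuous_map_cone_line:
  assumes "chain X v as"
  shows "continuous_map (prod_topology (top_of_set {0..1}) (subtopology (powertop_real UNIV) (standard_simplex (length as))))
    (subtopology (powertop_real UNIV) (standard_simplex (length (insert_apex v as))))
    (\<lambda>w. cone_line v as (fst w) (snd w))"
  (is "continuous_map ?P _ _")
proof -
  have coord: "continuous_map ?P euclideanreal (\<lambda>w. snd w i)" for i
    by (rule continuous_map_compose[OF continuous_map_snd, of _ euclideanreal "\<lambda>x. x i", unfolded o_def])
      (rule continuous_map_from_subtopology[OF continuous_map_product_projection[OF UNIV_I]])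
  have fst: "continuous_map ?P euclideanreal fst"
    by (rule continuous_map_into_fulltopology[OF continuous_map_fst])
  have zero: "continuous_map ?P euclideanreal (\<lambda>w. cone_coord v as (snd w) i)" for i
    by (cases "apex_in v as") (auto simp: cone_coord_def simplical_face_def coord)
  have "continuous_map ?P euclideanreal (\<lambda>w. cone_line v as (fst w) (snd w) i)" for i
    unfolding cone_line_def
    by (intro continuous_map_add continuous_map_real_mult continuous_map_diff fst zero) auto
  moreover have "cone_line v as (fst w) (snd w) \<in> standard_simplex (length (insert_apex v as))"
    if "w \<in> topspace ?P" for w
    using that by (intro cone_line_in[OF assms]) auto
  ultimately show ?thesis
    by (auto simp: continuous_map_in_subtopology continuous_map_componentwise_UNIV)
qed

text \<open>On each simplex the map is a straight line in the coned simplex, followed by the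
  inclusion into the sum and the quotient map.\<close>

lemma continuous_map_contraction:
  "continuous_map (prod_topology (top_of_set {0..1}) (simplex_sum X)) (realization X) contraction"
  unfolding simplex_sum_def
proof (rule continuous_map_prod_sum_topology)
  fix s assume "s \<in> simplices X"
  then obtain v as where s: "s = simplex_of v as" and ch: "chain X v as"
    using simplices_eq[OF scwol] by auto
  let ?s = "simplex_of (cone_top v) (insert_apex v as)"
  have "?s \<in> simplices X"
    using simplices_eq[OF scwol] chain_insert_apex[OF ch] by auto
  then have inj: "continuous_map (subtopology (powertop_real UNIV) (standard_simplex (simplex_dim ?s))) (simplex_sum X) (Pair ?s)"
    unfolding simplex_sum_def by (rule continuous_map_component_injection)
  have q: "continuous_map (simplex_sum X) (realization X) (\<lambda>p. {q. equivclp (glued X) p q})"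
    unfolding realization_def by (rule quotient_imp_continuous_map[OF quotient_map_quotient_topology])
  have eq: "contraction (fst w, s, snd w)
      = {q. equivclp (glued X) (?s, cone_line v as (fst w) (snd w)) q}" for w
    unfolding s contraction_eq[OF ch] cone_point_def point_def ..
  have "continuous_map (prod_topology (top_of_set {0..1})
      (subtopology (powertop_real UNIV) (standard_simplex (simplex_dim s)))) (realization X)
      ((\<lambda>p. {q. equivclp (glued X) p q}) \<circ> (Pair ?s \<circ> (\<lambda>w. cone_line v as (fst w) (snd w))))"
    by (intro continuous_map_compose[OF _ q] continuous_map_compose[OF _ inj])
      (use continuous_map_cone_line[OF ch] in \<open>simp add: s\<close>)
  then show "continuous_map (prod_topology (top_of_set {0..1})
      (subtopology (powertop_real UNIV) (standard_simplex (simplex_dim s)))) (realization X)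
      (\<lambda>w. contraction (fst w, s, snd w))"
    by (simp add: eq o_def)
qed

lemma contraction_glued:
  assumes "glued X p r" "0 \<le> t" "t \<le> 1"
  shows "contraction (t, p) = contraction (t, r)"
  using assms(1)
proof cases
  case (1 s k j x)
  then obtain v as where s: "s = simplex_of v as" and ch: "chain X v as"
    using simplices_eq[OF scwol] by auto
  then have as: "as \<noteq> []" "j \<le> length as" "x \<in> standard_simplex (length as - 1)" using 1 by auto
  have "contraction (t, p) = cone_point (face_top X j v as) (face_edges X j as) t x"
    unfolding 1(1) s simplex_face_simplex_of[OF ch as(1,2)]
    by (rule contraction_eq[OF chain_face[OF scwol ch as(1,2)]])
  then show ?thesis
    using cone_point_face[OF ch as assms(2,3)] 1 s contraction_eq[OF ch] by simp
qed

lemma contraction_equivclp: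
  assumes "equivclp (glued X) p r" "0 \<le> t" "t \<le> 1"
  shows "contraction (t, p) = contraction (t, r)"
  using assms(1) by (induction rule: equivclp_induct) (auto dest: contraction_glued[OF _ assms(2,3)])

theorem simply_connected: "simply_connected_scwol X"
  unfolding simply_connected_scwol_def
proof
  let ?I = "top_of_set {0..1::real}"
  let ?q = "\<lambda>p. {q. equivclp (glued X) p q}"
  have quot: "quotient_map (simplex_sum X) (realization X) ?q"
    unfolding realization_def by (rule quotient_map_quotient_topology)
  \<comment> \<open>\<open>[0, 1]\<close> is locally compact, so its product with the quotient map is again a quotient map.\<close>
  have Q: "quotient_map (prod_topology ?I (simplex_sum X)) (prod_topology ?I (realization X)) (\<lambda>(t, p). (t, ?q p))"
  proof (rule quotient_map_prod_right[OF _ _ quot])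
    show "locally_compact_space ?I"
      by (intro compact_imp_locally_compact_space) (auto simp: compact_space_subtopology)
    show "Hausdorff_space ?I \<or> regular_space ?I"
      by (simp add: Hausdorff_space_subtopology)
  qed
  \<comment> \<open>By \<open>contraction_equivclp\<close> the contraction is constant on the fibres
    of the quotient map \<open>Q\<close>, so it factors through it.\<close>
  obtain H where H: "continuous_map (prod_topology ?I (realization X)) (realization X) H"
    and Hq: "\<And>w. w \<in> topspace (prod_topology ?I (simplex_sum X)) \<Longrightarrow> H ((\<lambda>(t, p). (t, ?q p)) w) = contraction w"
  proof (rule quotient_map_lift_exists[OF Q continuous_map_contraction])
    fix w w' assume "w \<in> topspace (prod_topology ?I (simplex_sum X))" "w' \<in> topspace (prod_topology ?I (simplex_sum X))"
      and eq: "(\<lambda>(t, p). (t, ?q p)) w = (\<lambda>(t, p). (t, ?q p)) w'"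
    moreover obtain t p t' p' where w: "w = (t, p)" "w' = (t', p')" by (cases w, cases w')
    moreover have "equivclp (glued X) p p'"
    proof -
      have "?q p = ?q p'" using eq w by simp
      then show ?thesis using equivclp_refl[of "glued X" p'] by blast
    qed
    ultimately show "contraction w = contraction w'"
      using contraction_equivclp[of p p' t] by auto
  qed (rule that)
  have rep: "\<exists>v as x. chain X v as \<and> x \<in> standard_simplex (length as) \<and> y = point X v as x \<and>
     (\<forall>t\<in>{0..1}. H (t, y) = cone_point v as t x)" if y: "y \<in> topspace (realization X)" for y
  proof -
    obtain s x where sx: "s \<in> simplices X" "x \<in> standard_simplex (simplex_dim s)" "y = ?q (s, x)"
      using y unfolding realization_def topspace_quotient_topology topspace_simplex_sum by auto
    then obtain v as where s: "s = simplex_of v as" and ch: "chain X v as"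
      using simplices_eq[OF scwol] by auto
    have "H (t, y) = cone_point v as t x" if "t \<in> {0..1}" for t
      using Hq[of "(t, s, x)"] that sx by (simp add: topspace_simplex_sum s contraction_eq[OF ch])
    then show ?thesis using sx ch s by (auto simp: point_def)
  qed
  show "simply_connected_space (realization X)"
  proof (rule simply_connected_space_contraction[OF H])
    fix y assume y: "y \<in> topspace (realization X)"
    show "H (0, y) = y" using rep[OF y] cone_point_0 by auto
    show "H (1, y) = point X z [] (\<lambda>n. if n = 0 then 1 else 0)" using rep[OF y] cone_point_1 by auto
  qed
qed (rule scwol)

end

section \<open>Link joins as cones, and transport of cones\<close>

text \<open>The constructors decide: only \<open>ApexUp x\<close> and \<open>LowApex b\<close> touch
  \<open>Apex\<close>, and an edge from \<open>Up x\<close> to \<open>Low b\<close> must be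
  \<open>LowUp b x\<close>, their composite.\<close>

lemma cone_link_join:
  assumes "scwol (link_join U L)"
  shows "cone (link_join U L) Apex"
proof
  note s = scwolD[OF assms]
  have sel: "ini (link_join U L) = join_ini U L" "ter (link_join U L) = join_ter U L" "cmp (link_join U L) = join_cmp U L"
    by (simp_all add: link_join_def)
  fix v assume v: "v \<in> verts (link_join U L)" "v \<noteq> Apex"
  show "\<exists>!a. a \<in> edges (link_join U L) \<and> (ini (link_join U L) a = v \<and> ter (link_join U L) a = Apex
      \<or> ini (link_join U L) a = Apex \<and> ter (link_join U L) a = v)"
  proof (cases v)
    case (Up x)
    show ?thesis
    proof (rule ex1I[of _ "ApexUp x"])
      fix a assume "a \<in> edges (link_join U L) \<and> (ini (link_join U L) a = v \<and> ter (link_join U L) a = Apex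
      \<or> ini (link_join U L) a = Apex \<and> ter (link_join U L) a = v)"
      then show "a = ApexUp x" using Up by (cases a) (auto simp: sel)
    qed (use v Up in \<open>auto simp: link_join_def\<close>)
  next
    case (Low b)
    show ?thesis
    proof (rule ex1I[of _ "LowApex b"])
      fix a assume "a \<in> edges (link_join U L) \<and> (ini (link_join U L) a = v \<and> ter (link_join U L) a = Apex
      \<or> ini (link_join U L) a = Apex \<and> ter (link_join U L) a = v)"
      then show "a = LowApex b" using Low by (cases a) (auto simp: sel)
    qed (use v Low in \<open>auto simp: link_join_def\<close>)
  qed (use v in simp)
next
  fix a b c
  assume "ini (link_join U L) b = Apex" "ter (link_join U L) b = ter (link_join U L) a"
    "ter (link_join U L) c = Apex" "ini (link_join U L) c = ini (link_join U L) a"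
  then show "a = cmp (link_join U L) b c"
    by (cases a; cases b; cases c) (auto simp: link_join_def)
qed (use assms in \<open>auto simp: link_join_def\<close>)

lemma scwol_isoD:
  assumes "scwol_iso X X' fv fe"
  shows "\<And>a. a \<in> edges X \<Longrightarrow> ini X' (fe a) = fv (ini X a) \<and> ter X' (fe a) = fv (ter X a) \<and> fe a \<in> edges X'"
    and "\<And>a b. \<lbrakk>a \<in> edges X; b \<in> edges X; ini X a = ter X b\<rbrakk> \<Longrightarrow> fe (cmp X a b) = cmp X' (fe a) (fe b)"
    and "\<And>v. v \<in> verts X \<Longrightarrow> fv v \<in> verts X'"
    and "\<And>v w. \<lbrakk>v \<in> verts X; w \<in> verts X\<rbrakk> \<Longrightarrow> fv v = fv w \<longleftrightarrow> v = w"
    and "\<And>a b. \<lbrakk>a \<in> edges X; b \<in> edges X\<rbrakk> \<Longrightarrow> fe a = fe b \<longleftrightarrow> a = b"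
    and "edges X' = fe ` edges X"
  using assms by (auto simp: scwol_iso_def nondeg_functor_def bij_betw_def composable2_def inj_on_def)

text \<open>Carries the cone structure from the local development to the development of \<iota>, on
  which the fundamental group acts.\<close>

lemma cone_scwol_iso:
  assumes iso: "scwol_iso X X' fv fe" and z: "z \<in> verts X" and "cone X' (fv z)"
  shows "cone X z"
proof
  interpret c: cone X' "fv z" by fact
  note f = scwol_isoD[OF iso]
  show X: "scwol X" using iso by (simp add: scwol_iso_def)
  note s = scwolD[OF X]
  show "z \<in> verts X" by fact
  fix v assume v: "v \<in> verts X" "v \<noteq> z"
  have eq: "fe a \<in> edges X' \<and> (ini X' (fe a) = fv v \<and> ter X' (fe a) = fv z \<or> ini X' (fe a) = fv z \<and> ter X' (fe a) = fv v)
    \<longleftrightarrow> ini X a = v \<and> ter X a = z \<or> ini X a = z \<and> ter X a = v" if "a \<in> edges X" for a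
    using that f(1)[OF that] f(4) v z s(1)[OF that] by auto
  have "\<exists>!a. a \<in> edges X' \<and> (ini X' a = fv v \<and> ter X' a = fv z \<or> ini X' a = fv z \<and> ter X' a = fv v)"
    by (rule c.spoke_ex1) (use v z f(3,4) in auto)
  then show "\<exists>!a. a \<in> edges X \<and> (ini X a = v \<and> ter X a = z \<or> ini X a = z \<and> ter X a = v)"
    using eq f(5,6) by (smt (verit) image_iff)
next
  interpret c: cone X' "fv z" by fact
  note f = scwol_isoD[OF iso]
  have X: "scwol X" using iso by (simp add: scwol_iso_def)
  fix a b c
  assume e: "a \<in> edges X" "b \<in> edges X" "c \<in> edges X" and
    ends: "ini X b = z" "ter X b = ter X a" "ter X c = z" "ini X c = ini X a"
  have "fe a = cmp X' (fe b) (fe c)"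
    by (rule c.through_apex) (use f(1)[OF e(1)] f(1)[OF e(2)] f(1)[OF e(3)] ends in auto)
  then have "fe a = fe (cmp X b c)" using f(2)[OF e(2,3)] ends by simp
  then show "a = cmp X b c" using f(5) e scwolD(2)[OF X e(2,3)] ends by simp
qed

section \<open>The fundamental group of a complex of groups\<close>

text \<open>These rules rewrite membership in \<open>lists (S \<times> UNIV)\<close>, on which the rules of \<open>pres_eq\<close> rely.\<close>

declare in_listsD [rule del] in_listsI [rule del]

section \<open>Groups given by generators and relations\<close>

fun word_value :: "('h, 'm) monoid_scheme \<Rightarrow> ('x \<Rightarrow> 'h) \<Rightarrow> 'x pword \<Rightarrow> 'h" where
  "word_value H f [] = \<one>\<^bsub>H\<^esub>"
| "word_value H f ((x, s) # w) = (if s then f x else inv\<^bsub>H\<^esub> f x) \<otimes>\<^bsub>H\<^esub> word_value H f w"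

lemma word_value_closed:
  assumes "group H" "f \<in> S \<rightarrow> carrier H" "w \<in> lists (S \<times> UNIV)"
  shows "word_value H f w \<in> carrier H"
proof -
  interpret group H by fact
  have "f x \<in> carrier H" if "x \<in> S" for x using that assms(2) by blast
  then show ?thesis using assms(3) by (induction w) auto
qed

lemma word_value_append:
  assumes "group H" "f \<in> S \<rightarrow> carrier H" "u \<in> lists (S \<times> UNIV)" "v \<in> lists (S \<times> UNIV)"
  shows "word_value H f (u @ v) = word_value H f u \<otimes>\<^bsub>H\<^esub> word_value H f v"
proof -
  interpret group H by fact
  note closed = word_value_closed[OF assms(1,2)]
  show ?thesis using assms(3)
  proof (induction u)
    case (Cons p u)
    obtain x s where p: "p = (x, s)" by (cases p)
    have "f x \<in> carrier H" using Cons.hyps assms(2) p by auto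
    then show ?case using Cons p closed[of u] closed[OF assms(4)] by (auto simp: m_assoc)
  qed (use closed[OF assms(4)] in auto)
qed

definition formal_inverse :: "'x pword \<Rightarrow> 'x pword" where
  "formal_inverse w = rev (map (\<lambda>(x, s). (x, \<not> s)) w)"

lemma formal_inverse_in: "w \<in> lists (S \<times> UNIV) \<Longrightarrow> formal_inverse w \<in> lists (S \<times> UNIV)"
  by (auto simp: formal_inverse_def in_lists_conv_set split: prod.splits)

locale presentation =
  fixes S :: "'x set" and R :: "('x pword \<times> 'x pword) set"
  assumes rels: "R \<subseteq> lists (S \<times> UNIV) \<times> lists (S \<times> UNIV)"
begin

lemma pres_eq_in: "pres_eq S R u v \<Longrightarrow> u \<in> lists (S \<times> UNIV) \<and> v \<in> lists (S \<times> UNIV)"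
  by (induction rule: pres_eq.induct) (use rels in auto)

lemma pres_eq_append_right:
  "pres_eq S R u v \<Longrightarrow> w \<in> lists (S \<times> UNIV) \<Longrightarrow> pres_eq S R (u @ w) (v @ w)"
proof (induction rule: pres_eq.induct)
  case (cancel u v x s)
  then show ?case using pres_eq.cancel[of u S "v @ w" x R s] by auto
next
  case (relation u v l r)
  then show ?case using pres_eq.relation[of u S "v @ w" l r R] by auto
qed (auto intro: pres_eq.refl pres_eq.sym pres_eq.trans)

lemma pres_eq_append_left:
  "pres_eq S R u v \<Longrightarrow> w \<in> lists (S \<times> UNIV) \<Longrightarrow> pres_eq S R (w @ u) (w @ v)"
proof (induction rule: pres_eq.induct)
  case (cancel u v x s)
  then show ?case using pres_eq.cancel[of "w @ u" S v x R s] by auto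
next
  case (relation u v l r)
  then show ?case using pres_eq.relation[of "w @ u" S v l r R] by auto
qed (auto intro: pres_eq.refl pres_eq.sym pres_eq.trans)

lemma pres_eq_append:
  "pres_eq S R u u' \<Longrightarrow> pres_eq S R v v' \<Longrightarrow> pres_eq S R (u @ v) (u' @ v')"
  using pres_eq_append_right[of u u' v] pres_eq_append_left[of v v' u'] pres_eq_in pres_eq.trans by blast

lemma pres_class_eq_iff:
  "v \<in> lists (S \<times> UNIV) \<Longrightarrow> pres_class S R u = pres_class S R v \<longleftrightarrow> pres_eq S R u v"
  unfolding pres_class_def by (auto intro: pres_eq.refl pres_eq.sym pres_eq.trans)

text \<open>The product is a union over all representatives; \<open>pres_eq\<close> is a congruence,
  so all members of the union are the same class.\<close>

lemma mult_pres_class: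
  assumes "u \<in> lists (S \<times> UNIV)" "v \<in> lists (S \<times> UNIV)"
  shows "pres_class S R u \<otimes>\<^bsub>presented_group S R\<^esub> pres_class S R v = pres_class S R (u @ v)"
proof -
  have "pres_class S R (u' @ v') = pres_class S R (u @ v)" if "pres_eq S R u u'" "pres_eq S R v v'" for u' v'
    using that assms pres_class_eq_iff[of "u @ v"] pres_eq_append pres_eq.sym by (metis append_in_lists_conv)
  then have "(\<Union>u'\<in>pres_class S R u. \<Union>v'\<in>pres_class S R v. pres_class S R (u' @ v'))
      = (\<Union>u'\<in>pres_class S R u. \<Union>v'\<in>pres_class S R v. pres_class S R (u @ v))"
    by (intro SUP_cong HOL.refl) (simp add: pres_class_def)
  moreover have "u \<in> pres_class S R u" "v \<in> pres_class S R v"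
    using assms by (auto simp: pres_class_def intro: pres_eq.refl)
  ultimately show ?thesis
    unfolding presented_group_def by auto
qed

lemma one_presented_group: "\<one>\<^bsub>presented_group S R\<^esub> = pres_class S R []"
  by (simp add: presented_group_def)

lemma carrier_presented_group: "carrier (presented_group S R) = pres_class S R ` lists (S \<times> UNIV)"
  by (simp add: presented_group_def)

lemma pres_class_in: "w \<in> lists (S \<times> UNIV) \<Longrightarrow> pres_class S R w \<in> carrier (presented_group S R)"
  by (simp add: carrier_presented_group)

lemma formal_inverse_cancel: "w \<in> lists (S \<times> UNIV) \<Longrightarrow> pres_eq S R (formal_inverse w @ w) []"
proof (induction w)
  case (Cons p w)
  obtain x s where p: "p = (x, s)" by (cases p)
  have "pres_eq S R (formal_inverse w @ [(x, \<not> s), (x, \<not> \<not> s)] @ w) (formal_inverse w @ w)"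
    by (rule pres_eq.cancel) (use Cons.prems p in \<open>auto intro: formal_inverse_in\<close>)
  then have "pres_eq S R (formal_inverse (p # w) @ p # w) (formal_inverse w @ w)"
    by (simp add: p formal_inverse_def)
  then show ?case using Cons pres_eq.trans by force
qed (auto simp: formal_inverse_def intro: pres_eq.refl)

lemma group_presented_group: "group (presented_group S R)"
proof (rule groupI)
  fix x assume "x \<in> carrier (presented_group S R)"
  then obtain w where w: "w \<in> lists (S \<times> UNIV)" "x = pres_class S R w"
    by (auto simp: carrier_presented_group)
  show "\<exists>y\<in>carrier (presented_group S R). y \<otimes>\<^bsub>presented_group S R\<^esub> x = \<one>\<^bsub>presented_group S R\<^esub>"
  proof
    show "pres_class S R (formal_inverse w) \<otimes>\<^bsub>presented_group S R\<^esub> x = \<one>\<^bsub>presented_group S R\<^esub>"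
      using w formal_inverse_in[OF w(1)] formal_inverse_cancel[OF w(1)]
      by (simp add: mult_pres_class one_presented_group pres_class_eq_iff)
  qed (intro pres_class_in formal_inverse_in w)
qed (auto simp: carrier_presented_group one_presented_group mult_pres_class intro: pres_class_in)

lemma word_value_pres_eq:
  assumes H: "group H" and f: "f \<in> S \<rightarrow> carrier H"
    and rel: "\<And>l r. (l, r) \<in> R \<Longrightarrow> word_value H f l = word_value H f r"
    and "pres_eq S R u v"
  shows "word_value H f u = word_value H f v"
proof -
  interpret group H by fact
  note app = word_value_append[OF H f] and closed = word_value_closed[OF H f]
  show ?thesis using assms(4)
  proof (induction rule: pres_eq.induct)
    case (cancel u v x s)
    have x: "f x \<in> carrier H" using f cancel by auto
    have "word_value H f ([(x, s), (x, \<not> s)] @ v) = word_value H f v"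
      using x closed[OF cancel(2)] by (auto simp: m_assoc[symmetric])
    then show ?case using cancel app[of u "[(x, s), (x, \<not> s)] @ v"] app[of u v] by simp
  next
    case (relation u v l r)
    then have lr: "l \<in> lists (S \<times> UNIV)" "r \<in> lists (S \<times> UNIV)" using rels by auto
    have "word_value H f (l @ v) = word_value H f (r @ v)"
      using lr relation rel by (simp add: app)
    then show ?case using lr relation app[of u "l @ v"] app[of u "r @ v"] by simp
  qed auto
qed

text \<open>Von Dyck's theorem: a class is evaluated at any word in it, and
  \<open>word_value_pres_eq\<close> makes the choice irrelevant.\<close>

lemma presented_group_lift:
  assumes H: "group H" and f: "f \<in> S \<rightarrow> carrier H"
    and rel: "\<And>l r. (l, r) \<in> R \<Longrightarrow> word_value H f l = word_value H f r"
  shows "\<exists>\<theta>\<in>hom (presented_group S R) H. \<forall>w\<in>lists (S \<times> UNIV). \<theta> (pres_class S R w) = word_value H f w"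
proof -
  define \<theta> where "\<theta> A = word_value H f (SOME w. w \<in> A)" for A
  have \<theta>: "\<theta> (pres_class S R w) = word_value H f w" if "w \<in> lists (S \<times> UNIV)" for w
  proof -
    have "w \<in> pres_class S R w" using that by (auto simp: pres_class_def intro: pres_eq.refl)
    then have "(SOME u. u \<in> pres_class S R w) \<in> pres_class S R w" by (rule someI)
    then show ?thesis
      unfolding \<theta>_def using word_value_pres_eq[OF H f rel] by (fastforce simp: pres_class_def)
  qed
  have "\<theta> \<in> hom (presented_group S R) H"
    by (rule homI) (auto simp: carrier_presented_group \<theta> mult_pres_class word_value_append[OF H f]
        word_value_closed[OF H f])
  with \<theta> show ?thesis by blast
qed

lemma hom_presented_group_eqI:
  assumes H: "group H" and h: "h \<in> hom (presented_group S R) H" and k: "k \<in> hom (presented_group S R) H"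
    and eq: "\<And>x. x \<in> S \<Longrightarrow> h (pres_class S R [(x, True)]) = k (pres_class S R [(x, True)])"
    and x: "x \<in> carrier (presented_group S R)"
  shows "h x = k x"
proof -
  interpret H: group H by fact
  interpret P: group "presented_group S R" by (rule group_presented_group)
  interpret h: group_hom "presented_group S R" H h by unfold_locales (rule h)
  interpret k: group_hom "presented_group S R" H k by unfold_locales (rule k)
  have gen: "h (pres_class S R [(x, s)]) = k (pres_class S R [(x, s)])" if "x \<in> S" for x s
  proof (cases s)
    case False
    have "pres_class S R [(x, False)] \<otimes>\<^bsub>presented_group S R\<^esub> pres_class S R [(x, True)] = \<one>\<^bsub>presented_group S R\<^esub>"
      using that pres_eq.cancel[of "[]" S "[]" x R False]
      by (simp add: mult_pres_class one_presented_group pres_class_eq_iff)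
    then have "pres_class S R [(x, False)] = inv\<^bsub>presented_group S R\<^esub> pres_class S R [(x, True)]"
      by (intro P.inv_equality[symmetric]) (use that in \<open>auto intro!: pres_class_in\<close>)
    then show ?thesis using False eq[OF that] pres_class_in[of "[(x, True)]"] that by simp
  qed (use eq that in auto)
  obtain w where w: "w \<in> lists (S \<times> UNIV)" "x = pres_class S R w"
    using x by (auto simp: carrier_presented_group)
  have "h (pres_class S R w) = k (pres_class S R w)" using w(1)
  proof (induction w)
    case Nil
    then show ?case by (simp flip: one_presented_group)
  next
    case (Cons p w)
    obtain y s where p: "p = (y, s)" by (cases p)
    have "pres_class S R (p # w) = pres_class S R [p] \<otimes>\<^bsub>presented_group S R\<^esub> pres_class S R w"
      using Cons.hyps by (simp add: mult_pres_class)
    then show ?case using Cons p gen[of y s] pres_class_in[of w] pres_class_in[of "[p]"] by simp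
  qed
  then show ?thesis using w by simp
qed

end

section \<open>Morphisms to a group and the universal property\<close>

definition group_morphism :: "('v, 'e) scwol_data \<Rightarrow> ('v, 'e, 'g) cog_data \<Rightarrow> ('h, 'm) monoid_scheme \<Rightarrow>
    ('v \<Rightarrow> 'g \<Rightarrow> 'h) \<Rightarrow> ('e \<Rightarrow> 'h) \<Rightarrow> bool" where
  "group_morphism Y G \<Gamma> \<phi> \<phi>e \<longleftrightarrow> group \<Gamma> \<and>
     (\<forall>\<sigma>\<in>verts Y. \<phi> \<sigma> \<in> hom (lgrp G \<sigma>) \<Gamma>) \<and>
     (\<forall>a\<in>edges Y. \<phi>e a \<in> carrier \<Gamma> \<and>
        (\<forall>g\<in>carrier (lgrp G (ini Y a)). Ad \<Gamma> (\<phi>e a) (\<phi> (ini Y a) g) = \<phi> (ter Y a) (lhom G a g))) \<and>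
     (\<forall>(a, b)\<in>composable2 Y.
        \<phi> (ter Y a) (twist G a b) \<otimes>\<^bsub>\<Gamma>\<^esub> \<phi>e (cmp Y a b) = \<phi>e a \<otimes>\<^bsub>\<Gamma>\<^esub> \<phi>e b)"

lemma group_morphismD:
  assumes "group_morphism Y G \<Gamma> \<phi> \<phi>e"
  shows "group \<Gamma>" and "\<And>\<sigma>. \<sigma> \<in> verts Y \<Longrightarrow> \<phi> \<sigma> \<in> hom (lgrp G \<sigma>) \<Gamma>"
    and "\<And>a. a \<in> edges Y \<Longrightarrow> \<phi>e a \<in> carrier \<Gamma>"
    and "\<And>a g. \<lbrakk>a \<in> edges Y; g \<in> carrier (lgrp G (ini Y a))\<rbrakk> \<Longrightarrow>
      Ad \<Gamma> (\<phi>e a) (\<phi> (ini Y a) g) = \<phi> (ter Y a) (lhom G a g)"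
    and "\<And>a b. \<lbrakk>a \<in> edges Y; b \<in> edges Y; ini Y a = ter Y b\<rbrakk> \<Longrightarrow>
      \<phi> (ter Y a) (twist G a b) \<otimes>\<^bsub>\<Gamma>\<^esub> \<phi>e (cmp Y a b) = \<phi>e a \<otimes>\<^bsub>\<Gamma>\<^esub> \<phi>e b"
    and "\<And>\<sigma> g. \<sigma> \<in> verts Y \<Longrightarrow> g \<in> carrier (lgrp G \<sigma>) \<Longrightarrow> \<phi> \<sigma> g \<in> carrier \<Gamma>"
  using assms by (auto simp: group_morphism_def composable2_def hom_def)

lemma complex_of_groupsD:
  assumes "complex_of_groups Y G"
  shows "scwol Y" and "\<And>\<sigma>. \<sigma> \<in> verts Y \<Longrightarrow> group (lgrp G \<sigma>)"
    and "\<And>a. a \<in> edges Y \<Longrightarrow> lhom G a \<in> hom (lgrp G (ini Y a)) (lgrp G (ter Y a))"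
    and "\<And>a. a \<in> edges Y \<Longrightarrow> inj_on (lhom G a) (carrier (lgrp G (ini Y a)))"
    and "\<And>a b. \<lbrakk>a \<in> edges Y; b \<in> edges Y; ini Y a = ter Y b\<rbrakk> \<Longrightarrow> twist G a b \<in> carrier (lgrp G (ter Y a))"
    and "\<And>a b g. \<lbrakk>a \<in> edges Y; b \<in> edges Y; ini Y a = ter Y b; g \<in> carrier (lgrp G (ini Y b))\<rbrakk> \<Longrightarrow>
      Ad (lgrp G (ter Y a)) (twist G a b) (lhom G (cmp Y a b) g) = lhom G a (lhom G b g)"
    and "\<And>a b c. \<lbrakk>a \<in> edges Y; b \<in> edges Y; c \<in> edges Y; ini Y a = ter Y b; ini Y b = ter Y c\<rbrakk> \<Longrightarrow>
      lhom G a (twist G b c) \<otimes>\<^bsub>lgrp G (ter Y a)\<^esub> twist G a (cmp Y b c) =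
        twist G a b \<otimes>\<^bsub>lgrp G (ter Y a)\<^esub> twist G (cmp Y a b) c"
  using assms by (auto simp: complex_of_groups_def composable2_def composable3_def)

locale fundamental_group =
  fixes Y :: "('v, 'e) scwol_data" and G :: "('v, 'e, 'g) cog_data" and T :: "'e set"
  assumes cog: "complex_of_groups Y G" and tree: "T \<subseteq> edges Y"
begin

lemma scwol: "scwol Y" using cog by (rule complex_of_groupsD)

lemma edge_verts: "a \<in> edges Y \<Longrightarrow> ini Y a \<in> verts Y" "a \<in> edges Y \<Longrightarrow> ter Y a \<in> verts Y"
  using scwol by (auto simp: scwol_def)

lemma cmp_edge: "a \<in> edges Y \<Longrightarrow> b \<in> edges Y \<Longrightarrow> ini Y a = ter Y b \<Longrightarrow> cmp Y a b \<in> edges Y"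
  using scwol by (auto simp: scwol_def)

lemma lhom_closed: "a \<in> edges Y \<Longrightarrow> g \<in> carrier (lgrp G (ini Y a)) \<Longrightarrow> lhom G a g \<in> carrier (lgrp G (ter Y a))"
  using complex_of_groupsD(3)[OF cog] by (auto simp: hom_def)

lemma gens: "Loc \<sigma> g \<in> pi1_gens Y G \<longleftrightarrow> \<sigma> \<in> verts Y \<and> g \<in> carrier (lgrp G \<sigma>)"
  "Plus a \<in> pi1_gens Y G \<longleftrightarrow> a \<in> edges Y" "Minus a \<in> pi1_gens Y G \<longleftrightarrow> a \<in> edges Y"
  by (auto simp: pi1_gens_def)

sublocale presentation "pi1_gens Y G" "pi1_rels Y G T"
proof
  have "g \<otimes>\<^bsub>lgrp G \<sigma>\<^esub> h \<in> carrier (lgrp G \<sigma>)"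
    if "\<sigma> \<in> verts Y" "g \<in> carrier (lgrp G \<sigma>)" "h \<in> carrier (lgrp G \<sigma>)" for \<sigma> g h
    using that complex_of_groupsD(2)[OF cog, THEN group.is_monoid] by (auto intro: monoid.m_closed)
  then show "pi1_rels Y G T \<subseteq> lists (pi1_gens Y G \<times> UNIV) \<times> lists (pi1_gens Y G \<times> UNIV)"
    using tree by (auto simp: pi1_rels_def gens composable2_def edge_verts cmp_edge lhom_closed
        complex_of_groupsD(5)[OF cog])
qed

lemma pi1_eq: "pi1 Y G T = presented_group (pi1_gens Y G) (pi1_rels Y G T)"
  by (simp add: pi1_def)

lemma group_pi1: "group (pi1 Y G T)"
  unfolding pi1_eq by (rule group_presented_group)

lemma relation: "(l, r) \<in> pi1_rels Y G T \<Longrightarrow>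
    pres_class (pi1_gens Y G) (pi1_rels Y G T) l = pres_class (pi1_gens Y G) (pi1_rels Y G T) r"
  using pres_eq.relation[of "[]" "pi1_gens Y G" "[]" l r] rels by (subst pres_class_eq_iff) auto

abbreviation "cls w \<equiv> pres_class (pi1_gens Y G) (pi1_rels Y G T) w"

lemma iota_edge_inverse:
  assumes "a \<in> edges Y"
  shows "inv\<^bsub>pi1 Y G T\<^esub> (iota_edge Y G T a) = cls [(Minus a, True)]"
proof -
  interpret group "pi1 Y G T" by (rule group_pi1)
  have "cls [(Minus a, True)] = cls [(Plus a, False)]"
    by (rule relation[symmetric]) (use assms in \<open>auto simp: pi1_rels_def\<close>)
  moreover have "cls [(Plus a, False)] \<otimes>\<^bsub>pi1 Y G T\<^esub> cls [(Plus a, True)] = \<one>\<^bsub>pi1 Y G T\<^esub>"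
    using assms pres_eq.cancel[of "[]" "pi1_gens Y G" "[]" "Plus a" _ False]
    unfolding pi1_eq by (simp add: mult_pres_class one_presented_group pres_class_eq_iff gens)
  ultimately show ?thesis
    unfolding iota_edge_def
    by (intro inv_equality) (use assms in \<open>auto simp: pi1_eq gens intro!: pres_class_in\<close>)
qed

text \<open>Each axiom of a morphism is one family of relations in \<open>pi1_rels\<close>, with
  \<open>Minus a\<close> standing for the inverse of \<open>Plus a\<close>.\<close>

lemma group_morphism_iota: "group_morphism Y G (pi1 Y G T) (iota_grp Y G T) (iota_edge Y G T)"
  unfolding group_morphism_def
proof (intro conjI ballI)
  fix \<sigma> assume s: "\<sigma> \<in> verts Y"
  show "iota_grp Y G T \<sigma> \<in> hom (lgrp G \<sigma>) (pi1 Y G T)"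
  proof (rule homI)
    fix g h assume gh: "g \<in> carrier (lgrp G \<sigma>)" "h \<in> carrier (lgrp G \<sigma>)"
    have "cls [(Loc \<sigma> g, True), (Loc \<sigma> h, True)] = cls [(Loc \<sigma> (g \<otimes>\<^bsub>lgrp G \<sigma>\<^esub> h), True)]"
      by (rule relation) (use s gh in \<open>auto simp: pi1_rels_def\<close>)
    then show "iota_grp Y G T \<sigma> (g \<otimes>\<^bsub>lgrp G \<sigma>\<^esub> h) = iota_grp Y G T \<sigma> g \<otimes>\<^bsub>pi1 Y G T\<^esub> iota_grp Y G T \<sigma> h"
      using s gh by (simp add: iota_grp_def pi1_eq mult_pres_class gens)
  qed (use s in \<open>auto simp: iota_grp_def pi1_eq gens intro!: pres_class_in\<close>)
next
  fix a assume a: "a \<in> edges Y"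
  then show "iota_edge Y G T a \<in> carrier (pi1 Y G T)"
    by (auto simp: iota_edge_def pi1_eq gens intro!: pres_class_in)
  fix g assume g: "g \<in> carrier (lgrp G (ini Y a))"
  have "cls [(Loc (ter Y a) (lhom G a g), True)] = cls [(Plus a, True), (Loc (ini Y a) g, True), (Minus a, True)]"
    by (rule relation) (use a g in \<open>auto simp: pi1_rels_def\<close>)
  then show "Ad (pi1 Y G T) (iota_edge Y G T a) (iota_grp Y G T (ini Y a) g) = iota_grp Y G T (ter Y a) (lhom G a g)"
    unfolding Ad_def iota_edge_inverse[OF a]
    using a g edge_verts by (simp add: iota_grp_def iota_edge_def pi1_eq mult_pres_class gens)
next
  fix p assume "p \<in> composable2 Y"
  then obtain a b where p: "p = (a, b)" and ab: "a \<in> edges Y" "b \<in> edges Y" "ini Y a = ter Y b"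
    by (auto simp: composable2_def)
  have "cls [(Plus a, True), (Plus b, True)] = cls [(Loc (ter Y a) (twist G a b), True), (Plus (cmp Y a b), True)]"
    by (rule relation) (use ab in \<open>auto simp: pi1_rels_def composable2_def\<close>)
  then show "case p of (a, b) \<Rightarrow> iota_grp Y G T (ter Y a) (twist G a b) \<otimes>\<^bsub>pi1 Y G T\<^esub> iota_edge Y G T (cmp Y a b) =
     iota_edge Y G T a \<otimes>\<^bsub>pi1 Y G T\<^esub> iota_edge Y G T b"
    using ab edge_verts cmp_edge complex_of_groupsD(5)[OF cog]
    by (simp add: p iota_grp_def iota_edge_def pi1_eq mult_pres_class gens)
qed (rule group_pi1)

lemma iota_edge_tree: "a \<in> T \<Longrightarrow> iota_edge Y G T a = \<one>\<^bsub>pi1 Y G T\<^esub>"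
  unfolding iota_edge_def pi1_eq one_presented_group by (rule relation) (auto simp: pi1_rels_def)

text \<open>Universal property of the fundamental group: evaluated in \<open>H\<close>, the
  relations of \<open>pi1_rels\<close> become the axioms of a morphism together with triviality on
  \<open>T\<close>.\<close>

lemma pi1_lift:
  assumes "group_morphism Y G H \<phi> \<phi>e" and "\<And>a. a \<in> T \<Longrightarrow> \<phi>e a = \<one>\<^bsub>H\<^esub>"
  shows "\<exists>\<theta>\<in>hom (pi1 Y G T) H. (\<forall>\<sigma>\<in>verts Y. \<forall>g\<in>carrier (lgrp G \<sigma>). \<theta> (iota_grp Y G T \<sigma> g) = \<phi> \<sigma> g)
     \<and> (\<forall>a\<in>edges Y. \<theta> (iota_edge Y G T a) = \<phi>e a)"
proof -
  note m = group_morphismD[OF assms(1)]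
  interpret H: group H by (rule m)
  define f where "f x = (case x of Loc \<sigma> g \<Rightarrow> \<phi> \<sigma> g | Plus a \<Rightarrow> \<phi>e a | Minus a \<Rightarrow> inv\<^bsub>H\<^esub> \<phi>e a)" for x
  have f: "f \<in> pi1_gens Y G \<rightarrow> carrier H"
    using m(3,6) by (auto simp: f_def pi1_gens_def)
  have "word_value H f l = word_value H f r" if "(l, r) \<in> pi1_rels Y G T" for l r
    using that tree m(3,6) hom_mult[OF m(2)] m(4)[symmetric] m(5)[symmetric] assms(2)
    by (auto simp: pi1_rels_def f_def composable2_def Ad_def edge_verts cmp_edge lhom_closed
        complex_of_groupsD(5)[OF cog] H.m_assoc)
  from presented_group_lift[OF H.group_axioms f this]
  obtain \<theta> where "\<theta> \<in> hom (pi1 Y G T) H" and \<theta>: "\<And>w. w \<in> lists (pi1_gens Y G \<times> UNIV) \<Longrightarrow> \<theta> (cls w) = word_value H f w"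
    by (auto simp: pi1_eq)
  moreover have "\<theta> (iota_grp Y G T \<sigma> g) = \<phi> \<sigma> g" if "\<sigma> \<in> verts Y" "g \<in> carrier (lgrp G \<sigma>)" for \<sigma> g
    using that m(6) by (simp add: iota_grp_def \<theta> gens f_def)
  moreover have "\<theta> (iota_edge Y G T a) = \<phi>e a" if "a \<in> edges Y" for a
    using that m(3) by (simp add: iota_edge_def \<theta> gens f_def)
  ultimately show ?thesis by blast
qed

lemma hom_pi1_eqI:
  assumes H: "group H" and h: "h \<in> hom (pi1 Y G T) H" and k: "k \<in> hom (pi1 Y G T) H"
    and loc: "\<And>\<sigma> g. \<sigma> \<in> verts Y \<Longrightarrow> g \<in> carrier (lgrp G \<sigma>) \<Longrightarrow> h (iota_grp Y G T \<sigma> g) = k (iota_grp Y G T \<sigma> g)"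
    and edge: "\<And>a. a \<in> edges Y \<Longrightarrow> h (iota_edge Y G T a) = k (iota_edge Y G T a)"
    and x: "x \<in> carrier (pi1 Y G T)"
  shows "h x = k x"
proof (rule hom_presented_group_eqI[OF H])
  interpret H: group H by fact
  interpret P: group "pi1 Y G T" by (rule group_pi1)
  interpret h: group_hom "pi1 Y G T" H h by unfold_locales (rule h)
  interpret k: group_hom "pi1 Y G T" H k by unfold_locales (rule k)
  fix s assume s: "s \<in> pi1_gens Y G"
  show "h (cls [(s, True)]) = k (cls [(s, True)])"
  proof (cases s)
    case (Minus a)
    then have a: "a \<in> edges Y" using s by (simp add: gens)
    have "iota_edge Y G T a \<in> carrier (pi1 Y G T)"
      using group_morphismD(3)[OF group_morphism_iota a] .
    then show ?thesis
      using iota_edge_inverse[OF a] edge[OF a] h.hom_inv k.hom_inv by (metis Minus)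
  qed (use s loc edge in \<open>auto simp: gens iota_grp_def iota_edge_def\<close>)
qed (use h k x in \<open>auto simp: pi1_eq\<close>)

end

section \<open>Maximal trees\<close>

lemma edge_path_append:
  "edge_path Y T v (p @ q) w \<longleftrightarrow> (\<exists>u. edge_path Y T v p u \<and> edge_path Y T u q w)"
  by (induction Y T v p w rule: edge_path.induct) auto

lemma edge_path_mono: "edge_path Y T v p w \<Longrightarrow> T \<subseteq> T' \<Longrightarrow> edge_path Y T' v p w"
  by (induction Y T v p w rule: edge_path.induct) auto

lemma edge_path_edges: "edge_path Y T v p w \<Longrightarrow> (a, s) \<in> set p \<Longrightarrow> a \<in> T"
  by (induction Y T v p w rule: edge_path.induct) auto

lemma reduced_path_append:
  "reduced_path (p @ q) \<longleftrightarrow> reduced_path p \<and> reduced_path q \<and>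
     (p \<noteq> [] \<and> q \<noteq> [] \<longrightarrow> \<not> (fst (last p) = fst (hd q) \<and> snd (last p) \<noteq> snd (hd q)))"
  unfolding reduced_path_def by (auto simp: successively_append_iff)

lemma reduced_path_Cons:
  "reduced_path (x # q) \<longleftrightarrow> reduced_path q \<and> (q \<noteq> [] \<longrightarrow> \<not> (fst x = fst (hd q) \<and> snd x \<noteq> snd (hd q)))"
  using reduced_path_append[of "[x]" q] by (auto simp: reduced_path_def)

lemma reduced_path_Nil [simp]: "reduced_path []"
  by (simp add: reduced_path_def)

lemma tree_inD:
  assumes "tree_in Y W T"
  shows "W \<subseteq> verts Y" "W \<noteq> {}" "T \<subseteq> edges Y"
    and "\<And>a. a \<in> T \<Longrightarrow> ini Y a \<in> W \<and> ter Y a \<in> W"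
    and "\<And>v w. v \<in> W \<Longrightarrow> w \<in> W \<Longrightarrow> \<exists>!p. edge_path Y T v p w \<and> reduced_path p"
  using assms by (auto simp: tree_in_def)

text \<open>The new vertex \<open>y\<close> meets only the edge \<open>e\<close>. A path that enters
  \<open>y\<close> on its way must leave along \<open>e\<close> again, which is a backtrack; so a
  reduced path that ends in \<open>W\<close> can visit \<open>y\<close> only as its starting
  point.\<close>

lemma reduced_path_leaf:
  assumes T: "tree_in Y W T" and x: "x \<in> W" and y: "y \<notin> W"
    and xy: "x = (if s then ini Y e else ter Y e)" "y = (if s then ter Y e else ini Y e)"
    and p: "edge_path Y (insert e T) v p w" "reduced_path p" "w \<in> W"
  shows "(v \<in> W \<longrightarrow> edge_path Y T v p w) \<and> (v = y \<longrightarrow> (\<exists>q. p = (e, \<not> s) # q \<and> edge_path Y T x q w))"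
  using p
proof (induction p arbitrary: v)
  case (Cons u p)
  obtain a r where u: "u = (a, r)" by (cases u)
  let ?v' = "if r then ter Y a else ini Y a"
  have red: "reduced_path p" using Cons.prems by (simp add: reduced_path_Cons)
  have path: "edge_path Y (insert e T) ?v' p w" and a: "a = e \<or> a \<in> T"
    and v: "v = (if r then ini Y a else ter Y a)"
    using Cons.prems by (auto simp: u)
  note IH = Cons.IH[OF path red Cons.prems(3)]
  show ?case
  proof (cases "a \<in> T")
    case True
    then have "v \<in> W" "?v' \<in> W" using tree_inD(4)[OF T True] v by auto
    then show ?thesis using IH True v y by (auto simp: u)
  next
    case False
    then have ae: "a = e" using a by simp
    show ?thesis
    proof (cases "r = s")
      case True
      \<comment> \<open>This step enters \<open>y\<close>, and by the induction hypothesis the next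
        one goes straight back.\<close>
      then have "v = x" "?v' = y" using v xy ae by auto
      then obtain q where "p = (e, \<not> s) # q" using IH by auto
      then have False using Cons.prems(2) u ae True by (simp add: reduced_path_Cons)
      then show ?thesis ..
    next
      case False
      then have "v = y" "?v' = x" using v xy ae by auto
      then show ?thesis using IH x y False ae by (auto simp: u)
    qed
  qed
qed (use y in auto)

text \<open>Reduced paths between \<open>y\<close> and an old vertex are the old ones between
  \<open>x\<close> and that vertex with one step along \<open>e\<close> added; two old vertices are
  joined by the old paths only.\<close>

lemma tree_in_insert_leaf:
  assumes T: "tree_in Y W T" and e: "e \<in> edges Y" and x: "x \<in> W" and y: "y \<notin> W" "y \<in> verts Y"
    and xy: "x = (if s then ini Y e else ter Y e)" "y = (if s then ter Y e else ini Y e)"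
  shows "tree_in Y (insert y W) (insert e T)"
proof -
  note t = tree_inD[OF T]
  note leaf = reduced_path_leaf[OF T x y(1) xy]
  have eT: "e \<notin> T" using t(4)[of e] xy y by (auto split: if_splits)
  have step: "edge_path Y (insert e T) x [(e, s)] y" "edge_path Y (insert e T) y [(e, \<not> s)] x"
    using xy by auto
  have mono: "edge_path Y T v p w \<Longrightarrow> edge_path Y (insert e T) v p w" for v p w
    by (erule edge_path_mono) auto
  \<comment> \<open>Edges of \<open>T\<close> have both ends in \<open>W\<close>, so a path can
    arrive at \<open>y\<close> only along \<open>e\<close>.\<close>
  have ends: "\<exists>q. p = q @ [(e, s)] \<and> edge_path Y (insert e T) v q x"
    if p0: "edge_path Y (insert e T) v p y \<and> p \<noteq> []" for p v
  proof -
    obtain q u where "p = q @ [u]" using p0 by (cases p rule: rev_cases) auto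
    moreover obtain a r where "u = (a, r)" by (cases u)
    ultimately have p: "p = q @ [(a, r)]" by simp
    then have a: "a \<in> insert e T" "y = (if r then ter Y a else ini Y a)"
      and q: "edge_path Y (insert e T) v q (if r then ini Y a else ter Y a)"
      using p0 by (auto simp: edge_path_append)
    have "a = e" using a t(4)[of a] y by (auto split: if_splits)
    moreover then have "r = s" using a xy x y by (auto split: if_splits)
    ultimately show ?thesis using p q xy by auto
  qed
  have "\<exists>!p. edge_path Y (insert e T) v p w \<and> reduced_path p" if v: "v \<in> insert y W" and w: "w \<in> insert y W" for v w
  proof (cases "w = y")
    case False
    then have wW: "w \<in> W" using w by simp
    show ?thesis
    proof (cases "v = y")
      case True
      obtain p where p: "edge_path Y T x p w" "reduced_path p" using t(5)[OF x wW] by blast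
      then have "p \<noteq> [] \<Longrightarrow> fst (hd p) \<noteq> e" using edge_path_edges[OF p(1)] eT by (cases p) auto
      then have "reduced_path ((e, \<not> s) # p)" using p by (auto simp: reduced_path_Cons)
      moreover have "edge_path Y (insert e T) y ((e, \<not> s) # p) w"
        using mono[OF p(1)] step(2) by simp
      moreover have "q = (e, \<not> s) # p" if "edge_path Y (insert e T) y q w" "reduced_path q" for q
        using leaf[OF that wW] that(2) p t(5)[OF x wW] by (auto simp: reduced_path_Cons)
      ultimately show ?thesis using True by blast
    next
      case False
      then have vW: "v \<in> W" using v by simp
      then show ?thesis using t(5)[OF vW wW] leaf[OF _ _ wW] mono by blast
    qed
  next
    case wy: True
    show ?thesis
    proof (cases "v = y")
      case True
      \<comment> \<open>A nonempty reduced loop at \<open>y\<close> would leave and return along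
        \<open>e\<close>. The loop at \<open>x\<close> in between is reduced, hence empty, and then
        the two steps along \<open>e\<close> form a backtrack.\<close>
      have "p = []" if p: "edge_path Y (insert e T) y p y" "reduced_path p" for p
      proof (rule ccontr)
        assume "p \<noteq> []"
        then obtain q where q: "p = q @ [(e, s)]" "edge_path Y (insert e T) y q x" using ends[of y p] p by blast
        then obtain q' where q': "q = (e, \<not> s) # q'" "edge_path Y T x q' x"
          using leaf[OF q(2) _ x] p(2) by (auto simp: reduced_path_append)
        have "reduced_path q'" using p(2) q q' by (auto simp: reduced_path_append reduced_path_Cons)
        then have "q' = []" using t(5)[OF x x] q'(2) by (metis edge_path.simps(1) reduced_path_Nil)
        then show False using p(2) q q' by (simp add: reduced_path_Cons)
      qed
      then show ?thesis using True wy by (metis edge_path.simps(1) reduced_path_Nil)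
    next
      case False
      then have vW: "v \<in> W" using v by simp
      obtain p where p: "edge_path Y T v p x" "reduced_path p" using t(5)[OF vW x] by blast
      then have "p \<noteq> [] \<Longrightarrow> fst (last p) \<noteq> e"
        using edge_path_edges[OF p(1), of "fst (last p)" "snd (last p)"] eT by auto
      then have "reduced_path (p @ [(e, s)])" using p by (auto simp: reduced_path_append reduced_path_Cons)
      moreover have "edge_path Y (insert e T) v (p @ [(e, s)]) y"
        using mono[OF p(1)] step(1) by (auto simp: edge_path_append)
      moreover have "q = p @ [(e, s)]" if q: "edge_path Y (insert e T) v q y" "reduced_path q" for q
      proof -
        have "q \<noteq> []" using q(1) False by auto
        then obtain q' where q': "q = q' @ [(e, s)]" "edge_path Y (insert e T) v q' x" using ends[of v q] q by blast
        moreover have "reduced_path q'" using q q' by (simp add: reduced_path_append)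
        ultimately show ?thesis using leaf[OF q'(2) _ x] vW p t(5)[OF vW x] by blast
      qed
      ultimately show ?thesis using wy by blast
    qed
  qed
  moreover have "insert e T \<subseteq> {a \<in> edges Y. ini Y a \<in> insert y W \<and> ter Y a \<in> insert y W}"
    using t(3,4) e x xy by (auto split: if_splits)
  ultimately show ?thesis using t(1) y(2) unfolding tree_in_def by auto
qed

text \<open>An edge from the tree to a missing vertex could be attached as a leaf, against
  maximality. The edges at \<open>z\<close> first bring \<open>z\<close> into the tree and then
  every other vertex.\<close>

lemma maximal_tree_spanning:
  assumes T: "maximal_tree Y W T" and z: "z \<in> verts Y"
    and star: "\<And>v. v \<in> verts Y \<Longrightarrow> v \<noteq> z \<Longrightarrow> \<exists>e\<in>edges Y. ini Y e = v \<and> ter Y e = z \<or> ini Y e = z \<and> ter Y e = v"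
  shows "W = verts Y"
proof -
  have tree: "tree_in Y W T" and max: "\<And>W' T'. \<lbrakk>tree_in Y W' T'; W \<subseteq> W'; T \<subseteq> T'\<rbrakk> \<Longrightarrow> W' = W"
    using T by (auto simp: maximal_tree_def)
  note t = tree_inD[OF tree]
  have grow: "y \<in> W" if "e \<in> edges Y" "x \<in> W" "y \<in> verts Y" "ini Y e = x \<and> ter Y e = y \<or> ini Y e = y \<and> ter Y e = x" for e x y
  proof (rule ccontr)
    assume y: "y \<notin> W"
    have "tree_in Y (insert y W) (insert e T)"
      by (rule tree_in_insert_leaf[OF tree that(1,2) y that(3), of "ini Y e = x"]) (use that(4) in auto)
    from max[OF this] y show False by auto
  qed
  have "z \<in> W"
  proof (rule ccontr)
    assume zW: "z \<notin> W"
    obtain v where v: "v \<in> W" using t(2) by blast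
    then show False using star[of v] grow[of _ v z] t(1) z zW by blast
  qed
  then show ?thesis using grow[of _ z] star t(1) by blast
qed

text \<open>A step from source to target contributes the inverse of \<open>f a\<close>. Under this
  convention the value at \<open>ter Y a\<close> times \<open>f a\<close> is the value at
  \<open>ini Y a\<close>.\<close>

fun path_value :: "('h, 'm) monoid_scheme \<Rightarrow> ('e \<Rightarrow> 'h) \<Rightarrow> ('e \<times> bool) list \<Rightarrow> 'h" where
  "path_value \<Gamma> f [] = \<one>\<^bsub>\<Gamma>\<^esub>"
| "path_value \<Gamma> f ((a, s) # p) = (if s then inv\<^bsub>\<Gamma>\<^esub> f a else f a) \<otimes>\<^bsub>\<Gamma>\<^esub> path_value \<Gamma> f p"

text \<open>\<open>k v\<close> is the value of the reduced path from \<open>z\<close> to \<open>v\<close>.\<close>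

lemma tree_potential:
  assumes T: "tree_in Y W T" and z: "z \<in> W" and \<Gamma>: "group \<Gamma>" and f: "\<And>a. a \<in> T \<Longrightarrow> f a \<in> carrier \<Gamma>"
  shows "\<exists>k. k z = \<one>\<^bsub>\<Gamma>\<^esub> \<and> (\<forall>v\<in>W. k v \<in> carrier \<Gamma>) \<and>
    (\<forall>a\<in>T. k (ter Y a) \<otimes>\<^bsub>\<Gamma>\<^esub> f a = k (ini Y a))"
proof -
  interpret group \<Gamma> by fact
  note t = tree_inD[OF T]
  define P where "P v = (THE p. edge_path Y T z p v \<and> reduced_path p)" for v
  have P: "edge_path Y T z (P v) v \<and> reduced_path (P v)" if "v \<in> W" for v
    unfolding P_def by (rule theI'[OF t(5)[OF z that]])
  have P_eq: "P v = p" if "edge_path Y T z p v" "reduced_path p" "v \<in> W" for p v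
    using P[OF that(3)] t(5)[OF z that(3)] that by blast
  have closed: "path_value \<Gamma> f p \<in> carrier \<Gamma>" if "fst ` set p \<subseteq> T" for p
    using that f by (induction p) auto
  have app: "path_value \<Gamma> f (p @ q) = path_value \<Gamma> f p \<otimes>\<^bsub>\<Gamma>\<^esub> path_value \<Gamma> f q"
    if "fst ` set p \<subseteq> T" "fst ` set q \<subseteq> T" for p q
    using that(1)
  proof (induction p)
    case (Cons u p)
    then show ?case using closed[of p] closed[OF that(2)] f[of "fst u"] by (cases u) (auto simp: m_assoc)
  qed (use closed[OF that(2)] in simp)
  have PT: "fst ` set (P v) \<subseteq> T" if "v \<in> W" for v
    using P[OF that] edge_path_edges by fastforce
  have "path_value \<Gamma> f (P (ter Y a)) \<otimes>\<^bsub>\<Gamma>\<^esub> f a = path_value \<Gamma> f (P (ini Y a))" if a: "a \<in> T" for a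
  proof -
    have i: "ini Y a \<in> W" "ter Y a \<in> W" using t(4)[OF a] by auto
    note c = closed[OF PT[OF i(1)]] closed[OF PT[OF i(2)]]
    show ?thesis
    \<comment> \<open>Either the reduced path to \<open>ini Y a\<close> arrives through
      \<open>a\<close>, and without this step it is the path to \<open>ter Y a\<close>; or
      \<open>a\<close> can be appended without a backtrack.\<close>
    proof (cases "\<exists>q. P (ini Y a) = q @ [(a, False)]")
      case True
      then obtain q where q: "P (ini Y a) = q @ [(a, False)]" by blast
      have "P (ter Y a) = q"
        by (rule P_eq) (use P[OF i(1)] i q in \<open>auto simp: edge_path_append reduced_path_append\<close>)
      then show ?thesis using q app[of q "[(a, False)]"] PT[OF i(2)] a f by simp
    next
      case False
      have "P (ter Y a) = P (ini Y a) @ [(a, True)]"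
      proof (rule P_eq)
        show "edge_path Y T z (P (ini Y a) @ [(a, True)]) (ter Y a)"
          using P[OF i(1)] a by (auto simp: edge_path_append)
        have "\<not> (fst (last (P (ini Y a))) = a \<and> \<not> snd (last (P (ini Y a))))" if "P (ini Y a) \<noteq> []"
          using False that by (metis append_butlast_last_id prod.collapse)
        then show "reduced_path (P (ini Y a) @ [(a, True)])"
          using P[OF i(1)] by (auto simp: reduced_path_append reduced_path_Cons)
      qed (rule i)
      then show ?thesis using app[OF PT[OF i(1)], of "[(a, True)]"] a f c by (simp add: m_assoc)
    qed
  qed
  moreover have "P z = []" by (rule P_eq) (use z in auto)
  ultimately show ?thesis
    using closed PT by (intro exI[of _ "\<lambda>v. path_value \<Gamma> f (P v)"]) auto
qed

section \<open>The action on the development\<close>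

text \<open>The axioms for \<open>Q\<close> are transported along the bijections. In this way the
  quotient of the development and the local development are seen to be scwols.\<close>

lemma scwol_isoI:
  assumes Y: "scwol Y" and f: "nondeg_functor Y Q fv fe"
    and bv: "bij_betw fv (verts Y) (verts Q)" and be: "bij_betw fe (edges Y) (edges Q)"
  shows "scwol_iso Y Q fv fe"
proof -
  note s = scwolD[OF Y]
  have ini: "ini Q (fe a) = fv (ini Y a)" and ter: "ter Q (fe a) = fv (ter Y a)" and ed: "fe a \<in> edges Q"
    if "a \<in> edges Y" for a
    using f that by (auto simp: nondeg_functor_def)
  have cmp: "cmp Q (fe a) (fe b) = fe (cmp Y a b)" if "a \<in> edges Y" "b \<in> edges Y" "ini Y a = ter Y b" for a b
    using f that by (auto simp: nondeg_functor_def composable2_def)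
  have inj: "fv v = fv w \<longleftrightarrow> v = w" if "v \<in> verts Y" "w \<in> verts Y" for v w
    using bv that by (auto simp: bij_betw_def inj_on_def)
  have fv: "fv v \<in> verts Q" if "v \<in> verts Y" for v using bv that by (auto simp: bij_betw_def)
  have comp: "ini Q (fe a) = ter Q (fe b) \<longleftrightarrow> ini Y a = ter Y b" if "a \<in> edges Y" "b \<in> edges Y" for a b
    using that inj s(1) by (simp add: ini ter)
  have E: "edges Q = fe ` edges Y" using be by (simp add: bij_betw_def)
  have "scwol Q"
    unfolding scwol_def
  proof (intro conjI ballI impI)
    fix p assume "p \<in> edges Q"
    then obtain a where a: "p = fe a" "a \<in> edges Y" using E by blast
    with s(1)[OF a(2)] show "ini Q p \<in> verts Q" "ter Q p \<in> verts Q" "ini Q p \<noteq> ter Q p"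
      by (simp_all add: ini ter fv inj)
    fix q assume "q \<in> edges Q"
    then obtain b where b: "q = fe b" "b \<in> edges Y" using E by blast
    {
      assume "ini Q p = ter Q q"
      then have ab: "ini Y a = ter Y b" using comp a b by simp
      note c = s(2)[OF a(2) b(2) ab]
      have cp: "cmp Q p q = fe (cmp Y a b)" using cmp ab a b by simp
      show "cmp Q p q \<in> edges Q" "ini Q (cmp Q p q) = ini Q q" "ter Q (cmp Q p q) = ter Q p"
        unfolding cp using c a b by (simp_all add: ed ini ter)
      fix r assume "r \<in> edges Q" "ini Q q = ter Q r"
      moreover then obtain d where "r = fe d" "d \<in> edges Y" using E by blast
      ultimately have d: "r = fe d" "d \<in> edges Y" "ini Y b = ter Y d" using comp[OF b(2)] b(1) by simp_all
      note e = s(2)[OF b(2) d(2,3)]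
      show "cmp Q (cmp Q p q) r = cmp Q p (cmp Q q r)"
        unfolding a(1) b(1) d(1)
        using a b c d e ab s(3)[OF a(2) b(2) d(2) ab d(3)] by (simp add: cmp)
    }
  qed
  then show ?thesis using assms by (simp add: scwol_iso_def)
qed

lemma scwol_iso_trans:
  assumes f: "scwol_iso X Y fv fe" and g: "scwol_iso Y Z gv ge"
  shows "scwol_iso X Z (gv \<circ> fv) (ge \<circ> fe)"
proof (rule scwol_isoI)
  note F = scwol_isoD[OF f] and G = scwol_isoD[OF g]
  show "nondeg_functor X Z (gv \<circ> fv) (ge \<circ> fe)"
    using F(1-3) G(1-3) by (auto simp: nondeg_functor_def composable2_def)
qed (use f g in \<open>auto simp: scwol_iso_def intro: bij_betw_trans\<close>)

text \<open>The elements of \<open>BijGroup E\<close> are extensional functions, hence the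
  restriction to \<open>E\<close>.\<close>

lemma group_action_restrict:
  assumes "group \<Gamma>" and closed: "\<And>g x. g \<in> carrier \<Gamma> \<Longrightarrow> x \<in> E \<Longrightarrow> f g x \<in> E"
    and one: "\<And>x. x \<in> E \<Longrightarrow> f \<one>\<^bsub>\<Gamma>\<^esub> x = x"
    and mult: "\<And>g h x. \<lbrakk>g \<in> carrier \<Gamma>; h \<in> carrier \<Gamma>; x \<in> E\<rbrakk> \<Longrightarrow> f (g \<otimes>\<^bsub>\<Gamma>\<^esub> h) x = f g (f h x)"
  shows "group_action \<Gamma> E (\<lambda>g. restrict (f g) E)"
proof -
  interpret group \<Gamma> by fact
  have bij: "restrict (f g) E \<in> carrier (BijGroup E)" if g: "g \<in> carrier \<Gamma>" for g
  proof -
    have "bij_betw (f g) E E"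
      by (rule bij_betw_byWitness[of _ "f (inv\<^bsub>\<Gamma>\<^esub> g)"])
        (use g closed in \<open>auto simp: one mult[symmetric]\<close>)
    then have "bij_betw (restrict (f g) E) E E" by (rule bij_betw_cong[THEN iffD2, rotated]) simp
    then show ?thesis by (simp add: BijGroup_def Bij_def)
  qed
  show ?thesis
    unfolding group_action_def group_hom_def group_hom_axioms_def
  proof (intro conjI homI)
    fix g h assume gh: "g \<in> carrier \<Gamma>" "h \<in> carrier \<Gamma>"
    then have "restrict (f (g \<otimes>\<^bsub>\<Gamma>\<^esub> h)) E = compose E (restrict (f g) E) (restrict (f h) E)"
      by (auto simp: compose_def mult closed)
    then show "restrict (f (g \<otimes>\<^bsub>\<Gamma>\<^esub> h)) E = restrict (f g) E \<otimes>\<^bsub>BijGroup E\<^esub> restrict (f h) E"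
      using bij[OF gh(1)] bij[OF gh(2)] by (simp add: BijGroup_def)
  qed (auto intro: bij group_BijGroup group_axioms)
qed

section \<open>The development and the action by left translation\<close>

locale morphism_to_group =
  fixes Y :: "('v, 'e) scwol_data" and G :: "('v, 'e, 'g) cog_data" and \<Gamma> :: "'h monoid" (structure)
    and \<phi> :: "'v \<Rightarrow> 'g \<Rightarrow> 'h" and \<phi>e :: "'e \<Rightarrow> 'h"
  assumes cog: "complex_of_groups Y G" and morphism: "group_morphism Y G \<Gamma> \<phi> \<phi>e"
begin

sublocale \<Gamma>: group \<Gamma> by (rule group_morphismD[OF morphism])

lemma scwol: "scwol Y" using cog by (rule complex_of_groupsD)

lemmas scw = scwolD[OF scwol]

lemma edge_image [simp, intro]: "a \<in> edges Y \<Longrightarrow> \<phi>e a \<in> carrier \<Gamma>"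
  by (rule group_morphismD[OF morphism])

lemma loc_image [simp, intro]: "\<sigma> \<in> verts Y \<Longrightarrow> g \<in> carrier (lgrp G \<sigma>) \<Longrightarrow> \<phi> \<sigma> g \<in> carrier \<Gamma>"
  by (rule group_morphismD[OF morphism])

definition K :: "'v \<Rightarrow> 'h set" where "K \<sigma> = \<phi> \<sigma> ` carrier (lgrp G \<sigma>)"

definition coset :: "'h \<Rightarrow> 'v \<Rightarrow> 'h set" where "coset g \<sigma> = g <# K \<sigma>"

lemma subgroup_K: "\<sigma> \<in> verts Y \<Longrightarrow> subgroup (K \<sigma>) \<Gamma>"
  unfolding K_def using group_morphismD(2)[OF morphism] complex_of_groupsD(2)[OF cog]
  by (intro group_hom.img_is_subgroup) (simp add: group_hom_def group_hom_axioms_def)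

lemma K_carrier [simp]: "\<sigma> \<in> verts Y \<Longrightarrow> k \<in> K \<sigma> \<Longrightarrow> k \<in> carrier \<Gamma>"
  by (auto simp: K_def)

lemma mem_coset: "x \<in> coset g \<sigma> \<longleftrightarrow> (\<exists>k\<in>K \<sigma>. x = g \<otimes> k)"
  by (auto simp: coset_def l_coset_def)

lemma coset_self: "g \<in> carrier \<Gamma> \<Longrightarrow> \<sigma> \<in> verts Y \<Longrightarrow> g \<in> coset g \<sigma>"
  using subgroup.one_closed[OF subgroup_K] by (force simp: mem_coset)

lemma coset_mult_K:
  assumes "g \<in> carrier \<Gamma>" "\<sigma> \<in> verts Y" "k \<in> K \<sigma>"
  shows "coset (g \<otimes> k) \<sigma> = coset g \<sigma>"
proof (intro equalityI subsetI)
  interpret S: subgroup "K \<sigma>" \<Gamma> by (rule subgroup_K) fact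
  fix x
  {
    assume "x \<in> coset (g \<otimes> k) \<sigma>"
    then obtain l where "l \<in> K \<sigma>" "x = g \<otimes> (k \<otimes> l)" using assms by (auto simp: mem_coset \<Gamma>.m_assoc)
    then show "x \<in> coset g \<sigma>" using assms by (auto simp: mem_coset)
  next
    assume "x \<in> coset g \<sigma>"
    then obtain l where l: "l \<in> K \<sigma>" "x = g \<otimes> l" by (auto simp: mem_coset)
    then have "x = g \<otimes> k \<otimes> (inv k \<otimes> l)"
      using assms by (simp add: \<Gamma>.m_assoc) (simp flip: \<Gamma>.m_assoc)
    then show "x \<in> coset (g \<otimes> k) \<sigma>" using l assms by (auto simp: mem_coset)
  }
qed

lemma coset_eqD:
  assumes "coset g \<sigma> = coset h \<sigma>" "h \<in> carrier \<Gamma>" "\<sigma> \<in> verts Y"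
  shows "\<exists>k\<in>K \<sigma>. h = g \<otimes> k"
  using coset_self[OF assms(2,3)] assms(1) mem_coset by blast

lemma coset_one: "\<sigma> \<in> verts Y \<Longrightarrow> coset \<one> \<sigma> = K \<sigma>"
  by (force simp: mem_coset)

lemma mult_coset:
  "g \<in> carrier \<Gamma> \<Longrightarrow> h \<in> carrier \<Gamma> \<Longrightarrow> \<sigma> \<in> verts Y \<Longrightarrow> g <# coset h \<sigma> = coset (g \<otimes> h) \<sigma>"
  unfolding coset_def by (rule \<Gamma>.lcos_m_assoc) auto

lemma edge_image_commute:
  assumes "a \<in> edges Y" "x \<in> carrier (lgrp G (ini Y a))"
  shows "\<phi> (ini Y a) x \<otimes> inv \<phi>e a = inv \<phi>e a \<otimes> \<phi> (ter Y a) (lhom G a x)"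
proof -
  have "inv \<phi>e a \<otimes> Ad \<Gamma> (\<phi>e a) (\<phi> (ini Y a) x) = \<phi> (ini Y a) x \<otimes> inv \<phi>e a"
    using assms scw(1)[of a] by (simp add: Ad_def flip: \<Gamma>.m_assoc)
  then show ?thesis by (simp add: group_morphismD(4)[OF morphism assms])
qed

text \<open>By \<open>edge_image_commute\<close> a factor from \<open>K (ini Y a)\<close> passes
  across the inverse of \<open>\<phi>e a\<close> and is absorbed by \<open>K (ter Y a)\<close>. So
  the set product in \<open>development\<close> is a single coset.\<close>

lemma target_coset:
  assumes "a \<in> edges Y" "g \<in> carrier \<Gamma>"
  shows "coset g (ini Y a) <#> (inv \<phi>e a <# K (ter Y a)) = coset (g \<otimes> inv \<phi>e a) (ter Y a)"
proof (intro equalityI subsetI)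
  have v: "ini Y a \<in> verts Y" "ter Y a \<in> verts Y" using scw(1) assms by auto
  interpret S: subgroup "K (ter Y a)" \<Gamma> by (rule subgroup_K) fact
  fix x
  {
    assume "x \<in> coset g (ini Y a) <#> (inv \<phi>e a <# K (ter Y a))"
    then obtain u l where u: "u \<in> coset g (ini Y a)" and l: "l \<in> K (ter Y a)"
      and x: "x = u \<otimes> (inv \<phi>e a \<otimes> l)"
      by (auto simp: set_mult_def l_coset_def)
    obtain y where y: "y \<in> carrier (lgrp G (ini Y a))" "u = g \<otimes> \<phi> (ini Y a) y"
      using u by (auto simp: mem_coset K_def)
    have k: "\<phi> (ter Y a) (lhom G a y) \<in> K (ter Y a)"
      using y complex_of_groupsD(3)[OF cog assms(1)] by (auto simp: K_def hom_def)
    have "x = g \<otimes> (\<phi> (ini Y a) y \<otimes> inv \<phi>e a) \<otimes> l"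
      using x y l v assms by (simp add: \<Gamma>.m_assoc)
    also have "\<dots> = g \<otimes> inv \<phi>e a \<otimes> (\<phi> (ter Y a) (lhom G a y) \<otimes> l)"
      unfolding edge_image_commute[OF assms(1) y(1)] using k l v assms by (simp add: \<Gamma>.m_assoc)
    finally show "x \<in> coset (g \<otimes> inv \<phi>e a) (ter Y a)"
      using k l by (auto simp: mem_coset)
  next
    assume "x \<in> coset (g \<otimes> inv \<phi>e a) (ter Y a)"
    then obtain l where "l \<in> K (ter Y a)" "x = g \<otimes> (inv \<phi>e a \<otimes> l)"
      using assms v by (auto simp: mem_coset \<Gamma>.m_assoc)
    then show "x \<in> coset g (ini Y a) <#> (inv \<phi>e a <# K (ter Y a))"
      using coset_self[OF assms(2) v(1)] by (auto simp: set_mult_def l_coset_def)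
  }
qed

text \<open>The inverses of \<open>\<phi>e (cmp Y a b)\<close> and of the product of
  \<open>\<phi>e a\<close> and \<open>\<phi>e b\<close> differ by the inverse of the image of
  \<open>twist G a b\<close>, an element of \<open>K (ter Y a)\<close>. Hence composites in the
  development have the right target.\<close>

lemma coset_comp:
  assumes "a \<in> edges Y" "b \<in> edges Y" "ini Y a = ter Y b" "g \<in> carrier \<Gamma>"
  shows "coset (g \<otimes> inv \<phi>e (cmp Y a b)) (ter Y a)
    = coset (g \<otimes> inv \<phi>e b \<otimes> inv \<phi>e a) (ter Y a)"
proof -
  let ?t = "\<phi> (ter Y a) (twist G a b)"
  have v: "ter Y a \<in> verts Y" "cmp Y a b \<in> edges Y" using scw assms by auto
  have t: "?t \<in> K (ter Y a)" "?t \<in> carrier \<Gamma>"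
    using complex_of_groupsD(5)[OF cog assms(1-3)] v by (auto simp: K_def)
  have "?t \<otimes> \<phi>e (cmp Y a b) = \<phi>e a \<otimes> \<phi>e b"
    by (rule group_morphismD(5)[OF morphism assms(1-3)])
  then have "inv (?t \<otimes> \<phi>e (cmp Y a b)) = inv (\<phi>e a \<otimes> \<phi>e b)" by simp
  then have "inv \<phi>e (cmp Y a b) \<otimes> inv ?t = inv \<phi>e b \<otimes> inv \<phi>e a"
    using v assms t by (simp add: \<Gamma>.inv_mult_group)
  then have "g \<otimes> inv \<phi>e b \<otimes> inv \<phi>e a = g \<otimes> inv \<phi>e (cmp Y a b) \<otimes> inv ?t"
    using v assms t by (simp add: \<Gamma>.m_assoc)
  then show ?thesis
    using coset_mult_K[of "g \<otimes> inv \<phi>e (cmp Y a b)" "ter Y a" "inv ?t"] v assms t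
      subgroup.m_inv_closed[OF subgroup_K] by simp
qed

definition D :: "('h set \<times> 'v, 'h set \<times> 'e) scwol_data" where
  "D = development Y G \<Gamma> \<phi> \<phi>e"

lemma verts_D: "verts D = {(coset g \<sigma>, \<sigma>) |g \<sigma>. g \<in> carrier \<Gamma> \<and> \<sigma> \<in> verts Y}"
  by (simp add: D_def development_def coset_def K_def)

lemma edges_D: "edges D = {(coset g (ini Y a), a) |g a. g \<in> carrier \<Gamma> \<and> a \<in> edges Y}"
  by (simp add: D_def development_def coset_def K_def)

lemma ini_D [simp]: "ini D (A, a) = (A, ini Y a)"
  by (simp add: D_def development_def)

lemma ter_D [simp]: "a \<in> edges Y \<Longrightarrow> g \<in> carrier \<Gamma> \<Longrightarrow>
    ter D (coset g (ini Y a), a) = (coset (g \<otimes> inv \<phi>e a) (ter Y a), ter Y a)"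
  using target_coset by (simp add: D_def development_def flip: K_def)

lemma cmp_D [simp]: "cmp D (A, a) (B, b) = (B, cmp Y a b)"
  by (simp add: D_def development_def)

lemma vert_D [intro]: "g \<in> carrier \<Gamma> \<Longrightarrow> \<sigma> \<in> verts Y \<Longrightarrow> (coset g \<sigma>, \<sigma>) \<in> verts D"
  by (auto simp: verts_D)

lemma edge_D [intro]: "g \<in> carrier \<Gamma> \<Longrightarrow> a \<in> edges Y \<Longrightarrow> (coset g (ini Y a), a) \<in> edges D"
  by (auto simp: edges_D)

lemma scwol_D: "scwol D"
  unfolding scwol_def
proof (intro conjI ballI impI)
  fix p assume "p \<in> edges D"
  then obtain g a where p: "p = (coset g (ini Y a), a)" "g \<in> carrier \<Gamma>" "a \<in> edges Y" by (auto simp: edges_D)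
  with scw(1)[of a] show "ini D p \<in> verts D" "ter D p \<in> verts D" "ini D p \<noteq> ter D p"
    by auto
  fix q assume "q \<in> edges D"
  then obtain h b where q: "q = (coset h (ini Y b), b)" "h \<in> carrier \<Gamma>" "b \<in> edges Y" by (auto simp: edges_D)
  {
    assume comp: "ini D p = ter D q"
    then have pq: "coset g (ini Y a) = coset (h \<otimes> inv \<phi>e b) (ter Y b)" "ini Y a = ter Y b"
      unfolding p(1) q(1) ini_D ter_D[OF q(3,2)] prod.inject by blast+
    note ab = scw(2)[OF p(3) q(3) pq(2)]
    have cp: "cmp D p q = (coset h (ini Y (cmp Y a b)), cmp Y a b)" unfolding p(1) q(1) cmp_D using ab by simp
    show "cmp D p q \<in> edges D" unfolding cp using ab by (intro edge_D[OF q(2)]) simp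
    show "ini D (cmp D p q) = ini D q" unfolding cp unfolding q(1) ini_D using ab by simp
    \<comment> \<open>The source coset of \<open>p\<close> is represented anew by the element that
      comes from the target of \<open>q\<close>.\<close>
    have "ter D p = ter D (coset (h \<otimes> inv \<phi>e b) (ini Y a), a)"
      unfolding p(1) pq(1) by (simp only: pq(2))
    then show "ter D (cmp D p q) = ter D p"
      unfolding cp using ab p(2,3) q(2,3) ter_D[of "cmp Y a b" h] coset_comp[OF p(3) q(3) pq(2) q(2)] by simp
    fix r assume "r \<in> edges D" "ini D q = ter D r"
    then obtain k c where r: "r = (coset k (ini Y c), c)" "k \<in> carrier \<Gamma>" "c \<in> edges Y" "ini Y b = ter Y c"
      using q by (auto simp: edges_D)
    show "cmp D (cmp D p q) r = cmp D p (cmp D q r)"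
      using scw(3)[OF p(3) q(3) r(3) pq(2) r(4)] by (simp add: p q r)
  }
qed

definition translate :: "'h \<Rightarrow> 'h set \<times> 'x \<Rightarrow> 'h set \<times> 'x" where
  "translate g = (\<lambda>(A, x). (g <# A, x))"

definition act_verts :: "'h \<Rightarrow> 'h set \<times> 'v \<Rightarrow> 'h set \<times> 'v" where
  "act_verts g = restrict (translate g) (verts D)"

definition act_edges :: "'h \<Rightarrow> 'h set \<times> 'e \<Rightarrow> 'h set \<times> 'e" where
  "act_edges g = restrict (translate g) (edges D)"

lemma act_verts_coset [simp]: "g \<in> carrier \<Gamma> \<Longrightarrow> h \<in> carrier \<Gamma> \<Longrightarrow> \<sigma> \<in> verts Y \<Longrightarrow>
    act_verts g (coset h \<sigma>, \<sigma>) = (coset (g \<otimes> h) \<sigma>, \<sigma>)"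
  by (auto simp: act_verts_def translate_def mult_coset)

lemma act_edges_coset [simp]: "g \<in> carrier \<Gamma> \<Longrightarrow> h \<in> carrier \<Gamma> \<Longrightarrow> a \<in> edges Y \<Longrightarrow>
    act_edges g (coset h (ini Y a), a) = (coset (g \<otimes> h) (ini Y a), a)"
  using scw(1)[of a] by (auto simp: act_edges_def translate_def mult_coset)

lemma translate_verts:
  assumes "g \<in> carrier \<Gamma>" "x \<in> verts D"
  shows "translate g x \<in> verts D"
proof -
  obtain h \<sigma> where "x = (coset h \<sigma>, \<sigma>)" "h \<in> carrier \<Gamma>" "\<sigma> \<in> verts Y" using assms by (auto simp: verts_D)
  then show ?thesis using assms vert_D[of "g \<otimes> h" \<sigma>] by (simp add: translate_def mult_coset)
qed

lemma translate_edges: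
  assumes "g \<in> carrier \<Gamma>" "x \<in> edges D"
  shows "translate g x \<in> edges D"
proof -
  obtain h a where "x = (coset h (ini Y a), a)" "h \<in> carrier \<Gamma>" "a \<in> edges Y" using assms by (auto simp: edges_D)
  then show ?thesis using assms edge_D[of "g \<otimes> h" a] scw(1)[of a] by (simp add: translate_def mult_coset)
qed

lemma group_action_verts: "group_action \<Gamma> (verts D) act_verts"
  unfolding act_verts_def
  by (rule group_action_restrict) (auto simp: translate_verts, auto simp: verts_D translate_def mult_coset \<Gamma>.m_assoc)

lemma group_action_edges: "group_action \<Gamma> (edges D) act_edges"
  unfolding act_edges_def
  by (rule group_action_restrict)
    (auto simp: translate_edges, auto simp: edges_D translate_def mult_coset \<Gamma>.m_assoc scw(1))

text \<open>Translations keep the second component, and \<open>Y\<close> has no loops, so a source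
  never moves to the target. An edge carries the coset of its source, so fixing the source fixes the
  edge.\<close>

lemma scwol_action_D: "scwol_action \<Gamma> D act_verts act_edges"
  unfolding scwol_action_def
proof (intro conjI ballI scwol_D group_action_verts group_action_edges)
  fix g assume g: "g \<in> carrier \<Gamma>"
  show "nondeg_functor D D (act_verts g) (act_edges g)"
    unfolding nondeg_functor_def
  proof (intro conjI ballI)
    show "act_verts g \<in> verts D \<rightarrow> verts D" using g by (auto simp: act_verts_def translate_verts)
    show "act_edges g \<in> edges D \<rightarrow> edges D" using g by (auto simp: act_edges_def translate_edges)
  next
    fix p assume "p \<in> edges D"
    then obtain h a where p: "p = (coset h (ini Y a), a)" "h \<in> carrier \<Gamma>" "a \<in> edges Y" by (auto simp: edges_D)
    then show "ini D (act_edges g p) = act_verts g (ini D p)" "ter D (act_edges g p) = act_verts g (ter D p)"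
      using g scw(1)[of a] by (auto simp: \<Gamma>.m_assoc)
  next
    fix w assume "w \<in> composable2 D"
    then obtain h a k b where "w = ((coset h (ini Y a), a), (coset k (ini Y b), b))" "h \<in> carrier \<Gamma>" "a \<in> edges Y"
      "k \<in> carrier \<Gamma>" "b \<in> edges Y" "ini Y a = ter Y b"
      by (auto simp: composable2_def edges_D)
    then show "case w of (a, b) \<Rightarrow> act_edges g (cmp D a b) = cmp D (act_edges g a) (act_edges g b)"
      using g scw(2)[of a b] act_edges_coset[of g k "cmp Y a b"]
        act_edges_coset[of g h a] by auto
  qed
  fix p assume "p \<in> edges D"
  then obtain h a where p: "p = (coset h (ini Y a), a)" "h \<in> carrier \<Gamma>" "a \<in> edges Y" by (auto simp: edges_D)
  then show "act_verts g (ini D p) \<noteq> ter D p" "act_verts g (ini D p) = ini D p \<longrightarrow> act_edges g p = p"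
    using g scw(1)[of a] by auto
qed

section \<open>The quotient of the development and its complex of groups\<close>

definition vert_orbit :: "'v \<Rightarrow> ('h set \<times> 'v) set" where
  "vert_orbit \<sigma> = (\<lambda>g. (coset g \<sigma>, \<sigma>)) ` carrier \<Gamma>"

definition edge_orbit :: "'e \<Rightarrow> ('h set \<times> 'e) set" where
  "edge_orbit a = (\<lambda>g. (coset g (ini Y a), a)) ` carrier \<Gamma>"

abbreviation Q :: "(('h set \<times> 'v) set, ('h set \<times> 'e) set) scwol_data" where
  "Q \<equiv> quotient_scwol \<Gamma> D act_verts act_edges"

text \<open>Right multiplication permutes the group; therefore all cosets over one vertex, or over
  one edge, form a single orbit.\<close>

lemma mult_right_range:
  assumes "h \<in> carrier \<Gamma>"
  shows "(\<lambda>g. f (g \<otimes> h)) ` carrier \<Gamma> = f ` carrier \<Gamma>"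
proof (intro equalityI subsetI)
  fix x assume "x \<in> f ` carrier \<Gamma>"
  then obtain g where "g \<in> carrier \<Gamma>" "x = f g" by blast
  with assms have "x = f (g \<otimes> inv h \<otimes> h)" "g \<otimes> inv h \<in> carrier \<Gamma>"
    by (simp_all add: \<Gamma>.m_assoc)
  then show "x \<in> (\<lambda>g. f (g \<otimes> h)) ` carrier \<Gamma>" by blast
qed (use assms in auto)

lemma orbit_vert:
  assumes "h \<in> carrier \<Gamma>" "\<sigma> \<in> verts Y"
  shows "orbit \<Gamma> act_verts (coset h \<sigma>, \<sigma>) = vert_orbit \<sigma>"
proof -
  have "orbit \<Gamma> act_verts (coset h \<sigma>, \<sigma>) = (\<lambda>g. (coset (g \<otimes> h) \<sigma>, \<sigma>)) ` carrier \<Gamma>"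
    unfolding orbit_def Setcompr_eq_image by (rule image_cong) (use assms in auto)
  then show ?thesis
    unfolding vert_orbit_def using mult_right_range[OF assms(1), of "\<lambda>g. (coset g \<sigma>, \<sigma>)"] by simp
qed

lemma orbit_edge:
  assumes "h \<in> carrier \<Gamma>" "a \<in> edges Y"
  shows "orbit \<Gamma> act_edges (coset h (ini Y a), a) = edge_orbit a"
proof -
  have "orbit \<Gamma> act_edges (coset h (ini Y a), a) = (\<lambda>g. (coset (g \<otimes> h) (ini Y a), a)) ` carrier \<Gamma>"
    unfolding orbit_def Setcompr_eq_image by (rule image_cong) (use assms in auto)
  then show ?thesis
    unfolding edge_orbit_def using mult_right_range[OF assms(1), of "\<lambda>g. (coset g (ini Y a), a)"] by simp
qed

lemma verts_Q: "verts Q = vert_orbit ` verts Y"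
proof (intro equalityI subsetI)
  fix x assume "x \<in> verts Q"
  then obtain g \<sigma> where "g \<in> carrier \<Gamma>" "\<sigma> \<in> verts Y" "x = orbit \<Gamma> act_verts (coset g \<sigma>, \<sigma>)"
    by (auto simp: quotient_scwol_def orbits_def verts_D)
  then show "x \<in> vert_orbit ` verts Y" by (simp add: orbit_vert)
next
  fix x assume "x \<in> vert_orbit ` verts Y"
  then obtain \<sigma> where "\<sigma> \<in> verts Y" "x = orbit \<Gamma> act_verts (coset \<one> \<sigma>, \<sigma>)"
    using orbit_vert[OF \<Gamma>.one_closed] by auto
  then show "x \<in> verts Q" using vert_D[OF \<Gamma>.one_closed] by (auto simp: quotient_scwol_def orbits_def)
qed

lemma edges_Q: "edges Q = edge_orbit ` edges Y"
proof (intro equalityI subsetI)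
  fix x assume "x \<in> edges Q"
  then obtain g a where "g \<in> carrier \<Gamma>" "a \<in> edges Y" "x = orbit \<Gamma> act_edges (coset g (ini Y a), a)"
    by (auto simp: quotient_scwol_def orbits_def edges_D)
  then show "x \<in> edge_orbit ` edges Y" by (simp add: orbit_edge)
next
  fix x assume "x \<in> edge_orbit ` edges Y"
  then obtain a where "a \<in> edges Y" "x = orbit \<Gamma> act_edges (coset \<one> (ini Y a), a)"
    using orbit_edge[OF \<Gamma>.one_closed] by auto
  then show "x \<in> edges Q" using edge_D[OF \<Gamma>.one_closed] by (auto simp: quotient_scwol_def orbits_def)
qed

lemma ini_orbit: "ini D ` edge_orbit a = vert_orbit (ini Y a)"
  by (simp add: edge_orbit_def vert_orbit_def image_image)

lemma ter_orbit:
  assumes "a \<in> edges Y"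
  shows "ter D ` edge_orbit a = vert_orbit (ter Y a)"
proof -
  have "ter D ` edge_orbit a = (\<lambda>g. (coset (g \<otimes> inv \<phi>e a) (ter Y a), ter Y a)) ` carrier \<Gamma>"
    unfolding edge_orbit_def image_image by (rule image_cong) (use assms in auto)
  then show ?thesis
    unfolding vert_orbit_def
    using mult_right_range[of "inv \<phi>e a" "\<lambda>g. (coset g (ter Y a), ter Y a)"] assms by simp
qed

lemma ini_Q: "ini Q (edge_orbit a) = vert_orbit (ini Y a)"
  by (simp add: quotient_scwol_def ini_orbit)

lemma ter_Q: "a \<in> edges Y \<Longrightarrow> ter Q (edge_orbit a) = vert_orbit (ter Y a)"
  by (simp add: quotient_scwol_def ter_orbit)

lemma cmp_Q:
  assumes "a \<in> edges Y" "b \<in> edges Y" "ini Y a = ter Y b"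
  shows "cmp Q (edge_orbit a) (edge_orbit b) = edge_orbit (cmp Y a b)"
proof -
  have i: "ini Y (cmp Y a b) = ini Y b" using scw(2)[OF assms] by simp
  have "cmp Q (edge_orbit a) (edge_orbit b)
    = {cmp D p q |p q. p \<in> edge_orbit a \<and> q \<in> edge_orbit b \<and> ini D p = ter D q}"
    by (simp add: quotient_scwol_def)
  also have "\<dots> = edge_orbit (cmp Y a b)"
  proof (intro equalityI subsetI)
    fix x assume "x \<in> edge_orbit (cmp Y a b)"
    then obtain g where g: "g \<in> carrier \<Gamma>" "x = (coset g (ini Y b), cmp Y a b)" by (auto simp: edge_orbit_def i)
    then have "x = cmp D (coset (g \<otimes> inv \<phi>e b) (ini Y a), a) (coset g (ini Y b), b)" by simp
    moreover have "ini D (coset (g \<otimes> inv \<phi>e b) (ini Y a), a) = ter D (coset g (ini Y b), b)"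
      using g assms by simp
    moreover have "(coset (g \<otimes> inv \<phi>e b) (ini Y a), a) \<in> edge_orbit a" "(coset g (ini Y b), b) \<in> edge_orbit b"
      using g assms by (auto simp: edge_orbit_def)
    ultimately show "x \<in> {cmp D p q |p q. p \<in> edge_orbit a \<and> q \<in> edge_orbit b \<and> ini D p = ter D q}" by blast
  qed (auto simp: edge_orbit_def i)
  finally show ?thesis .
qed

lemma vert_orbit_snd: "x \<in> vert_orbit \<sigma> \<Longrightarrow> snd x = \<sigma>"
  by (auto simp: vert_orbit_def)

lemma edge_orbit_snd: "x \<in> edge_orbit a \<Longrightarrow> snd x = a"
  by (auto simp: edge_orbit_def)

lemma vert_orbit_nonempty: "(coset \<one> \<sigma>, \<sigma>) \<in> vert_orbit \<sigma>"
  by (auto simp: vert_orbit_def)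

lemma edge_orbit_nonempty: "(coset \<one> (ini Y a), a) \<in> edge_orbit a"
  by (auto simp: edge_orbit_def)

lemma scwol_iso_Q: "scwol_iso Y Q vert_orbit edge_orbit"
proof (rule scwol_isoI[OF scwol])
  show "nondeg_functor Y Q vert_orbit edge_orbit"
    by (auto simp: nondeg_functor_def verts_Q edges_Q ini_Q ter_Q cmp_Q composable2_def)
  show "bij_betw vert_orbit (verts Y) (verts Q)"
    unfolding bij_betw_def verts_Q by (metis inj_onI vert_orbit_nonempty vert_orbit_snd)
  show "bij_betw edge_orbit (edges Y) (edges Q)"
    unfolding bij_betw_def edges_Q by (metis inj_onI edge_orbit_nonempty edge_orbit_snd)
qed

definition orbit_label :: "('h set \<times> 'x) set \<Rightarrow> 'x" where
  "orbit_label A = snd (SOME p. p \<in> A)"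

lemma orbit_label_vert [simp]: "orbit_label (vert_orbit \<sigma>) = \<sigma>"
  unfolding orbit_label_def by (rule vert_orbit_snd, rule someI, rule vert_orbit_nonempty)

lemma orbit_label_edge [simp]: "orbit_label (edge_orbit a) = a"
  unfolding orbit_label_def by (rule edge_orbit_snd, rule someI, rule edge_orbit_nonempty)

definition base_lift :: "('h set \<times> 'v) set \<Rightarrow> 'h set \<times> 'v" where
  "base_lift A = (coset \<one> (orbit_label A), orbit_label A)"

text \<open>The lift of \<open>a\<close> starting at the base lift ends at the coset of the inverse
  of \<open>\<phi>e a\<close>, and translation by \<open>\<phi>e a\<close> brings this to the base
  lift of the target.\<close>

definition edge_element :: "('h set \<times> 'e) set \<Rightarrow> 'h" where
  "edge_element A = \<phi>e (orbit_label A)"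

lemma edge_lift_orbit: "edge_lift D base_lift (edge_orbit a) = (coset \<one> (ini Y a), a)"
  unfolding edge_lift_def ini_orbit
  by (rule the_equality) (auto simp: base_lift_def edge_orbit_def)

lemma action_choices_D: "action_choices \<Gamma> D act_verts act_edges base_lift edge_element"
  unfolding action_choices_def verts_Q edges_Q
  using scw(1)
  by (auto simp: vert_orbit_nonempty base_lift_def edge_element_def edge_lift_orbit ter_Q)

abbreviation C :: "(('h set \<times> 'v) set, ('h set \<times> 'e) set, 'h) cog_data" where
  "C \<equiv> action_cog \<Gamma> D act_verts act_edges base_lift edge_element"

lemma stabilizer_base:
  assumes "\<sigma> \<in> verts Y"
  shows "stabilizer \<Gamma> act_verts (base_lift (vert_orbit \<sigma>)) = K \<sigma>"
proof (intro equalityI subsetI)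
  fix g
  {
    assume "g \<in> stabilizer \<Gamma> act_verts (base_lift (vert_orbit \<sigma>))"
    then have g: "g \<in> carrier \<Gamma>" "coset g \<sigma> = coset \<one> \<sigma>"
      using assms by (auto simp: stabilizer_def base_lift_def)
    then have "g \<in> coset \<one> \<sigma>" using coset_self assms by blast
    then show "g \<in> K \<sigma>" using coset_one assms by simp
  next
    assume g: "g \<in> K \<sigma>"
    then show "g \<in> stabilizer \<Gamma> act_verts (base_lift (vert_orbit \<sigma>))"
      using assms coset_mult_K[of "\<one>" \<sigma> g] by (auto simp: stabilizer_def base_lift_def)
  }
qed

text \<open>With these choices the homomorphisms of the action are conjugations by
  \<open>\<phi>e a\<close> and its twisting elements are the images of \<open>twist G a b\<close>.
  The local maps \<phi> therefore match everything on the nose, and the edge elements of the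
  isomorphism can be 1.\<close>

lemma cog_isomorphic_action:
  assumes inj: "\<And>\<sigma>. \<sigma> \<in> verts Y \<Longrightarrow> inj_on (\<phi> \<sigma>) (carrier (lgrp G \<sigma>))"
  shows "cog_isomorphic Y G Q C"
  unfolding cog_isomorphic_def
proof (intro exI conjI ballI)
  have lgrp: "lgrp C (vert_orbit \<sigma>) = \<Gamma>\<lparr>carrier := K \<sigma>\<rparr>" if "\<sigma> \<in> verts Y" for \<sigma>
    using that by (simp add: action_cog_def stabilizer_base)
  have hom: "\<phi> \<sigma> \<in> hom (lgrp G \<sigma>) (lgrp C (vert_orbit \<sigma>))" if "\<sigma> \<in> verts Y" for \<sigma>
    using group_morphismD(2)[OF morphism that] by (auto simp: lgrp that hom_def K_def)
  show "scwol_iso Y Q vert_orbit edge_orbit" by (rule scwol_iso_Q)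
  show "\<phi> \<sigma> \<in> iso (lgrp G \<sigma>) (lgrp C (vert_orbit \<sigma>))" if "\<sigma> \<in> verts Y" for \<sigma>
    using hom[OF that] inj[OF that] by (auto simp: iso_def bij_betw_def lgrp that K_def)
  show "cog_morphism Y G Q C vert_orbit edge_orbit \<phi> (\<lambda>_. \<one>)"
    unfolding cog_morphism_def
  proof (intro conjI ballI)
    show "nondeg_functor Y Q vert_orbit edge_orbit" using scwol_iso_Q by (simp add: scwol_iso_def)
    show "\<phi> \<sigma> \<in> hom (lgrp G \<sigma>) (lgrp C (vert_orbit \<sigma>))" if "\<sigma> \<in> verts Y" for \<sigma> by (rule hom[OF that])
  next
    fix a assume a: "a \<in> edges Y"
    note v = scw(1)[OF a]
    have one: "\<one> \<in> K (ter Y a)" using subgroup.one_closed[OF subgroup_K] v by auto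
    show "\<one> \<in> carrier (lgrp C (ter Q (edge_orbit a)))"
      using one a v by (simp add: ter_Q lgrp)
    fix g assume g: "g \<in> carrier (lgrp G (ini Y a))"
    have "inv\<^bsub>\<Gamma>\<lparr>carrier := K (ter Y a)\<rparr>\<^esub> \<one> = \<one>"
      using \<Gamma>.m_inv_consistent[OF subgroup_K one] v by simp
    moreover have "Ad \<Gamma> (\<phi>e a) (\<phi> (ini Y a) g) \<in> carrier \<Gamma>"
      using a g v by (auto simp: Ad_def)
    ultimately have "Ad (\<Gamma>\<lparr>carrier := K (ter Y a)\<rparr>) \<one> (Ad \<Gamma> (\<phi>e a) (\<phi> (ini Y a) g)) = Ad \<Gamma> (\<phi>e a) (\<phi> (ini Y a) g)"
      by (simp add: Ad_def[of "\<Gamma>\<lparr>carrier := K (ter Y a)\<rparr>"])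
    then show "Ad (lgrp C (ter Q (edge_orbit a))) \<one> (lhom C (edge_orbit a) (\<phi> (ini Y a) g)) = \<phi> (ter Y a) (lhom G a g)"
      using a g v group_morphismD(4)[OF morphism a g]
      by (simp add: ter_Q lgrp) (simp add: action_cog_def edge_element_def)
  next
    fix p assume "p \<in> composable2 Y"
    then obtain a b where p: "p = (a, b)" and ab: "a \<in> edges Y" "b \<in> edges Y" "ini Y a = ter Y b"
      by (auto simp: composable2_def)
    have t: "\<phi> (ter Y a) (twist G a b) \<in> carrier \<Gamma>" "cmp Y a b \<in> edges Y" "ter Y a \<in> verts Y"
      using complex_of_groupsD(5)[OF cog ab] scw ab by auto
    have "Ad \<Gamma> (\<phi>e a) \<one> = \<one>" using ab by (simp add: Ad_def)
    moreover have "\<phi> (ter Y a) (twist G a b) = \<phi>e a \<otimes> \<phi>e b \<otimes> inv \<phi>e (cmp Y a b)"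
      using group_morphismD(5)[OF morphism ab] t ab by (simp add: \<Gamma>.inv_solve_right)
    ultimately show "case p of (a, b) \<Rightarrow>
       \<phi> (ter Y a) (twist G a b) \<otimes>\<^bsub>lgrp C (ter Q (edge_orbit a))\<^esub> \<one> =
       \<one> \<otimes>\<^bsub>lgrp C (ter Q (edge_orbit a))\<^esub> lhom C (edge_orbit a) \<one>
         \<otimes>\<^bsub>lgrp C (ter Q (edge_orbit a))\<^esub> twist C (edge_orbit a) (edge_orbit b)"
      using t ab by (simp add: p ter_Q lgrp) (simp add: action_cog_def edge_element_def cmp_Q)
  qed
qed

end

text \<open>Injectivity makes the stabilizers \<open>K \<sigma>\<close> copies of the local groups,
  so the action on the development returns \<open>G\<close>. The type of \<Gamma> is the one over
  which \<open>developable\<close> ranges.\<close>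

theorem developableI:
  fixes Y :: "('v, 'e) scwol_data" and G :: "('v, 'e, 'g) cog_data" and \<Gamma> :: "('v, 'e, 'g) pi1_elem monoid"
  assumes "complex_of_groups Y G" and "group_morphism Y G \<Gamma> \<phi> \<phi>e"
    and "\<And>\<sigma>. \<sigma> \<in> verts Y \<Longrightarrow> inj_on (\<phi> \<sigma>) (carrier (lgrp G \<sigma>))"
    and "simply_connected_scwol (development Y G \<Gamma> \<phi> \<phi>e)"
  shows "developable Y G"
proof -
  interpret morphism_to_group Y G \<Gamma> \<phi> \<phi>e by unfold_locales fact+
  have iso: "cog_isomorphic Y G Q C" by (rule cog_isomorphic_action) (rule assms(3))
  show ?thesis
    unfolding developable_def
    by (intro conjI exI[of _ \<Gamma>] exI[of _ D] exI[of _ act_verts] exI[of _ act_edges] exI[of _ base_lift]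
        exI[of _ edge_element] assms(1) \<Gamma>.group_axioms scwol_action_D action_choices_D iso
        assms(4)[folded D_def])
qed

section \<open>The local complex of groups\<close>

lemma scwol_upper_link:
  assumes "scwol Y"
  shows "scwol (upper_link Y \<gamma>)"
proof -
  \<comment> \<open>The sources \<open>ini Y d\<close> and \<open>ini Y c = ter Y d\<close> differ;
    so the link has no loops.\<close>
  have "cmp Y c d \<noteq> c" if "c \<in> edges Y" "d \<in> edges Y" "ini Y c = ter Y d" for c d
    using scwolD(1)[OF assms, of d] scwolD(2)[OF assms that] that by auto
  then show ?thesis
    unfolding scwol_def by (auto simp: upper_link_def composable2_def scwolD(2,3)[OF assms])
qed

lemma scwol_lower_link:
  assumes "scwol Y"
  shows "scwol (lower_link Y \<gamma>)"
proof -
  have "cmp Y a b \<noteq> b" if "a \<in> edges Y" "b \<in> edges Y" "ini Y a = ter Y b" for a b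
    using scwolD(1)[OF assms, of a] scwolD(2)[OF assms that] that by auto
  then have "b \<noteq> cmp Y a b" if "a \<in> edges Y" "b \<in> edges Y" "ini Y a = ter Y b" for a b
    using that by metis
  then show ?thesis
    unfolding scwol_def by (auto simp: lower_link_def composable2_def scwolD(2,3)[OF assms])
qed

lemma scwol_link_join:
  assumes U: "scwol U" and L: "scwol L"
  shows "scwol (link_join U L)"
proof -
  note u = scwolD[OF U] and l = scwolD[OF L]
  have sel: "ini (link_join U L) = join_ini U L" "ter (link_join U L) = join_ter U L" "cmp (link_join U L) = join_cmp U L"
    by (simp_all add: link_join_def)
  have edges: "p \<in> edges (link_join U L) \<longleftrightarrow> (case p of UpE e \<Rightarrow> e \<in> edges U | LowE f \<Rightarrow> f \<in> edges L
      | ApexUp x \<Rightarrow> x \<in> verts U | LowUp b x \<Rightarrow> b \<in> verts L \<and> x \<in> verts U | LowApex b \<Rightarrow> b \<in> verts L)" for p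
    by (cases p) (auto simp: link_join_def)
  have verts: "v \<in> verts (link_join U L) \<longleftrightarrow> (case v of Up x \<Rightarrow> x \<in> verts U | Apex \<Rightarrow> True | Low b \<Rightarrow> b \<in> verts L)" for v
    by (cases v) (auto simp: link_join_def)
  show ?thesis
    unfolding scwol_def sel
  proof (intro conjI ballI impI)
    fix p assume p: "p \<in> edges (link_join U L)"
    then show "join_ini U L p \<in> verts (link_join U L)" "join_ter U L p \<in> verts (link_join U L)"
      "join_ini U L p \<noteq> join_ter U L p"
      using u(1) l(1) by (auto simp: edges verts split: jedge.splits)
    fix q assume q: "q \<in> edges (link_join U L)"
    {
      assume pq: "join_ini U L p = join_ter U L q"
      then show "join_cmp U L p q \<in> edges (link_join U L)" "join_ini U L (join_cmp U L p q) = join_ini U L q"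
        "join_ter U L (join_cmp U L p q) = join_ter U L p"
        using p q by (cases p; cases q; use u(1,2) l(1,2) in \<open>force simp: edges\<close>)+
      fix r assume "r \<in> edges (link_join U L)" "join_ini U L q = join_ter U L r"
      then show "join_cmp U L (join_cmp U L p q) r = join_cmp U L p (join_cmp U L q r)"
        using p q pq by (cases p; cases q; cases r; simp add: edges u(2,3) l(2,3))
    }
  qed
qed

lemma Ad_mult:
  assumes "group H" "g \<in> carrier H" "h \<in> carrier H" "x \<in> carrier H"
  shows "Ad H (g \<otimes>\<^bsub>H\<^esub> h) x = Ad H g (Ad H h x)"
proof -
  interpret group H by fact
  show ?thesis using assms(2-) by (simp add: Ad_def m_assoc inv_mult_group)
qed

lemma hom_Ad:
  assumes "group H" "group K" "f \<in> hom H K" "g \<in> carrier H" "x \<in> carrier H"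
  shows "f (Ad H g x) = Ad K (f g) (f x)"
proof -
  interpret group_hom H K f using assms by (simp add: group_hom_def group_hom_axioms_def)
  show ?thesis using assms(4-) by (simp add: Ad_def)
qed

text \<open>
  Since \<open>\<phi>\<close> is injective on the local groups, the compatibility and cocycle conditions need only be
  checked after applying \<open>\<phi>\<close>, where they follow from the associativity of \<open>\<Gamma>\<close>.
\<close>

lemma complex_of_groupsI:
  assumes Y: "scwol Y" and grp: "\<And>\<sigma>. \<sigma> \<in> verts Y \<Longrightarrow> group (lgrp G \<sigma>)"
    and hom: "\<And>a. a \<in> edges Y \<Longrightarrow> lhom G a \<in> hom (lgrp G (ini Y a)) (lgrp G (ter Y a))"
    and twist: "\<And>a b. \<lbrakk>a \<in> edges Y; b \<in> edges Y; ini Y a = ter Y b\<rbrakk> \<Longrightarrow> twist G a b \<in> carrier (lgrp G (ter Y a))"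
    and morphism: "group_morphism Y G \<Gamma> \<phi> \<phi>e"
    and inj: "\<And>\<sigma>. \<sigma> \<in> verts Y \<Longrightarrow> inj_on (\<phi> \<sigma>) (carrier (lgrp G \<sigma>))"
  shows "complex_of_groups Y G"
proof -
  note s = scwolD[OF Y] and m = group_morphismD[OF morphism]
  interpret \<Gamma>: group \<Gamma> by (rule m)
  have hc: "lhom G a g \<in> carrier (lgrp G (ter Y a))" if "a \<in> edges Y" "g \<in> carrier (lgrp G (ini Y a))" for a g
    using hom that by (auto simp: hom_def)
  have Ad_closed: "Ad (lgrp G \<sigma>) g x \<in> carrier (lgrp G \<sigma>)"
    if "\<sigma> \<in> verts Y" "g \<in> carrier (lgrp G \<sigma>)" "x \<in> carrier (lgrp G \<sigma>)" for \<sigma> g x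
    using group.is_monoid[OF grp[OF that(1)]] group.inv_closed[OF grp[OF that(1)]] that
    by (auto simp: Ad_def intro!: monoid.m_closed)
  \<comment> \<open>\<open>\<phi> (ter Y a)\<close> after \<open>lhom G a\<close> is a conjugate of
    \<open>\<phi> (ini Y a)\<close>, so injectivity passes to \<open>lhom G a\<close>.\<close>
  have inj_lhom: "inj_on (lhom G a) (carrier (lgrp G (ini Y a)))" if a: "a \<in> edges Y" for a
  proof (rule inj_onI)
    fix g h assume gh: "g \<in> carrier (lgrp G (ini Y a))" "h \<in> carrier (lgrp G (ini Y a))" "lhom G a g = lhom G a h"
    note v = s(1)[OF a]
    have "Ad \<Gamma> (\<phi>e a) (\<phi> (ini Y a) g) = Ad \<Gamma> (\<phi>e a) (\<phi> (ini Y a) h)"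
      using m(4)[OF a] gh by metis
    then have "\<phi> (ini Y a) g = \<phi> (ini Y a) h"
      using m(3)[OF a] m(6) v gh by (simp add: Ad_def)
    then show "g = h" using inj v gh by (meson inj_onD)
  qed
  have Ad_twist: "Ad (lgrp G (ter Y a)) (twist G a b) (lhom G (cmp Y a b) g) = lhom G a (lhom G b g)"
    if ab: "a \<in> edges Y" "b \<in> edges Y" "ini Y a = ter Y b" and g: "g \<in> carrier (lgrp G (ini Y b))" for a b g
  proof -
    note c = s(2)[OF ab] and v = s(1)[OF ab(1)] s(1)[OF ab(2)] and t = twist[OF ab]
    let ?\<phi> = "\<phi> (ter Y a)"
    have g': "lhom G (cmp Y a b) g \<in> carrier (lgrp G (ter Y a))" using hc[of "cmp Y a b" g] c g by simp
    have "?\<phi> (Ad (lgrp G (ter Y a)) (twist G a b) (lhom G (cmp Y a b) g))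
      = Ad \<Gamma> (?\<phi> (twist G a b)) (?\<phi> (lhom G (cmp Y a b) g))"
      using hom_Ad[OF grp \<Gamma>.group_axioms m(2) t g'] v by simp
    also have "?\<phi> (lhom G (cmp Y a b) g) = Ad \<Gamma> (\<phi>e (cmp Y a b)) (\<phi> (ini Y b) g)"
      using m(4)[of "cmp Y a b" g] c g by simp
    also have "Ad \<Gamma> (?\<phi> (twist G a b)) (Ad \<Gamma> (\<phi>e (cmp Y a b)) (\<phi> (ini Y b) g))
        = Ad \<Gamma> (\<phi>e a) (Ad \<Gamma> (\<phi>e b) (\<phi> (ini Y b) g))"
      using m(5)[OF ab] m(3,6) v g t c ab by (simp flip: Ad_mult[OF \<Gamma>.group_axioms])
    also have "\<dots> = ?\<phi> (lhom G a (lhom G b g))"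
      using m(4)[OF ab(2) g] m(4)[OF ab(1)] hc[OF ab(2) g] ab(3) by simp
    finally show ?thesis
      using inj[of "ter Y a"] v Ad_closed[OF _ t g'] hc[OF ab(1)] hc[OF ab(2) g] ab(3) by (auto dest: inj_onD)
  qed
  have cocycle: "lhom G a (twist G b c) \<otimes>\<^bsub>lgrp G (ter Y a)\<^esub> twist G a (cmp Y b c) =
        twist G a b \<otimes>\<^bsub>lgrp G (ter Y a)\<^esub> twist G (cmp Y a b) c"
    if abc: "a \<in> edges Y" "b \<in> edges Y" "c \<in> edges Y" "ini Y a = ter Y b" "ini Y b = ter Y c" for a b c
  proof -
    let ?H = "lgrp G (ter Y a)" and ?\<phi> = "\<phi> (ter Y a)"
    note ab = s(2)[OF abc(1,2,4)] and bc = s(2)[OF abc(2,3,5)] and v = s(1)[OF abc(1)] s(1)[OF abc(2)]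
    have ab_c: "ini Y (cmp Y a b) = ter Y c" and a_bc: "ini Y a = ter Y (cmp Y b c)" using ab bc abc by auto
    have abc': "cmp Y (cmp Y a b) c = cmp Y a (cmp Y b c)" by (rule s(3)[OF abc])
    interpret H: group ?H using grp v by simp
    interpret \<phi>: group_hom ?H \<Gamma> ?\<phi> by unfold_locales (use m(2) v in simp)
    have t: "twist G a b \<in> carrier ?H" "twist G (cmp Y a b) c \<in> carrier ?H" "twist G a (cmp Y b c) \<in> carrier ?H"
      "lhom G a (twist G b c) \<in> carrier ?H" "twist G b c \<in> carrier (lgrp G (ini Y a))"
      using twist[OF abc(1,2,4)] twist[of "cmp Y a b" c] twist[of a "cmp Y b c"] twist[OF abc(2,3,5)]
        hc[OF abc(1)] ab bc abc by auto
    have e: "\<phi>e a \<in> carrier \<Gamma>" "\<phi>e b \<in> carrier \<Gamma>" "\<phi>e c \<in> carrier \<Gamma>" "\<phi>e (cmp Y a b) \<in> carrier \<Gamma>"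
      "\<phi>e (cmp Y b c) \<in> carrier \<Gamma>" "\<phi>e (cmp Y a (cmp Y b c)) \<in> carrier \<Gamma>" "\<phi> (ini Y a) (twist G b c) \<in> carrier \<Gamma>"
      using m(3,6) abc ab bc s(2)[OF abc(1) _ a_bc] v t by auto
    \<comment> \<open>Multiplied by \<open>\<phi>e\<close> of the triple composite, the images of
      both sides become the product of \<open>\<phi>e a\<close>, \<open>\<phi>e b\<close> and
      \<open>\<phi>e c\<close>.\<close>
    have "?\<phi> (lhom G a (twist G b c) \<otimes>\<^bsub>?H\<^esub> twist G a (cmp Y b c)) \<otimes>\<^bsub>\<Gamma>\<^esub> \<phi>e (cmp Y a (cmp Y b c))
      = ?\<phi> (lhom G a (twist G b c)) \<otimes>\<^bsub>\<Gamma>\<^esub> (?\<phi> (twist G a (cmp Y b c)) \<otimes>\<^bsub>\<Gamma>\<^esub> \<phi>e (cmp Y a (cmp Y b c)))"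
      using t e by (simp add: \<Gamma>.m_assoc)
    also have "\<dots> = Ad \<Gamma> (\<phi>e a) (\<phi> (ini Y a) (twist G b c)) \<otimes>\<^bsub>\<Gamma>\<^esub> (\<phi>e a \<otimes>\<^bsub>\<Gamma>\<^esub> \<phi>e (cmp Y b c))"
      using m(4)[OF abc(1) t(5)] m(5)[OF abc(1) _ a_bc] bc by simp
    also have "\<dots> = \<phi>e a \<otimes>\<^bsub>\<Gamma>\<^esub> (\<phi> (ini Y a) (twist G b c) \<otimes>\<^bsub>\<Gamma>\<^esub> (inv\<^bsub>\<Gamma>\<^esub> \<phi>e a \<otimes>\<^bsub>\<Gamma>\<^esub> \<phi>e a \<otimes>\<^bsub>\<Gamma>\<^esub> \<phi>e (cmp Y b c)))"
      unfolding Ad_def using e by (simp add: \<Gamma>.m_assoc) (simp flip: \<Gamma>.m_assoc)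
    also have "\<dots> = \<phi>e a \<otimes>\<^bsub>\<Gamma>\<^esub> (\<phi>e b \<otimes>\<^bsub>\<Gamma>\<^esub> \<phi>e c)"
      using m(5)[OF abc(2,3,5)] e abc(4) by simp
    also have "\<dots> = ?\<phi> (twist G a b) \<otimes>\<^bsub>\<Gamma>\<^esub> (\<phi>e (cmp Y a b) \<otimes>\<^bsub>\<Gamma>\<^esub> \<phi>e c)"
      using m(5)[OF abc(1,2,4)] t e by (simp flip: \<Gamma>.m_assoc)
    also have "\<dots> = ?\<phi> (twist G a b) \<otimes>\<^bsub>\<Gamma>\<^esub> (?\<phi> (twist G (cmp Y a b) c) \<otimes>\<^bsub>\<Gamma>\<^esub> \<phi>e (cmp Y a (cmp Y b c)))"
      using m(5)[of "cmp Y a b" c] ab abc ab_c abc' by simp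
    also have "\<dots> = ?\<phi> (twist G a b \<otimes>\<^bsub>?H\<^esub> twist G (cmp Y a b) c) \<otimes>\<^bsub>\<Gamma>\<^esub> \<phi>e (cmp Y a (cmp Y b c))"
      using t e by (simp add: \<Gamma>.m_assoc)
    finally have "?\<phi> (lhom G a (twist G b c) \<otimes>\<^bsub>?H\<^esub> twist G a (cmp Y b c)) = ?\<phi> (twist G a b \<otimes>\<^bsub>?H\<^esub> twist G (cmp Y a b) c)"
      using t e by (simp del: \<phi>.hom_mult)
    then show ?thesis using inj[of "ter Y a"] v t by (meson inj_onD H.m_closed)
  qed
  show ?thesis
    unfolding complex_of_groups_def composable2_def composable3_def
    using Y grp hom inj_lhom twist Ad_twist cocycle by auto
qed

section \<open>The morphism from the local complex of groups to the group at \<gamma>\<close>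

fun local_map :: "('v, 'e, 'g) cog_data \<Rightarrow> ('e, 'e) jvert \<Rightarrow> 'g \<Rightarrow> 'g" where
  "local_map G (Up c) g = lhom G c g"
| "local_map G Apex g = g"
| "local_map G (Low b) g = g"

text \<open>At \<open>(c, d)\<close> the value is the element that conjugates
  \<open>lhom G (cmp Y c d)\<close> into the composite of \<open>lhom G c\<close> and
  \<open>lhom G d\<close>. Along all other edges the maps \<open>local_map\<close> agree as they
  are.\<close>

fun local_element :: "('v, 'e, 'g) cog_data \<Rightarrow> 'v \<Rightarrow> ('e, 'e \<times> 'e, 'e, 'e \<times> 'e) jedge \<Rightarrow> 'g" where
  "local_element G \<gamma> (UpE (c, d)) = twist G c d"
| "local_element G \<gamma> _ = \<one>\<^bsub>lgrp G \<gamma>\<^esub>"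

lemma local_edge_cases:
  fixes p :: "('u, 'c \<times> 'd, 'b, 'i \<times> 'j) jedge"
  obtains c d where "p = UpE (c, d)" | a b where "p = LowE (a, b)" | c where "p = ApexUp c"
    | b c where "p = LowUp b c" | b where "p = LowApex b"
  by (metis jedge.exhaust surj_pair)

locale local_complex =
  fixes Y :: "('v, 'e) scwol_data" and G :: "('v, 'e, 'g) cog_data" and \<gamma> :: 'v
  assumes cog: "complex_of_groups Y G" and \<gamma>: "\<gamma> \<in> verts Y"
begin

abbreviation "LS \<equiv> local_scwol Y \<gamma>"
abbreviation "LG \<equiv> local_cog Y G \<gamma>"
abbreviation "G\<gamma> \<equiv> lgrp G \<gamma>"

lemmas C = complex_of_groupsD[OF cog]
lemmas S = scwolD[OF C(1)]

sublocale G: group G\<gamma> by (rule C(2)[OF \<gamma>])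

lemma scwol_local: "scwol LS"
  unfolding local_scwol_def by (intro scwol_link_join scwol_upper_link scwol_lower_link C(1))

lemma vert_local: "v \<in> verts LS \<longleftrightarrow> (case v of Up c \<Rightarrow> c \<in> edges Y \<and> ter Y c = \<gamma> | Apex \<Rightarrow> True
    | Low b \<Rightarrow> b \<in> edges Y \<and> ini Y b = \<gamma>)"
  by (cases v) (auto simp: local_scwol_def link_join_def upper_link_def lower_link_def)

lemma edge_local: "p \<in> edges LS \<longleftrightarrow> (case p of
      UpE e \<Rightarrow> (case e of (c, d) \<Rightarrow> c \<in> edges Y \<and> d \<in> edges Y \<and> ini Y c = ter Y d \<and> ter Y c = \<gamma>)
    | LowE f \<Rightarrow> (case f of (a, b) \<Rightarrow> a \<in> edges Y \<and> b \<in> edges Y \<and> ini Y a = ter Y b \<and> ini Y b = \<gamma>)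
    | ApexUp c \<Rightarrow> c \<in> edges Y \<and> ter Y c = \<gamma>
    | LowUp b c \<Rightarrow> b \<in> edges Y \<and> ini Y b = \<gamma> \<and> c \<in> edges Y \<and> ter Y c = \<gamma>
    | LowApex b \<Rightarrow> b \<in> edges Y \<and> ini Y b = \<gamma>)"
  by (cases p) (auto simp: local_scwol_def link_join_def upper_link_def lower_link_def composable2_def)

lemma link_local [simp]:
  "ini LS (UpE (c, d)) = Up (cmp Y c d)" "ter LS (UpE (c, d)) = Up c"
  "ini LS (LowE (a, b)) = Low b" "ter LS (LowE (a, b)) = Low (cmp Y a b)"
  "ini LS (ApexUp c) = Up c" "ter LS (ApexUp c) = Apex"
  "ini LS (LowUp b c) = Up c" "ter LS (LowUp b c) = Low b"
  "ini LS (LowApex b) = Apex" "ter LS (LowApex b) = Low b"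
  "cmp LS (UpE (c, d)) (UpE (c', d')) = UpE (c, cmp Y d d')"
  "cmp LS (LowE (a, b)) (LowE (a', b')) = LowE (cmp Y a a', b')"
  "cmp LS (ApexUp c') (UpE (c, d)) = ApexUp (cmp Y c d)"
  "cmp LS (LowUp b c') (UpE (c, d)) = LowUp b (cmp Y c d)"
  "cmp LS (LowE (a, b)) (LowUp b' c) = LowUp (cmp Y a b) c"
  "cmp LS (LowApex b) (ApexUp c) = LowUp b c"
  "cmp LS (LowE (a, b)) (LowApex b') = LowApex (cmp Y a b)"
  by (simp_all add: local_scwol_def link_join_def upper_link_def lower_link_def)

lemma cog_local [simp]: "lgrp LG = local_grp Y G \<gamma>" "lhom LG = local_hom G" "twist LG = local_twist G \<gamma>"
  by (simp_all add: local_cog_def)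

lemma lhom_local_closed: "c \<in> edges Y \<Longrightarrow> g \<in> carrier (lgrp G (ini Y c)) \<Longrightarrow> lhom G c g \<in> carrier (lgrp G (ter Y c))"
  using C(3) by (auto simp: hom_def)

text \<open>The conjugation axiom at \<open>(c, d)\<close> is the compatibility of
  \<open>twist G c d\<close> with composition in \<open>G\<close>, and the product axiom for two
  edges of the upper link is the cocycle identity of \<open>G\<close>. In all other cases at most
  one factor on either side differs from 1.\<close>

lemma group_morphism_local: "group_morphism LS LG G\<gamma> (local_map G) (local_element G \<gamma>)"
  unfolding group_morphism_def
proof (intro conjI ballI)
  fix v assume v: "v \<in> verts LS"
  show "local_map G v \<in> hom (lgrp LG v) G\<gamma>"
  proof (cases v)
    case (Up c)
    then have "lhom G c \<in> hom (lgrp G (ini Y c)) G\<gamma>" using v C(3)[of c] by (simp add: vert_local)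
    moreover have "local_map G (Up c) = lhom G c" by (rule ext) simp
    ultimately show ?thesis using Up by simp
  qed (auto simp: hom_def)
next
  fix p assume p: "p \<in> edges LS"
  show "local_element G \<gamma> p \<in> carrier G\<gamma>"
    using p C(5) by (cases p) (auto simp: edge_local)
  fix g assume g: "g \<in> carrier (lgrp LG (ini LS p))"
  show "Ad G\<gamma> (local_element G \<gamma> p) (local_map G (ini LS p) g) = local_map G (ter LS p) (lhom LG p g)"
  proof (cases p)
    case (UpE e)
    obtain c d where e: "e = (c, d)" by (cases e)
    have cd: "c \<in> edges Y" "d \<in> edges Y" "ini Y c = ter Y d" "ter Y c = \<gamma>"
      using p UpE e by (auto simp: edge_local)
    then have "g \<in> carrier (lgrp G (ini Y d))" using g S(2)[OF cd(1-3)] UpE e by simp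
    then show ?thesis using C(6)[OF cd(1-3)] cd UpE e by simp
  next
    case (LowE f)
    then show ?thesis using g by (cases f) (auto simp: Ad_def)
  next
    case (ApexUp c)
    then show ?thesis using p g lhom_local_closed[of c g] by (simp add: edge_local Ad_def)
  next
    case (LowUp b c)
    then show ?thesis using p g lhom_local_closed[of c g] by (simp add: edge_local Ad_def)
  qed (use p g in \<open>auto simp: edge_local Ad_def\<close>)
next
  fix w assume "w \<in> composable2 LS"
  then obtain p q where w: "w = (p, q)" and p: "p \<in> edges LS" and q: "q \<in> edges LS" and pq: "ini LS p = ter LS q"
    by (auto simp: composable2_def)
  have "local_map G (ter LS p) (twist LG p q) \<otimes>\<^bsub>G\<gamma>\<^esub> local_element G \<gamma> (cmp LS p q)
     = local_element G \<gamma> p \<otimes>\<^bsub>G\<gamma>\<^esub> local_element G \<gamma> q"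
  proof (cases q)
    case (UpE e)
    obtain c d where e: "e = (c, d)" by (cases e)
    have cd: "c \<in> edges Y" "d \<in> edges Y" "ini Y c = ter Y d" "ter Y c = \<gamma>"
      using q UpE e by (auto simp: edge_local)
    note t = C(5)[OF cd(1-3)]
    show ?thesis
    proof (cases p)
      case (UpE e')
      obtain c' d' where e': "e' = (c', d')" by (cases e')
      have cd': "c' \<in> edges Y" "d' \<in> edges Y" "ini Y c' = ter Y d'" "ter Y c' = \<gamma>" "c = cmp Y c' d'"
        using p pq UpE e e' \<open>q = UpE e\<close> by (auto simp: edge_local)
      have "ini Y d' = ter Y d" using cd cd' S(2)[OF cd'(1-3)] by simp
      then show ?thesis
        using C(7)[OF cd'(1,2) cd(2) cd'(3)] cd cd' UpE e e' \<open>q = UpE e\<close> by simp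
    next
      case (LowE f)
      then show ?thesis using pq UpE e by (cases f) simp
    qed (use p pq UpE e t cd in \<open>auto simp: edge_local\<close>)
  next
    case (LowE f)
    obtain a b where f: "f = (a, b)" by (cases f)
    show ?thesis using pq LowE f by (cases p rule: local_edge_cases) auto
  next
    case (ApexUp c)
    then show ?thesis using pq by (cases p rule: local_edge_cases) auto
  next
    case (LowUp b c)
    then show ?thesis using pq by (cases p rule: local_edge_cases) auto
  next
    case (LowApex b)
    then show ?thesis using pq by (cases p rule: local_edge_cases) auto
  qed
  then show "case w of (p, q) \<Rightarrow> local_map G (ter LS p) (twist LG p q) \<otimes>\<^bsub>G\<gamma>\<^esub> local_element G \<gamma> (cmp LS p q)
     = local_element G \<gamma> p \<otimes>\<^bsub>G\<gamma>\<^esub> local_element G \<gamma> q" by (simp add: w)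
qed (rule G.group_axioms)

lemma inj_local_map: "v \<in> verts LS \<Longrightarrow> inj_on (local_map G v) (carrier (lgrp LG v))"
  using C(4) by (cases v) (auto simp: vert_local inj_on_def)

lemma complex_of_groups_local: "complex_of_groups LS LG"
proof (rule complex_of_groupsI[OF scwol_local _ _ _ group_morphism_local inj_local_map])
  show "group (lgrp LG v)" if "v \<in> verts LS" for v
    using that C(2) S(1) by (cases v) (auto simp: vert_local)
next
  fix p assume p: "p \<in> edges LS"
  show "lhom LG p \<in> hom (lgrp LG (ini LS p)) (lgrp LG (ter LS p))"
  proof (cases p)
    case (UpE e)
    then show ?thesis using p C(3) S(2) by (cases e) (auto simp: edge_local)
  next
    case (LowE f)
    then show ?thesis by (cases f) (auto simp: hom_def)
  next
    case (LowApex b)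
    then show ?thesis by (auto simp: hom_def)
  next
    case (ApexUp c)
    then show ?thesis using p C(3)[of c] by (simp add: edge_local)
  next
    case (LowUp b c)
    then show ?thesis using p C(3)[of c] by (simp add: edge_local)
  qed
next
  fix p q assume p: "p \<in> edges LS" and q: "q \<in> edges LS" and pq: "ini LS p = ter LS q"
  show "twist LG p q \<in> carrier (lgrp LG (ter LS p))"
  proof (cases q)
    case (UpE e)
    obtain c d where e: "e = (c, d)" by (cases e)
    have cd: "c \<in> edges Y" "d \<in> edges Y" "ini Y c = ter Y d" "ter Y c = \<gamma>"
      using q UpE e by (auto simp: edge_local)
    show ?thesis
    proof (cases p)
      case (UpE e')
      obtain c' d' where e': "e' = (c', d')" by (cases e')
      have cd': "c' \<in> edges Y" "d' \<in> edges Y" "ini Y c' = ter Y d'" "c = cmp Y c' d'"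
        using p pq UpE e e' \<open>q = UpE e\<close> by (auto simp: edge_local)
      then show ?thesis
        using C(5)[of d' d] cd S(2)[OF cd'(1-3)] UpE e e' \<open>q = UpE e\<close> by simp
    next
      case (LowE f)
      then show ?thesis using pq UpE e by (cases f) simp
    qed (use p pq UpE e C(5)[OF cd(1-3)] cd in \<open>auto simp: edge_local\<close>)
  next
    case (LowE f)
    obtain a b where f: "f = (a, b)" by (cases f)
    show ?thesis using pq LowE f by (cases p rule: local_edge_cases) auto
  next
    case (ApexUp c)
    then show ?thesis using pq by (cases p rule: local_edge_cases) auto
  next
    case (LowUp b c)
    then show ?thesis using pq by (cases p rule: local_edge_cases) auto
  next
    case (LowApex b)
    then show ?thesis using pq by (cases p rule: local_edge_cases) auto
  qed
qed

end

section \<open>Conjugate morphisms\<close>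

lemma (in group) Ad_closed [simp]: "g \<in> carrier G \<Longrightarrow> x \<in> carrier G \<Longrightarrow> Ad G g x \<in> carrier G"
  by (simp add: Ad_def)

lemma (in group) Ad_one [simp]: "x \<in> carrier G \<Longrightarrow> Ad G \<one> x = x"
  by (simp add: Ad_def)

lemma (in group) Ad_eq_iff: "g \<in> carrier G \<Longrightarrow> x \<in> carrier G \<Longrightarrow> y \<in> carrier G \<Longrightarrow> Ad G g x = Ad G g y \<longleftrightarrow> x = y"
  by (simp add: Ad_def)

lemma (in group) Ad_hom: "\<lbrakk>g \<in> carrier G; x \<in> carrier G; y \<in> carrier G\<rbrakk> \<Longrightarrow> Ad G g (x \<otimes> y) = Ad G g x \<otimes> Ad G g y"
  by (simp add: Ad_def m_assoc) (simp flip: m_assoc)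

text \<open>A change of gauge at the vertices: for composable edges the factors at the middle vertex
  cancel.\<close>

lemma group_morphism_conjugate:
  assumes Y: "complex_of_groups Y G" and m: "group_morphism Y G H \<phi> \<phi>e" and k: "\<And>\<sigma>. \<sigma> \<in> verts Y \<Longrightarrow> k \<sigma> \<in> carrier H"
  shows "group_morphism Y G H (\<lambda>\<sigma> g. Ad H (k \<sigma>) (\<phi> \<sigma> g))
    (\<lambda>a. k (ter Y a) \<otimes>\<^bsub>H\<^esub> \<phi>e a \<otimes>\<^bsub>H\<^esub> inv\<^bsub>H\<^esub> k (ini Y a))"
  unfolding group_morphism_def
proof (intro conjI ballI)
  note M = group_morphismD[OF m] and C = complex_of_groupsD[OF Y]
  note S = scwolD[OF C(1)]
  interpret group H by (rule M)
  fix \<sigma> assume s: "\<sigma> \<in> verts Y"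
  show "(\<lambda>g. Ad H (k \<sigma>) (\<phi> \<sigma> g)) \<in> hom (lgrp G \<sigma>) H"
    by (rule homI) (use s k M(6) hom_mult[OF M(2)] in \<open>auto simp: Ad_hom\<close>)
next
  note M = group_morphismD[OF m] and C = complex_of_groupsD[OF Y]
  note S = scwolD[OF C(1)]
  interpret group H by (rule M)
  fix a assume a: "a \<in> edges Y"
  note v = S(1)[OF a] and e = M(3)[OF a]
  show "k (ter Y a) \<otimes>\<^bsub>H\<^esub> \<phi>e a \<otimes>\<^bsub>H\<^esub> inv\<^bsub>H\<^esub> k (ini Y a) \<in> carrier H" using v e k by simp
  fix g assume g: "g \<in> carrier (lgrp G (ini Y a))"
  have x: "\<phi> (ini Y a) g \<in> carrier H" using M(6) v g by blast
  have ki: "k (ini Y a) \<in> carrier H" "k (ter Y a) \<in> carrier H" using k v by auto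
  have "Ad H (k (ter Y a) \<otimes>\<^bsub>H\<^esub> \<phi>e a \<otimes>\<^bsub>H\<^esub> inv\<^bsub>H\<^esub> k (ini Y a)) (Ad H (k (ini Y a)) (\<phi> (ini Y a) g))
    = Ad H (k (ter Y a) \<otimes>\<^bsub>H\<^esub> \<phi>e a \<otimes>\<^bsub>H\<^esub> inv\<^bsub>H\<^esub> k (ini Y a) \<otimes>\<^bsub>H\<^esub> k (ini Y a)) (\<phi> (ini Y a) g)"
    using Ad_mult[OF group_axioms, of "k (ter Y a) \<otimes>\<^bsub>H\<^esub> \<phi>e a \<otimes>\<^bsub>H\<^esub> inv\<^bsub>H\<^esub> k (ini Y a)" "k (ini Y a)"] x ki e by simp
  also have "\<dots> = Ad H (k (ter Y a) \<otimes>\<^bsub>H\<^esub> \<phi>e a) (\<phi> (ini Y a) g)"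
    using ki e by (simp add: m_assoc)
  also have "\<dots> = Ad H (k (ter Y a)) (\<phi> (ter Y a) (lhom G a g))"
    using Ad_mult[OF group_axioms ki(2) e x] M(4)[OF a g] by simp
  finally show "Ad H (k (ter Y a) \<otimes>\<^bsub>H\<^esub> \<phi>e a \<otimes>\<^bsub>H\<^esub> inv\<^bsub>H\<^esub> k (ini Y a)) (Ad H (k (ini Y a)) (\<phi> (ini Y a) g))
     = Ad H (k (ter Y a)) (\<phi> (ter Y a) (lhom G a g))" .
next
  note M = group_morphismD[OF m] and C = complex_of_groupsD[OF Y]
  note S = scwolD[OF C(1)]
  interpret group H by (rule M)
  fix w assume "w \<in> composable2 Y"
  then obtain a b where w: "w = (a, b)" and ab: "a \<in> edges Y" "b \<in> edges Y" "ini Y a = ter Y b"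
    by (auto simp: composable2_def)
  note c = S(2)[OF ab]
  have x: "\<phi> (ter Y a) (twist G a b) \<in> carrier H" using M(6) S(1)[OF ab(1)] C(5)[OF ab] by blast
  have e: "\<phi>e a \<in> carrier H" "\<phi>e b \<in> carrier H" "\<phi>e (cmp Y a b) \<in> carrier H" using M(3) ab c by auto
  have ki: "k (ter Y a) \<in> carrier H" "k (ter Y b) \<in> carrier H" "k (ini Y b) \<in> carrier H" using k S(1) ab by auto
  have cancel: "inv\<^bsub>H\<^esub> u \<otimes>\<^bsub>H\<^esub> (u \<otimes>\<^bsub>H\<^esub> y) = y" if "u \<in> carrier H" "y \<in> carrier H" for u y
    using that by (simp flip: m_assoc)
  have "Ad H (k (ter Y a)) (\<phi> (ter Y a) (twist G a b)) \<otimes>\<^bsub>H\<^esub> (k (ter Y a) \<otimes>\<^bsub>H\<^esub> \<phi>e (cmp Y a b) \<otimes>\<^bsub>H\<^esub> inv\<^bsub>H\<^esub> k (ini Y b))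
    = k (ter Y a) \<otimes>\<^bsub>H\<^esub> (\<phi> (ter Y a) (twist G a b) \<otimes>\<^bsub>H\<^esub> \<phi>e (cmp Y a b)) \<otimes>\<^bsub>H\<^esub> inv\<^bsub>H\<^esub> k (ini Y b)"
    unfolding Ad_def using x e ki by (simp add: m_assoc cancel)
  also have "\<dots> = (k (ter Y a) \<otimes>\<^bsub>H\<^esub> \<phi>e a \<otimes>\<^bsub>H\<^esub> inv\<^bsub>H\<^esub> k (ini Y a)) \<otimes>\<^bsub>H\<^esub> (k (ter Y b) \<otimes>\<^bsub>H\<^esub> \<phi>e b \<otimes>\<^bsub>H\<^esub> inv\<^bsub>H\<^esub> k (ini Y b))"
    unfolding M(5)[OF ab] ab(3) using e ki by (simp add: m_assoc cancel)
  finally show "case w of (a, b) \<Rightarrow> Ad H (k (ter Y a)) (\<phi> (ter Y a) (twist G a b)) \<otimes>\<^bsub>H\<^esub>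
      (k (ter Y (cmp Y a b)) \<otimes>\<^bsub>H\<^esub> \<phi>e (cmp Y a b) \<otimes>\<^bsub>H\<^esub> inv\<^bsub>H\<^esub> k (ini Y (cmp Y a b)))
     = k (ter Y a) \<otimes>\<^bsub>H\<^esub> \<phi>e a \<otimes>\<^bsub>H\<^esub> inv\<^bsub>H\<^esub> k (ini Y a) \<otimes>\<^bsub>H\<^esub> (k (ter Y b) \<otimes>\<^bsub>H\<^esub> \<phi>e b \<otimes>\<^bsub>H\<^esub> inv\<^bsub>H\<^esub> k (ini Y b))"
    using c by (simp add: w)
qed (rule group_morphismD(1)[OF m])

text \<open>\<theta> maps a left coset of the image of \<open>\<phi> \<sigma>\<close> to a left
  coset of the image of \<open>\<psi> \<sigma>\<close> conjugated by \<open>k \<sigma>\<close>.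
  Multiplication by \<open>k \<sigma>\<close> on the right turns this into a left coset of the image
  of \<open>\<psi> \<sigma>\<close> itself.\<close>

lemma scwol_iso_development_conjugate:
  fixes \<Gamma> :: "'h monoid" and H :: "'i monoid"
  assumes Y: "complex_of_groups Y G"
    and m: "group_morphism Y G \<Gamma> \<phi> \<phi>e" and m': "group_morphism Y G H \<psi> \<psi>e"
    and \<theta>: "\<theta> \<in> iso \<Gamma> H" and k: "\<And>\<sigma>. \<sigma> \<in> verts Y \<Longrightarrow> k \<sigma> \<in> carrier H"
    and loc: "\<And>\<sigma> g. \<lbrakk>\<sigma> \<in> verts Y; g \<in> carrier (lgrp G \<sigma>)\<rbrakk> \<Longrightarrow> \<theta> (\<phi> \<sigma> g) = Ad H (k \<sigma>) (\<psi> \<sigma> g)"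
    and edge: "\<And>a. a \<in> edges Y \<Longrightarrow> \<theta> (\<phi>e a) = k (ter Y a) \<otimes>\<^bsub>H\<^esub> \<psi>e a \<otimes>\<^bsub>H\<^esub> inv\<^bsub>H\<^esub> k (ini Y a)"
  shows "scwol_iso (development Y G \<Gamma> \<phi> \<phi>e) (development Y G H \<psi> \<psi>e)
    (\<lambda>(A, \<sigma>). (\<theta> ` A #>\<^bsub>H\<^esub> k \<sigma>, \<sigma>)) (\<lambda>(A, a). (\<theta> ` A #>\<^bsub>H\<^esub> k (ini Y a), a))"
proof -
  interpret M: morphism_to_group Y G \<Gamma> \<phi> \<phi>e by unfold_locales fact+
  interpret N: morphism_to_group Y G H \<psi> \<psi>e by unfold_locales fact+
  interpret \<theta>: group_hom \<Gamma> H \<theta> by unfold_locales (use \<theta> in \<open>simp add: iso_def\<close>)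
  have bij: "bij_betw \<theta> (carrier \<Gamma>) (carrier H)" using \<theta> by (simp add: iso_def)
  have move: "\<theta> (g \<otimes>\<^bsub>\<Gamma>\<^esub> \<phi> \<sigma> x) \<otimes>\<^bsub>H\<^esub> k \<sigma> = \<theta> g \<otimes>\<^bsub>H\<^esub> k \<sigma> \<otimes>\<^bsub>H\<^esub> \<psi> \<sigma> x"
    if "g \<in> carrier \<Gamma>" "\<sigma> \<in> verts Y" "x \<in> carrier (lgrp G \<sigma>)" for g \<sigma> x
    using that k[OF that(2)] by (simp add: loc Ad_def N.\<Gamma>.m_assoc)
  have image: "\<theta> ` M.coset g \<sigma> #>\<^bsub>H\<^esub> k \<sigma> = N.coset (\<theta> g \<otimes>\<^bsub>H\<^esub> k \<sigma>) \<sigma>" if "g \<in> carrier \<Gamma>" "\<sigma> \<in> verts Y" for g \<sigma>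
  proof -
    have "\<theta> ` M.coset g \<sigma> #>\<^bsub>H\<^esub> k \<sigma> = (\<lambda>x. \<theta> (g \<otimes>\<^bsub>\<Gamma>\<^esub> \<phi> \<sigma> x) \<otimes>\<^bsub>H\<^esub> k \<sigma>) ` carrier (lgrp G \<sigma>)"
      by (auto simp: r_coset_def M.coset_def M.K_def l_coset_def)
    also have "\<dots> = (\<lambda>x. \<theta> g \<otimes>\<^bsub>H\<^esub> k \<sigma> \<otimes>\<^bsub>H\<^esub> \<psi> \<sigma> x) ` carrier (lgrp G \<sigma>)"
      by (rule image_cong) (use that move in auto)
    also have "\<dots> = N.coset (\<theta> g \<otimes>\<^bsub>H\<^esub> k \<sigma>) \<sigma>"
      by (auto simp: N.coset_def N.K_def l_coset_def)
    finally show ?thesis .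
  qed
  have inj: "M.coset g \<sigma> = M.coset h \<sigma>"
    if eq: "N.coset (\<theta> g \<otimes>\<^bsub>H\<^esub> k \<sigma>) \<sigma> = N.coset (\<theta> h \<otimes>\<^bsub>H\<^esub> k \<sigma>) \<sigma>" and gh: "g \<in> carrier \<Gamma>" "h \<in> carrier \<Gamma>" and s: "\<sigma> \<in> verts Y" for g h \<sigma>
  proof -
    obtain x where x: "x \<in> carrier (lgrp G \<sigma>)" "\<theta> h \<otimes>\<^bsub>H\<^esub> k \<sigma> = \<theta> g \<otimes>\<^bsub>H\<^esub> k \<sigma> \<otimes>\<^bsub>H\<^esub> \<psi> \<sigma> x"
      using N.coset_eqD[OF eq _ s] gh k[OF s] by (auto simp: N.K_def)
    then have "\<theta> h \<otimes>\<^bsub>H\<^esub> k \<sigma> = \<theta> (g \<otimes>\<^bsub>\<Gamma>\<^esub> \<phi> \<sigma> x) \<otimes>\<^bsub>H\<^esub> k \<sigma>" using move gh s by simp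
    then have "\<theta> h = \<theta> (g \<otimes>\<^bsub>\<Gamma>\<^esub> \<phi> \<sigma> x)" using k[OF s] gh s x by (simp del: \<theta>.hom_mult)
    then have "h = g \<otimes>\<^bsub>\<Gamma>\<^esub> \<phi> \<sigma> x"
      using bij gh s x M.loc_image by (metis M.\<Gamma>.m_closed bij_betw_def inj_onD)
    then show ?thesis using M.coset_mult_K[OF gh(1) s, of "\<phi> \<sigma> x"] x by (simp add: M.K_def)
  qed
  have surj: "\<exists>g\<in>carrier \<Gamma>. h = \<theta> g \<otimes>\<^bsub>H\<^esub> k \<sigma>" if "h \<in> carrier H" "\<sigma> \<in> verts Y" for h \<sigma>
  proof -
    have "h \<otimes>\<^bsub>H\<^esub> inv\<^bsub>H\<^esub> k \<sigma> \<in> \<theta> ` carrier \<Gamma>" using that k bij by (simp add: bij_betw_def)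
    then obtain g where "g \<in> carrier \<Gamma>" "h \<otimes>\<^bsub>H\<^esub> inv\<^bsub>H\<^esub> k \<sigma> = \<theta> g" by blast
    then show ?thesis using that k by (metis N.\<Gamma>.inv_solve_right' N.\<Gamma>.inv_closed \<theta>.hom_closed)
  qed
  have vD: "(N.coset (\<theta> g \<otimes>\<^bsub>H\<^esub> k \<sigma>) \<sigma>, \<sigma>) \<in> verts N.D" if "g \<in> carrier \<Gamma>" "\<sigma> \<in> verts Y" for g \<sigma>
    by (rule N.vert_D) (use that k in simp_all)
  have eD: "(N.coset (\<theta> g \<otimes>\<^bsub>H\<^esub> k (ini Y a)) (ini Y a), a) \<in> edges N.D" if "g \<in> carrier \<Gamma>" "a \<in> edges Y" for g a
    by (rule N.edge_D) (use that k M.scw(1) in simp_all)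
  let ?fv = "\<lambda>(A, \<sigma>). (\<theta> ` A #>\<^bsub>H\<^esub> k \<sigma>, \<sigma>)" and ?fe = "\<lambda>(A, a). (\<theta> ` A #>\<^bsub>H\<^esub> k (ini Y a), a)"
  have "scwol_iso M.D N.D ?fv ?fe"
  proof (rule scwol_isoI[OF M.scwol_D])
    show "bij_betw ?fv (verts M.D) (verts N.D)"
      unfolding bij_betw_def
    proof (intro conjI inj_onI equalityI subsetI)
      fix x y assume "x \<in> verts M.D" "y \<in> verts M.D" and eq: "?fv x = ?fv y"
      then obtain g \<sigma> h \<tau> where x: "x = (M.coset g \<sigma>, \<sigma>)" "g \<in> carrier \<Gamma>" "\<sigma> \<in> verts Y"
        and y: "y = (M.coset h \<tau>, \<tau>)" "h \<in> carrier \<Gamma>" "\<tau> \<in> verts Y"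
        by (auto simp: M.verts_D)
      with eq have st: "\<sigma> = \<tau>" and nc: "N.coset (\<theta> g \<otimes>\<^bsub>H\<^esub> k \<sigma>) \<sigma> = N.coset (\<theta> h \<otimes>\<^bsub>H\<^esub> k \<sigma>) \<sigma>"
        by (auto simp: image)
      have "M.coset g \<sigma> = M.coset h \<sigma>" by (rule inj[OF nc x(2) y(2) x(3)])
      then show "x = y" by (simp only: x(1) y(1) st)
    next
      fix y assume "y \<in> verts N.D"
      then obtain h \<sigma> where y: "y = (N.coset h \<sigma>, \<sigma>)" "h \<in> carrier H" "\<sigma> \<in> verts Y" by (auto simp: N.verts_D)
      then obtain g where g: "g \<in> carrier \<Gamma>" "h = \<theta> g \<otimes>\<^bsub>H\<^esub> k \<sigma>" using surj by blast
      then have "y = ?fv (M.coset g \<sigma>, \<sigma>)" using y image by simp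
      then show "y \<in> ?fv ` verts M.D" using M.vert_D[OF g(1) y(3)] by blast
    qed (auto simp: M.verts_D image vD)
    show "bij_betw ?fe (edges M.D) (edges N.D)"
      unfolding bij_betw_def
    proof (intro conjI inj_onI equalityI subsetI)
      fix x y assume "x \<in> edges M.D" "y \<in> edges M.D" and eq: "?fe x = ?fe y"
      then obtain g a h b where x: "x = (M.coset g (ini Y a), a)" "g \<in> carrier \<Gamma>" "a \<in> edges Y"
        and y: "y = (M.coset h (ini Y b), b)" "h \<in> carrier \<Gamma>" "b \<in> edges Y"
        by (auto simp: M.edges_D)
      with eq M.scw(1) have ab: "a = b" and
        nc: "N.coset (\<theta> g \<otimes>\<^bsub>H\<^esub> k (ini Y a)) (ini Y a) = N.coset (\<theta> h \<otimes>\<^bsub>H\<^esub> k (ini Y a)) (ini Y a)"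
        by (auto simp: image)
      have "M.coset g (ini Y a) = M.coset h (ini Y a)"
        by (rule inj[OF nc x(2) y(2)]) (use x(3) M.scw(1) in simp)
      then show "x = y" by (simp only: x(1) y(1) ab)
    next
      fix y assume "y \<in> edges N.D"
      then obtain h a where y: "y = (N.coset h (ini Y a), a)" "h \<in> carrier H" "a \<in> edges Y" by (auto simp: N.edges_D)
      then obtain g where g: "g \<in> carrier \<Gamma>" "h = \<theta> g \<otimes>\<^bsub>H\<^esub> k (ini Y a)" using surj M.scw(1) by blast
      then have "y = ?fe (M.coset g (ini Y a), a)" using y image M.scw(1) by simp
      then show "y \<in> ?fe ` edges M.D" using M.edge_D[OF g(1) y(3)] by blast
    qed (auto simp: M.edges_D image eD M.scw(1))
    show "nondeg_functor M.D N.D ?fv ?fe"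
      unfolding nondeg_functor_def
    proof (intro conjI ballI)
      show "?fv \<in> verts M.D \<rightarrow> verts N.D" by (auto simp: M.verts_D image vD)
      show "?fe \<in> edges M.D \<rightarrow> edges N.D" by (auto simp: M.edges_D image eD M.scw(1))
    next
      fix p assume "p \<in> edges M.D"
      then obtain g a where p: "p = (M.coset g (ini Y a), a)" "g \<in> carrier \<Gamma>" "a \<in> edges Y" by (auto simp: M.edges_D)
      note v = M.scw(1)[OF p(3)]
      have ki: "k (ini Y a) \<in> carrier H" "k (ter Y a) \<in> carrier H" using k v by auto
      show "ini N.D (?fe p) = ?fv (ini M.D p)" using p by simp
      \<comment> \<open>The inverse of \<open>\<theta> (\<phi>e a)\<close> ends in the inverse of
        \<open>k (ter Y a)\<close>, which the right translation at the target cancels.\<close>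
      have "\<theta> (g \<otimes>\<^bsub>\<Gamma>\<^esub> inv\<^bsub>\<Gamma>\<^esub> \<phi>e a) \<otimes>\<^bsub>H\<^esub> k (ter Y a) = \<theta> g \<otimes>\<^bsub>H\<^esub> k (ini Y a) \<otimes>\<^bsub>H\<^esub> inv\<^bsub>H\<^esub> \<psi>e a"
        using p ki by (simp add: edge N.\<Gamma>.inv_mult_group N.\<Gamma>.m_assoc)
      then show "ter N.D (?fe p) = ?fv (ter M.D p)" using p v ki by (simp add: image)
    next
      fix w assume "w \<in> composable2 M.D"
      then obtain g a h b where "w = ((M.coset g (ini Y a), a), (M.coset h (ini Y b), b))"
        "g \<in> carrier \<Gamma>" "a \<in> edges Y" "h \<in> carrier \<Gamma>" "b \<in> edges Y" "ini Y a = ter Y b"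
        by (auto simp: composable2_def M.edges_D)
      then show "case w of (p, q) \<Rightarrow> ?fe (cmp M.D p q) = cmp N.D (?fe p) (?fe q)"
        using M.scw(2)[of a b] by simp
    qed
  qed
  then show ?thesis by (simp add: M.D_def N.D_def)
qed

section \<open>The development of the local complex of groups\<close>

fun local_dev_vert :: "'g set \<times> ('e, 'e) jvert \<Rightarrow> ('g set \<times> 'e, 'e) jvert" where
  "local_dev_vert (A, Up c) = Up (A, c)"
| "local_dev_vert (A, Apex) = Apex"
| "local_dev_vert (A, Low b) = Low b"

fun local_dev_edge :: "'g set \<times> ('e, 'e \<times> 'e, 'e, 'e \<times> 'e) jedge \<Rightarrow>
    ('g set \<times> 'e, 'g set \<times> 'e \<times> 'e, 'e, 'e \<times> 'e) jedge" where
  "local_dev_edge (A, UpE (c, d)) = UpE (A, c, d)"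
| "local_dev_edge (A, LowE f) = LowE f"
| "local_dev_edge (A, ApexUp c) = ApexUp (A, c)"
| "local_dev_edge (A, LowUp b c) = LowUp b (A, c)"
| "local_dev_edge (A, LowApex b) = LowApex b"

context local_complex begin

sublocale N: morphism_to_group LS LG G\<gamma> "local_map G" "local_element G \<gamma>"
  by unfold_locales (rule complex_of_groups_local group_morphism_local)+

lemma K_local: "N.K (Up c) = lhom G c ` carrier (lgrp G (ini Y c))" "N.K Apex = carrier G\<gamma>" "N.K (Low b) = carrier G\<gamma>"
  by (auto simp: N.K_def)

lemma coset_local [simp]:
  assumes "g \<in> carrier G\<gamma>"
  shows "N.coset g Apex = carrier G\<gamma>" "N.coset g (Low b) = carrier G\<gamma>"
proof -
  have "g <#\<^bsub>G\<gamma>\<^esub> carrier G\<gamma> = carrier G\<gamma>"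
    by (rule G.coset_join3[OF assms G.subgroup_self assms])
  then show "N.coset g Apex = carrier G\<gamma>" "N.coset g (Low b) = carrier G\<gamma>"
    by (simp_all add: N.coset_def K_local)
qed

lemma coset_Up: "N.coset g (Up c) = g <#\<^bsub>G\<gamma>\<^esub> (lhom G c ` carrier (lgrp G (ini Y c)))"
  by (simp add: N.coset_def K_local)

abbreviation "LD \<equiv> local_development Y G \<gamma>"

lemma verts_upper_link_dev: "verts (upper_link_dev Y G \<gamma>) =
    {(N.coset g (Up c), c) |g c. g \<in> carrier G\<gamma> \<and> c \<in> edges Y \<and> ter Y c = \<gamma>}"
  by (simp add: upper_link_dev_def coset_Up)

lemma edges_upper_link_dev: "edges (upper_link_dev Y G \<gamma>) =
    {(N.coset g (Up (cmp Y c d)), c, d) |g c d. g \<in> carrier G\<gamma> \<and> c \<in> edges Y \<and> d \<in> edges Y \<and> ini Y c = ter Y d \<and> ter Y c = \<gamma>}"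
  using S(2) by (force simp: upper_link_dev_def coset_Up composable2_def)

lemma verts_N_cases:
  assumes "p \<in> verts N.D"
  obtains g c where "p = (N.coset g (Up c), Up c)" "g \<in> carrier G\<gamma>" "c \<in> edges Y" "ter Y c = \<gamma>"
  | "p = (carrier G\<gamma>, Apex)"
  | b where "p = (carrier G\<gamma>, Low b)" "b \<in> edges Y" "ini Y b = \<gamma>"
proof -
  obtain g v where p: "p = (N.coset g v, v)" "g \<in> carrier G\<gamma>" "v \<in> verts LS" using assms by (auto simp: N.verts_D)
  then show ?thesis using that by (cases v) (auto simp: vert_local)
qed

lemma edges_N_cases:
  assumes "p \<in> edges N.D"
  obtains g c d where "p = (N.coset g (Up (cmp Y c d)), UpE (c, d))" "g \<in> carrier G\<gamma>" "c \<in> edges Y" "d \<in> edges Y"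
      "ini Y c = ter Y d" "ter Y c = \<gamma>"
  | a b where "p = (carrier G\<gamma>, LowE (a, b))" "a \<in> edges Y" "b \<in> edges Y" "ini Y a = ter Y b" "ini Y b = \<gamma>"
  | g c where "p = (N.coset g (Up c), ApexUp c)" "g \<in> carrier G\<gamma>" "c \<in> edges Y" "ter Y c = \<gamma>"
  | g b c where "p = (N.coset g (Up c), LowUp b c)" "g \<in> carrier G\<gamma>" "c \<in> edges Y" "ter Y c = \<gamma>" "b \<in> edges Y" "ini Y b = \<gamma>"
  | b where "p = (carrier G\<gamma>, LowApex b)" "b \<in> edges Y" "ini Y b = \<gamma>"
proof -
  obtain g q where p: "p = (N.coset g (ini LS q), q)" "g \<in> carrier G\<gamma>" "q \<in> edges LS" using assms by (auto simp: N.edges_D)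
  then show ?thesis using that by (cases q rule: local_edge_cases) (auto simp: edge_local)
qed

lemma verts_LD: "v \<in> verts LD \<longleftrightarrow> (case v of Up x \<Rightarrow> x \<in> verts (upper_link_dev Y G \<gamma>) | Apex \<Rightarrow> True
    | Low b \<Rightarrow> b \<in> edges Y \<and> ini Y b = \<gamma>)"
  by (cases v) (auto simp: local_development_def link_join_def lower_link_def)

lemma edges_LD: "p \<in> edges LD \<longleftrightarrow> (case p of
      UpE e \<Rightarrow> e \<in> edges (upper_link_dev Y G \<gamma>)
    | LowE f \<Rightarrow> (case f of (a, b) \<Rightarrow> a \<in> edges Y \<and> b \<in> edges Y \<and> ini Y a = ter Y b \<and> ini Y b = \<gamma>)
    | ApexUp x \<Rightarrow> x \<in> verts (upper_link_dev Y G \<gamma>)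
    | LowUp b x \<Rightarrow> b \<in> edges Y \<and> ini Y b = \<gamma> \<and> x \<in> verts (upper_link_dev Y G \<gamma>)
    | LowApex b \<Rightarrow> b \<in> edges Y \<and> ini Y b = \<gamma>)"
  by (cases p) (auto simp: local_development_def link_join_def lower_link_def composable2_def)

lemma link_LD [simp]:
  "ini LD (UpE (A, c, d)) = Up (A, cmp Y c d)"
  "ini LD (LowE (a, b)) = Low b" "ter LD (LowE (a, b)) = Low (cmp Y a b)"
  "ini LD (ApexUp x) = Up x" "ter LD (ApexUp x) = Apex"
  "ini LD (LowUp b x) = Up x" "ter LD (LowUp b x) = Low b"
  "ini LD (LowApex b) = Apex" "ter LD (LowApex b) = Low b"
  "cmp LD (UpE (A, c, d)) (UpE (B, c', d')) = UpE (B, c, cmp Y d d')"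
  "cmp LD (LowE (a, b)) (LowE (a', b')) = LowE (cmp Y a a', b')"
  "cmp LD (ApexUp x) (UpE (A, c, d)) = ApexUp (A, cmp Y c d)"
  "cmp LD (LowUp b x) (UpE (A, c, d)) = LowUp b (A, cmp Y c d)"
  "cmp LD (LowE (a, b)) (LowUp b' x) = LowUp (cmp Y a b) x"
  "cmp LD (LowApex b) (ApexUp x) = LowUp b x"
  "cmp LD (LowE (a, b)) (LowApex b') = LowApex (cmp Y a b)"
  by (simp_all add: local_development_def link_join_def upper_link_dev_def lower_link_def)

text \<open>Both targets are the same set product of \<open>A\<close> with a coset; no
  representative has to be chosen.\<close>

lemma ter_LD_UpE: "ter LD (UpE (A, c, d)) = local_dev_vert (ter N.D (A, UpE (c, d)))"
  unfolding N.D_def development_def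
  by (simp add: local_development_def link_join_def upper_link_dev_def)

lemma ter_N: "ter N.D (A, p) = (fst (ter N.D (A, p)), ter LS p)"
  by (simp add: N.D_def development_def)

lemma scwol_iso_local_development: "scwol_iso N.D LD local_dev_vert local_dev_edge"
proof (rule scwol_isoI[OF N.scwol_D])
  have v: "local_dev_vert p \<in> verts LD" if "p \<in> verts N.D" for p
    using that by (cases rule: verts_N_cases) (auto simp: verts_LD verts_upper_link_dev)
  have e: "local_dev_edge p \<in> edges LD" if "p \<in> edges N.D" for p
    using that by (cases rule: edges_N_cases) (auto simp: edges_LD verts_upper_link_dev edges_upper_link_dev)
  show "nondeg_functor N.D LD local_dev_vert local_dev_edge"
    unfolding nondeg_functor_def
  proof (intro conjI ballI)
    fix p assume "p \<in> edges N.D"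
    then show "ini LD (local_dev_edge p) = local_dev_vert (ini N.D p)"
      by (cases rule: edges_N_cases) auto
    obtain A q where p: "p = (A, q)" by (cases p)
    show "ter LD (local_dev_edge p) = local_dev_vert (ter N.D p)"
      unfolding p by (cases q rule: local_edge_cases) (simp add: ter_LD_UpE, (subst ter_N, simp)+)
  next
    fix w assume "w \<in> composable2 N.D"
    then obtain A p B q where w: "w = ((A, p), (B, q))" and "ini N.D (A, p) = ter N.D (B, q)"
      by (auto simp: composable2_def)
    moreover have "snd (ter N.D (B, q)) = ter LS q" by (subst ter_N) simp
    ultimately have "ini LS p = ter LS q" by (metis N.ini_D snd_conv)
    then show "case w of (p, q) \<Rightarrow> local_dev_edge (cmp N.D p q) = cmp LD (local_dev_edge p) (local_dev_edge q)"
      unfolding w by (cases p rule: local_edge_cases; cases q rule: local_edge_cases) auto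
  qed (use v e in auto)
  show "bij_betw local_dev_vert (verts N.D) (verts LD)"
    unfolding bij_betw_def
  proof (intro conjI inj_onI equalityI subsetI)
    fix p q assume "p \<in> verts N.D" "q \<in> verts N.D" "local_dev_vert p = local_dev_vert q"
    then show "p = q" by (elim verts_N_cases) simp_all
  next
    fix x assume x: "x \<in> verts LD"
    show "x \<in> local_dev_vert ` verts N.D"
    proof (cases x)
      case (Up y)
      then obtain g c where "y = (N.coset g (Up c), c)" "g \<in> carrier G\<gamma>" "c \<in> edges Y" "ter Y c = \<gamma>"
        using x by (auto simp: verts_LD verts_upper_link_dev)
      then show ?thesis using Up N.vert_D[of g "Up c"]
        by (intro image_eqI[of _ _ "(N.coset g (Up c), Up c)"]) (auto simp: vert_local)
    next
      case Apex
      then show ?thesis using N.vert_D[OF G.one_closed, of Apex]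
        by (intro image_eqI[of _ _ "(carrier G\<gamma>, Apex)"]) (auto simp: vert_local)
    next
      case (Low b)
      then show ?thesis using x N.vert_D[OF G.one_closed, of "Low b"]
        by (intro image_eqI[of _ _ "(carrier G\<gamma>, Low b)"]) (auto simp: vert_local verts_LD)
    qed
  qed (use v in auto)
  show "bij_betw local_dev_edge (edges N.D) (edges LD)"
    unfolding bij_betw_def
  proof (intro conjI inj_onI equalityI subsetI)
    fix p q assume "p \<in> edges N.D" "q \<in> edges N.D" "local_dev_edge p = local_dev_edge q"
    then show "p = q" by (elim edges_N_cases) simp_all
  next
    fix x assume x: "x \<in> edges LD"
    have mem: "(N.coset g (ini LS p), p) \<in> edges N.D" if "p \<in> edges LS" "g \<in> carrier G\<gamma>" for p g
      using N.edge_D[OF that(2,1)] .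
    show "x \<in> local_dev_edge ` edges N.D"
    proof (cases x)
      case (UpE y)
      then obtain g c d where y: "y = (N.coset g (Up (cmp Y c d)), c, d)" "g \<in> carrier G\<gamma>"
        "c \<in> edges Y" "d \<in> edges Y" "ini Y c = ter Y d" "ter Y c = \<gamma>"
        using x by (auto simp: edges_LD edges_upper_link_dev)
      then show ?thesis using UpE mem[of "UpE (c, d)" g]
        by (intro image_eqI[of _ _ "(N.coset g (Up (cmp Y c d)), UpE (c, d))"]) (auto simp: edge_local)
    next
      case (LowE f)
      then obtain a b where "f = (a, b)" "a \<in> edges Y" "b \<in> edges Y" "ini Y a = ter Y b" "ini Y b = \<gamma>"
        using x by (auto simp: edges_LD split: prod.splits)
      then show ?thesis using LowE mem[OF _ G.one_closed, of "LowE (a, b)"]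
        by (intro image_eqI[of _ _ "(carrier G\<gamma>, LowE (a, b))"]) (auto simp: edge_local)
    next
      case (ApexUp y)
      then obtain g c where "y = (N.coset g (Up c), c)" "g \<in> carrier G\<gamma>" "c \<in> edges Y" "ter Y c = \<gamma>"
        using x by (auto simp: edges_LD verts_upper_link_dev)
      then show ?thesis using ApexUp mem[of "ApexUp c" g]
        by (intro image_eqI[of _ _ "(N.coset g (Up c), ApexUp c)"]) (auto simp: edge_local)
    next
      case (LowUp b y)
      then obtain g c where "y = (N.coset g (Up c), c)" "g \<in> carrier G\<gamma>" "c \<in> edges Y" "ter Y c = \<gamma>"
        "b \<in> edges Y" "ini Y b = \<gamma>"
        using x by (auto simp: edges_LD verts_upper_link_dev)
      then show ?thesis using LowUp mem[of "LowUp b c" g]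
        by (intro image_eqI[of _ _ "(N.coset g (Up c), LowUp b c)"]) (auto simp: edge_local)
    next
      case (LowApex b)
      then show ?thesis using x mem[OF _ G.one_closed, of "LowApex b"]
        by (intro image_eqI[of _ _ "(carrier G\<gamma>, LowApex b)"]) (auto simp: edge_local edges_LD)
    qed
  qed (use e in auto)
qed

end

section \<open>The fundamental group for an arbitrary maximal tree\<close>

locale local_complex_tree = local_complex Y G \<gamma>
  for Y :: "('v, 'e) scwol_data" and G :: "('v, 'e, 'g) cog_data" and \<gamma> :: 'v +
  fixes W :: "('e, 'e) jvert set" and T :: "('e, 'e \<times> 'e, 'e, 'e \<times> 'e) jedge set"
  assumes tree: "maximal_tree LS W T"
begin

lemma tree_in: "tree_in LS W T"
  using tree by (simp add: maximal_tree_def)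

lemma spanning: "W = verts LS"
proof (rule maximal_tree_spanning[OF tree, of Apex])
  fix v assume v: "v \<in> verts LS" "v \<noteq> Apex"
  then show "\<exists>e\<in>edges LS. ini LS e = v \<and> ter LS e = Apex \<or> ini LS e = Apex \<and> ter LS e = v"
  proof (cases v)
    case (Up c)
    then show ?thesis using v by (intro bexI[of _ "ApexUp c"]) (auto simp: vert_local edge_local)
  next
    case (Low b)
    then show ?thesis using v by (intro bexI[of _ "LowApex b"]) (auto simp: vert_local edge_local)
  qed simp
qed (simp add: vert_local)

sublocale F: fundamental_group LS LG T
  by unfold_locales (use complex_of_groups_local tree_inD(3)[OF tree_in] in auto)

abbreviation "\<P> \<equiv> pi1 LS LG T"
abbreviation "\<iota> \<equiv> iota_grp LS LG T"
abbreviation "\<iota>e \<equiv> iota_edge LS LG T"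

sublocale M: morphism_to_group LS LG \<P> \<iota> \<iota>e
  by unfold_locales (rule complex_of_groups_local F.group_morphism_iota)+

lemmas iota = group_morphismD[OF F.group_morphism_iota]

sublocale A: group_hom G\<gamma> \<P> "\<iota> Apex"
  by unfold_locales (use iota(2)[of Apex] in \<open>simp add: vert_local\<close>)

text \<open>The class of the step from \<open>v\<close> to \<open>Apex\<close>;
  \<open>LowApex b\<close> points away from \<open>Apex\<close>, hence the inverse. Conjugation by
  these elements expresses \<iota> at any vertex through \<iota> at \<open>Apex\<close>.\<close>

fun to_apex :: "('e, 'e) jvert \<Rightarrow> (('e, 'e) jvert, ('e, 'e \<times> 'e, 'e, 'e \<times> 'e) jedge, 'g) pi1_elem" where
  "to_apex (Up c) = \<iota>e (ApexUp c)"
| "to_apex Apex = \<one>\<^bsub>\<P>\<^esub>"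
| "to_apex (Low b) = inv\<^bsub>\<P>\<^esub> \<iota>e (LowApex b)"

lemma to_apex_closed: "v \<in> verts LS \<Longrightarrow> to_apex v \<in> carrier \<P>"
  using iota(3) by (cases v) (auto simp: vert_local edge_local)

lemma iota_low_one: "b \<in> edges Y \<Longrightarrow> ini Y b = \<gamma> \<Longrightarrow> \<iota> (Low b) \<one>\<^bsub>G\<gamma>\<^esub> = \<one>\<^bsub>\<P>\<^esub>"
  using iota(2)[of "Low b"] hom_one[OF _ G.group_axioms M.\<Gamma>.group_axioms] by (simp add: vert_local)

text \<open>The product relations of \<open>p\<close> with the edges at \<open>Apex\<close> give
  this. For \<open>p = UpE (c, d)\<close> the pair is \<open>ApexUp c\<close> and \<open>p\<close>,
  whose twisting element \<open>twist G c d\<close> is the value of \<open>local_element\<close>;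
  the other pairs that occur have trivial twisting elements.\<close>

lemma iota_edge_to_apex:
  assumes p: "p \<in> edges LS"
  shows "to_apex (ter LS p) \<otimes>\<^bsub>\<P>\<^esub> \<iota>e p = \<iota> Apex (local_element G \<gamma> p) \<otimes>\<^bsub>\<P>\<^esub> to_apex (ini LS p)"
proof (cases p rule: local_edge_cases)
  case (1 c d)
  then have "ApexUp c \<in> edges LS" using p by (simp add: edge_local)
  then show ?thesis using iota(5)[OF _ p, of "ApexUp c"] 1 by simp
next
  case (2 a b)
  then have b: "LowApex b \<in> edges LS" "LowApex (cmp Y a b) \<in> edges LS" using p S(2)[of a b] by (auto simp: edge_local)
  have "\<iota>e (LowApex (cmp Y a b)) = \<iota>e p \<otimes>\<^bsub>\<P>\<^esub> \<iota>e (LowApex b)"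
    using iota(5)[OF p b(1)] 2 iota_low_one[of "cmp Y a b"] b iota(3)[OF b(2)] by (simp add: edge_local)
  then show ?thesis
    using 2 iota(3)[OF p] iota(3)[OF b(1)] by (simp add: M.\<Gamma>.inv_mult_group M.\<Gamma>.m_assoc)
next
  case (3 c)
  then show ?thesis using iota(3)[OF p] by simp
next
  case (4 b c)
  then have b: "LowApex b \<in> edges LS" "ApexUp c \<in> edges LS" using p by (auto simp: edge_local)
  have "\<iota>e p = \<iota>e (LowApex b) \<otimes>\<^bsub>\<P>\<^esub> \<iota>e (ApexUp c)"
    using iota(5)[OF b] 4 iota_low_one[of b] b iota(3)[OF p] by (simp add: edge_local)
  then show ?thesis using 4 iota(3)[OF b(1)] iota(3)[OF b(2)] by (simp flip: M.\<Gamma>.m_assoc)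
next
  case (5 b)
  then show ?thesis using iota(3)[OF p] by simp
qed

text \<open>This is the conjugation relation of the edge between \<open>v\<close> and
  \<open>Apex\<close>, used directly for \<open>Up c\<close> and solved for the source for
  \<open>Low b\<close>.\<close>

lemma iota_grp_to_apex:
  assumes v: "v \<in> verts LS" and g: "g \<in> carrier (lgrp LG v)"
  shows "to_apex v \<otimes>\<^bsub>\<P>\<^esub> \<iota> v g = \<iota> Apex (local_map G v g) \<otimes>\<^bsub>\<P>\<^esub> to_apex v"
proof (cases v)
  case (Up c)
  then have c: "ApexUp c \<in> edges LS" using v by (simp add: edge_local vert_local)
  have Ad: "Ad \<P> (\<iota>e (ApexUp c)) (\<iota> (Up c) g) = \<iota> Apex (lhom G c g)"
    using iota(4)[OF c, of g] g Up by simp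
  then show ?thesis using Up iota(3)[OF c] iota(6)[OF v g] by (simp add: Ad_def M.\<Gamma>.m_assoc flip: Ad)
next
  case Apex
  then show ?thesis using iota(6)[OF v g] by simp
next
  case (Low b)
  then have b: "LowApex b \<in> edges LS" using v by (simp add: edge_local vert_local)
  have x: "\<iota> Apex g \<in> carrier \<P>" using g Low by simp
  have Ad: "Ad \<P> (\<iota>e (LowApex b)) (\<iota> Apex g) = \<iota> (Low b) g"
    using iota(4)[OF b, of g] g Low by simp
  have "inv\<^bsub>\<P>\<^esub> \<iota>e (LowApex b) \<otimes>\<^bsub>\<P>\<^esub> \<iota> (Low b) g
    = inv\<^bsub>\<P>\<^esub> \<iota>e (LowApex b) \<otimes>\<^bsub>\<P>\<^esub> \<iota>e (LowApex b) \<otimes>\<^bsub>\<P>\<^esub> \<iota> Apex g \<otimes>\<^bsub>\<P>\<^esub> inv\<^bsub>\<P>\<^esub> \<iota>e (LowApex b)"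
    using iota(3)[OF b] x by (simp add: Ad_def flip: Ad M.\<Gamma>.m_assoc)
  then show ?thesis using Low iota(3)[OF b] x by simp
qed

text \<open>The normalization of \<open>k\<close> at \<open>Apex\<close> makes \<theta> an exact
  left inverse of \<open>\<iota> Apex\<close>, not merely one up to conjugation. The elements
  \<open>k\<close> stay in the conclusion because the comparison of developments and the injectivity
  of \<iota> refer to them.\<close>

lemma pi1_iso_local:
  "\<exists>\<theta> k. \<theta> \<in> iso \<P> G\<gamma> \<and> (\<forall>v\<in>verts LS. k v \<in> carrier G\<gamma>) \<and>
     (\<forall>v\<in>verts LS. \<forall>g\<in>carrier (lgrp LG v). \<theta> (\<iota> v g) = Ad G\<gamma> (k v) (local_map G v g)) \<and>
     (\<forall>p\<in>edges LS. \<theta> (\<iota>e p) = k (ter LS p) \<otimes>\<^bsub>G\<gamma>\<^esub> local_element G \<gamma> p \<otimes>\<^bsub>G\<gamma>\<^esub> inv\<^bsub>G\<gamma>\<^esub> k (ini LS p))"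
proof -
  have le: "local_element G \<gamma> p \<in> carrier G\<gamma>" if "p \<in> edges LS" for p
    by (rule group_morphismD(3)[OF group_morphism_local that])
  have lm: "local_map G v g \<in> carrier G\<gamma>" if "v \<in> verts LS" "g \<in> carrier (lgrp LG v)" for v g
    by (rule group_morphismD(6)[OF group_morphism_local that])
  have TE: "a \<in> edges LS" if "a \<in> T" for a using that F.tree by blast
  have aW: "Apex \<in> W" by (simp add: spanning vert_local)
  obtain k where k: "k Apex = \<one>\<^bsub>G\<gamma>\<^esub>" "\<And>v. v \<in> verts LS \<Longrightarrow> k v \<in> carrier G\<gamma>"
    "\<And>a. a \<in> T \<Longrightarrow> k (ter LS a) \<otimes>\<^bsub>G\<gamma>\<^esub> local_element G \<gamma> a = k (ini LS a)"
    using tree_potential[OF tree_in aW G.group_axioms, of "local_element G \<gamma>"] le TE spanning by auto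
  let ?\<psi> = "\<lambda>v g. Ad G\<gamma> (k v) (local_map G v g)"
  let ?\<psi>e = "\<lambda>p. k (ter LS p) \<otimes>\<^bsub>G\<gamma>\<^esub> local_element G \<gamma> p \<otimes>\<^bsub>G\<gamma>\<^esub> inv\<^bsub>G\<gamma>\<^esub> k (ini LS p)"
  have ends: "ini LS a \<in> verts LS" "ter LS a \<in> verts LS" if "a \<in> edges LS" for a
    using scwolD(1)[OF scwol_local that] by auto
  have m: "group_morphism LS LG G\<gamma> ?\<psi> ?\<psi>e"
    by (rule group_morphism_conjugate[OF complex_of_groups_local group_morphism_local k(2)])
  have "?\<psi>e a = \<one>\<^bsub>G\<gamma>\<^esub>" if "a \<in> T" for a
    using k(2) ends[OF TE[OF that]] by (simp add: k(3)[OF that])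
  from F.pi1_lift[OF m this] obtain \<theta> where \<theta>: "\<theta> \<in> hom \<P> G\<gamma>"
    and \<theta>g: "\<And>v g. \<lbrakk>v \<in> verts LS; g \<in> carrier (lgrp LG v)\<rbrakk> \<Longrightarrow> \<theta> (\<iota> v g) = ?\<psi> v g"
    and \<theta>e: "\<And>p. p \<in> edges LS \<Longrightarrow> \<theta> (\<iota>e p) = ?\<psi>e p" by blast
  interpret \<theta>: group_hom \<P> G\<gamma> \<theta> by unfold_locales (rule \<theta>)
  \<comment> \<open>\<open>\<kappa>\<close> is constant along the tree, hence \<open>to_apex v\<close> is inverse to \<open>\<iota> Apex (k v)\<close>.\<close>
  define \<kappa> where "\<kappa> v = \<iota> Apex (k v) \<otimes>\<^bsub>\<P>\<^esub> to_apex v" for v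
  have \<kappa>_edge: "\<kappa> (ini LS a) = \<kappa> (ter LS a)" if a: "a \<in> T" for a
  proof -
    note e = TE[OF a] and v = ends[OF TE[OF a]]
    \<comment> \<open>Tree edges are trivial in the fundamental group, so
      \<open>iota_edge_to_apex\<close> compares \<open>to_apex\<close> at the two ends.\<close>
    have "to_apex (ter LS a) = \<iota> Apex (local_element G \<gamma> a) \<otimes>\<^bsub>\<P>\<^esub> to_apex (ini LS a)"
      using iota_edge_to_apex[OF e] F.iota_edge_tree[OF a] to_apex_closed[OF v(2)] by simp
    then have "\<kappa> (ter LS a) = \<iota> Apex (k (ter LS a) \<otimes>\<^bsub>G\<gamma>\<^esub> local_element G \<gamma> a) \<otimes>\<^bsub>\<P>\<^esub> to_apex (ini LS a)"
      using k(2)[OF v(2)] le[OF e] to_apex_closed[OF v(1)] by (simp add: \<kappa>_def M.\<Gamma>.m_assoc)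
    then show ?thesis by (simp add: k(3)[OF a] \<kappa>_def)
  qed
  have "\<kappa> v = \<kappa> w" if "edge_path LS T v p w" for v p w
    using that
  proof (induction p arbitrary: v)
    case (Cons u p)
    obtain a s where u: "u = (a, s)" by (cases u)
    have "\<kappa> (if s then ter LS a else ini LS a) = \<kappa> w" by (rule Cons.IH) (use Cons.prems u in simp)
    then show ?case using Cons.prems \<kappa>_edge[of a] u by (cases s) auto
  qed simp
  moreover have "\<kappa> Apex = \<one>\<^bsub>\<P>\<^esub>" by (simp add: \<kappa>_def k(1))
  ultimately have \<kappa>: "\<kappa> v = \<one>\<^bsub>\<P>\<^esub>" if "v \<in> verts LS" for v
    using tree_inD(5)[OF tree_in aW, of v] that spanning by metis
  have ta: "to_apex v = inv\<^bsub>\<P>\<^esub> \<iota> Apex (k v)" if "v \<in> verts LS" for v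
    using \<kappa>[OF that] k(2)[OF that] to_apex_closed[OF that] unfolding \<kappa>_def
    by (metis A.hom_closed M.\<Gamma>.inv_equality M.\<Gamma>.inv_inv M.\<Gamma>.inv_closed)
  have inverse: "\<iota> Apex (\<theta> x) = x" if x: "x \<in> carrier \<P>" for x
  proof -
    \<comment> \<open>It suffices to compare generators, and the composite multiplies each of them
      by some \<open>\<kappa> v\<close>, which is 1.\<close>
    have "(\<iota> Apex \<circ> \<theta>) x = id x"
    proof (rule F.hom_pi1_eqI[OF M.\<Gamma>.group_axioms _ _ _ _ x])
      show "\<iota> Apex \<circ> \<theta> \<in> hom \<P> \<P>" by (rule hom_compose[OF \<theta> A.homh])
      show "id \<in> hom \<P> \<P>" by (auto simp: hom_def)
    next
      fix v g assume v: "v \<in> verts LS" and g: "g \<in> carrier (lgrp LG v)"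
      note kv = A.hom_closed[OF k(2)[OF v]] and x = A.hom_closed[OF lm[OF v g]] and y = iota(6)[OF v g]
      have "\<iota> Apex (\<theta> (\<iota> v g)) = \<iota> Apex (k v) \<otimes>\<^bsub>\<P>\<^esub> (\<iota> Apex (local_map G v g) \<otimes>\<^bsub>\<P>\<^esub> to_apex v)"
        using k(2)[OF v] lm[OF v g] by (simp add: \<theta>g[OF v g] ta[OF v] Ad_def M.\<Gamma>.m_assoc)
      also have "\<dots> = \<kappa> v \<otimes>\<^bsub>\<P>\<^esub> \<iota> v g"
        using kv y to_apex_closed[OF v] by (simp add: \<kappa>_def M.\<Gamma>.m_assoc flip: iota_grp_to_apex[OF v g])
      finally show "(\<iota> Apex \<circ> \<theta>) (\<iota> v g) = id (\<iota> v g)" using \<kappa>[OF v] y by simp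
    next
      fix p assume p: "p \<in> edges LS"
      note v = ends[OF p] and y = iota(3)[OF p]
      note kt = A.hom_closed[OF k(2)[OF v(2)]]
      have "\<iota> Apex (\<theta> (\<iota>e p)) = \<iota> Apex (k (ter LS p)) \<otimes>\<^bsub>\<P>\<^esub> (\<iota> Apex (local_element G \<gamma> p) \<otimes>\<^bsub>\<P>\<^esub> to_apex (ini LS p))"
        using k(2)[OF v(1)] k(2)[OF v(2)] le[OF p] by (simp add: \<theta>e[OF p] ta[OF v(1)] M.\<Gamma>.m_assoc)
      also have "\<dots> = \<kappa> (ter LS p) \<otimes>\<^bsub>\<P>\<^esub> \<iota>e p"
        using kt y to_apex_closed[OF v(2)] by (simp add: \<kappa>_def M.\<Gamma>.m_assoc flip: iota_edge_to_apex[OF p])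
      finally show "(\<iota> Apex \<circ> \<theta>) (\<iota>e p) = id (\<iota>e p)" using \<kappa>[OF v(2)] y by simp
    qed
    then show ?thesis by simp
  qed
  have section_eq: "\<theta> (\<iota> Apex g) = g" if "g \<in> carrier G\<gamma>" for g
    using \<theta>g[of Apex g] that by (simp add: vert_local k(1))
  have "bij_betw \<theta> (carrier \<P>) (carrier G\<gamma>)"
    by (rule bij_betw_byWitness[of _ "\<iota> Apex"]) (auto simp: inverse section_eq)
  then have "\<theta> \<in> iso \<P> G\<gamma>" using \<theta> by (simp add: iso_def)
  then show ?thesis using k(2) \<theta>g \<theta>e by blast
qed

lemma developable_pi1_development_local:
  "developable LS LG \<and> \<P> \<cong> G\<gamma> \<and> scwol_isomorphic (development LS LG \<P> \<iota> \<iota>e) LD"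
proof -
  obtain \<theta> k where \<theta>: "\<theta> \<in> iso \<P> G\<gamma>" and k: "\<And>v. v \<in> verts LS \<Longrightarrow> k v \<in> carrier G\<gamma>"
    and loc: "\<And>v g. \<lbrakk>v \<in> verts LS; g \<in> carrier (lgrp LG v)\<rbrakk> \<Longrightarrow> \<theta> (\<iota> v g) = Ad G\<gamma> (k v) (local_map G v g)"
    and edge: "\<And>p. p \<in> edges LS \<Longrightarrow> \<theta> (\<iota>e p) = k (ter LS p) \<otimes>\<^bsub>G\<gamma>\<^esub> local_element G \<gamma> p \<otimes>\<^bsub>G\<gamma>\<^esub> inv\<^bsub>G\<gamma>\<^esub> k (ini LS p)"
    using pi1_iso_local by blast
  define fv where "fv = local_dev_vert \<circ> (\<lambda>(A, \<sigma>). (\<theta> ` A #>\<^bsub>G\<gamma>\<^esub> k \<sigma>, \<sigma>))"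
  have iso: "scwol_iso M.D LD fv
      (local_dev_edge \<circ> (\<lambda>(A, a). (\<theta> ` A #>\<^bsub>G\<gamma>\<^esub> k (ini LS a), a)))"
    unfolding fv_def
  proof (rule scwol_iso_trans[OF _ scwol_iso_local_development])
    show "scwol_iso M.D N.D (\<lambda>(A, \<sigma>). (\<theta> ` A #>\<^bsub>G\<gamma>\<^esub> k \<sigma>, \<sigma>)) (\<lambda>(A, a). (\<theta> ` A #>\<^bsub>G\<gamma>\<^esub> k (ini LS a), a))"
      unfolding M.D_def N.D_def
      by (rule scwol_iso_development_conjugate[OF complex_of_groups_local F.group_morphism_iota group_morphism_local \<theta> k loc edge])
  qed
  have "scwol LD" using iso by (simp add: scwol_iso_def)
  then have "cone LD Apex" unfolding local_development_def by (rule cone_link_join)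
  \<comment> \<open>The cone structure is pulled back along \<open>fv\<close>, which forgets the
    coset at \<open>Apex\<close>.\<close>
  moreover have "(M.coset \<one>\<^bsub>\<P>\<^esub> Apex, Apex) \<in> verts M.D" by (rule M.vert_D) (simp_all add: vert_local)
  moreover have "fv (M.coset \<one>\<^bsub>\<P>\<^esub> Apex, Apex) = Apex" by (simp add: fv_def)
  ultimately have "cone M.D (M.coset \<one>\<^bsub>\<P>\<^esub> Apex, Apex)" using cone_scwol_iso[OF iso] by metis
  then have sc: "simply_connected_scwol M.D" by (rule cone.simply_connected)
  \<comment> \<open>\<theta> after \<open>\<iota> v\<close> is a conjugate of the injective map
    \<open>local_map G v\<close>.\<close>
  have "inj_on (\<iota> v) (carrier (lgrp LG v))" if v: "v \<in> verts LS" for v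
  proof (rule inj_onI)
    fix g h assume gh: "g \<in> carrier (lgrp LG v)" "h \<in> carrier (lgrp LG v)" "\<iota> v g = \<iota> v h"
    then have "Ad G\<gamma> (k v) (local_map G v g) = Ad G\<gamma> (k v) (local_map G v h)"
      using loc[OF v] by metis
    then have "local_map G v g = local_map G v h"
      using G.Ad_eq_iff k[OF v] group_morphismD(6)[OF group_morphism_local v] gh by blast
    then show "g = h" using inj_local_map[OF v] gh by (meson inj_onD)
  qed
  then have "developable LS LG"
    using developableI[OF complex_of_groups_local F.group_morphism_iota] sc unfolding M.D_def by blast
  moreover have "\<P> \<cong> G\<gamma>" using \<theta> by (auto simp: is_iso_def)
  moreover have "scwol_isomorphic M.D LD" using iso unfolding scwol_isomorphic_def by blast
  ultimately show ?thesis by (simp add: M.D_def)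
qed

end

theorem theorem1p1:
  fixes Y :: "('v, 'e) scwol_data" and G :: "('v, 'e, 'g) cog_data" and \<gamma> :: 'v
    and W :: "('e, 'e) jvert set" and T :: "('e, 'e \<times> 'e, 'e, 'e \<times> 'e) jedge set"
  assumes "complex_of_groups Y G"
    and "\<gamma> \<in> verts Y"
    and "maximal_tree (local_scwol Y \<gamma>) W T"
  shows "developable (local_scwol Y \<gamma>) (local_cog Y G \<gamma>) \<and>
    pi1 (local_scwol Y \<gamma>) (local_cog Y G \<gamma>) T \<cong> lgrp G \<gamma> \<and>
    scwol_isomorphic
      (development (local_scwol Y \<gamma>) (local_cog Y G \<gamma>) (pi1 (local_scwol Y \<gamma>) (local_cog Y G \<gamma>) T)
        (iota_grp (local_scwol Y \<gamma>) (local_cog Y G \<gamma>) T)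
        (iota_edge (local_scwol Y \<gamma>) (local_cog Y G \<gamma>) T))
      (local_development Y G \<gamma>)"
proof -
  interpret local_complex_tree Y G \<gamma> W T by unfold_locales fact+
  show ?thesis by (rule developable_pi1_development_local)
qed

end
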